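(* Let $n\ge 2$ and $0<\alpha<n$. Suppose that $\Omega$ satisfies the $L^{s;\beta}$-Dini smoothness condition $\mathfrak{D}_{s;\beta}$ with $n/(n-\alpha)\le s\le\infty$ and $0<\beta\le 1$. If $0<\alpha<1+n/p$, $n/\alpha<p<\infty$ and $\omega$ is a weight with $\omega^{s'}\in A(p/s',\infty)$, then the operator $T_{\Omega,\alpha}$ is bounded from $L^p(\omega^p)$ to $\mathcal{C}^{\gamma,\ell}_{\omega}$ with $1\le\ell<n/(n-\alpha)$, $\gamma:=n(\alpha/n-1/p)=\alpha-n/p$ and $\gamma<\beta$; that is, there is a constant $C>0$, independent of $f$, such that $$\|T_{\Omega,\alpha}f\|_{\mathcal{C}^{\gamma,\ell}_{\omega}}\le C\,\|f\|_{L^p(\omega^p)}\quad\text{for every } f\in L^p(\omega^p).$$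
   Context: Conventions. $s'$ is the conjugate exponent of $s$: $1/s+1/s'=1$, with $1'=\infty$ and $\infty'=1$. $m(E)$ is Lebesgue measure on $\mathbb R^n$. Balls $B$ are open Euclidean balls, and $h_B:=\frac1{m(B)}\int_B h(y)\,dy$. $\mathbb S^{n-1}$ is the unit sphere of $\mathbb R^n$ with normalized Lebesgue measure $d\sigma$. A weight is a nonnegative locally integrable function on $\mathbb R^n$ that takes values in $(0,\infty)$ almost everywhere. Operator. For $\Omega$ homogeneous of degree zero on $\mathbb R^n$ and integrable on $\mathbb S^{n-1}$, $$T_{\Omega,\alpha}f(x):=\int_{\mathbb R^n}\frac{\Omega(x-y)}{|x-y|^{n-\alpha}}f(y)\,dy.$$ Dini condition. For $1\le s<\infty$ set $$\omega_s(\delta):=\sup_{|\rho|<\delta}\Big(\int_{\mathbb S^{n-1}}|\Omega(\rho x')-\Omega(x')|^s\,d\sigma(x')\Big)^{1/s},$$ and for $s=\infty$ set $\omega_\infty(\delta):=\sup_{|\rho|<\delta,\,x'\in\mathbb S^{n-1}}|\Omega(\rho x')-\Omega(x')|$, where $\rho$ ranges over rotations of $\mathbb R^n$ and $|\rho|:=\sup_{x'\in\mathbb S^{n-1}}|\rho x'-x'|$. For $1\le s\le\infty$ and $0\le\beta\le1$, $\Omega$ satisfies $\mathfrak D_{s;\beta}$ if $\Omega$ is homogeneous of degree zero on $\mathbb R^n$, $\Omega\in L^s(\mathbb S^{n-1})$, and $\int_0^1\frac{\omega_s(\delta)}{\delta^{1+\beta}}\,d\delta<+\infty$. Weight class. For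 $1<r<\infty$, a weight $w$ belongs to $A(r,\infty)$ if there is $C>0$ such that for every ball $B$, $$\Big[\operatorname*{ess\,sup}_{x\in B}w(x)\Big]\Big(\frac1{m(B)}\int_B w(x)^{-r'}dx\Big)^{1/r'}\le C.$$ Spaces. $L^p(\omega^p)$ is the weighted Lebesgue space with norm $\|f\|_{L^p(\omega^p)}:=\big(\int_{\mathbb R^n}|f(x)|^p\omega(x)^p\,dx\big)^{1/p}$. For $1\le\ell<\infty$, $0\le\gamma\le1$, the Campanato space $\mathcal C^{\gamma,\ell}_\omega$ is the set of locally integrable $h$ on $\mathbb R^n$ with $$\|h\|_{\mathcal C^{\gamma,\ell}_\omega}:=\sup_{B}\Big[\operatorname*{ess\,sup}_{y\in B}\omega(y)\Big]\frac1{m(B)^{\gamma/n}}\Big(\frac1{m(B)}\int_B|h(x)-h_B|^\ell dx\Big)^{1/\ell}<+\infty,$$ the supremum being over all balls $B\subset\mathbb R^n$. *)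

theory Defs
  imports "HOL-Analysis.Analysis" "HOL-Probability.Essential_Supremum"
begin

text \<open>The ambient space is \<^typ>\<open>real^'n\<close>, so the dimension is \<open>CARD('n)\<close>. Functions are
  complex-valued and Lebesgue measurable; weights are real-valued. Quantities that may be infinite
  are taken in \<^typ>\<open>ennreal\<close>, so that no supremum or integral is silently truncated.\<close>

subsection \<open>Exponents\<close>

definition conj_exp :: "ennreal \<Rightarrow> ennreal" where
  "conj_exp s = inverse (1 - inverse s)"

lemma conj_exp_conjugate:
  assumes "1 \<le> s"
  shows "inverse s + inverse (conj_exp s) = 1"
proof -
  have "inverse s \<le> 1"
  proof (cases s)
    case (real r)
    with assms have "1 \<le> r" by (simp flip: ennreal_1)
    with real show ?thesis
      by (simp add: inverse_ennreal inverse_le_1_iff flip: ennreal_1)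
  qed simp
  moreover have "inverse (inverse x) = x" for x :: ennreal
  proof (cases x)
    case (real r)
    then show ?thesis
      by (cases "r = 0") (simp_all add: inverse_ennreal)
  qed simp
  ultimately show ?thesis
    by (simp add: conj_exp_def add_diff_inverse_ennreal)
qed

lemma conj_exp_1: "conj_exp 1 = top" and conj_exp_top: "conj_exp top = 1"
  by (simp_all add: conj_exp_def)

text \<open>Only used with exponents \<open>a > 0\<close>.\<close>

definition epowr :: "ennreal \<Rightarrow> real \<Rightarrow> ennreal" where
  "epowr x a = (if x = top then top else ennreal (enn2real x powr a))"

subsection \<open>Averages, local integrability, weights\<close>

definition locally_integrable :: "(real^'n \<Rightarrow> 'b::{banach, second_countable_topology}) \<Rightarrow> bool" where
  "locally_integrable h \<longleftrightarrow> (\<forall>K. compact K \<longrightarrow> set_integrable lebesgue K h)"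

definition avg :: "(real^'n) set \<Rightarrow> (real^'n \<Rightarrow> complex) \<Rightarrow> complex" where
  "avg B h = (1 / measure lebesgue B) *\<^sub>R (LINT y:B|lebesgue. h y)"

definition eavg :: "(real^'n) set \<Rightarrow> (real^'n \<Rightarrow> ennreal) \<Rightarrow> ennreal" where
  "eavg B g = (\<integral>\<^sup>+x\<in>B. g x \<partial>lebesgue) / emeasure lebesgue B"

definition esssup_on :: "(real^'n) set \<Rightarrow> (real^'n \<Rightarrow> real) \<Rightarrow> ennreal" where
  "esssup_on B w = esssup (lebesgue_on B) (\<lambda>x. ennreal (w x))"

definition weight :: "(real^'n \<Rightarrow> real) \<Rightarrow> bool" where
  "weight w \<longleftrightarrow> (\<forall>x. 0 \<le> w x) \<and> locally_integrable w \<and> (AE x in lebesgue. 0 < w x)"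

text \<open>The convention \<open>0 powr a = 0\<close> affects \<open>w x powr (- r')\<close> only on a null set, as a weight is
  positive almost everywhere.\<close>

definition A_infty :: "real \<Rightarrow> (real^'n \<Rightarrow> real) set" where
  "A_infty r = {w. weight w \<and>
     (let r' = enn2real (conj_exp (ennreal r)) in
       \<exists>C>0. \<forall>z R. R > 0 \<longrightarrow>
         esssup_on (ball z R) w * epowr (eavg (ball z R) (\<lambda>x. ennreal (w x powr (- r')))) (1 / r')
           \<le> ennreal C)}"

subsection \<open>Normalized surface measure and the Dini condition\<close>

text \<open>The normalized surface measure is the image of the uniform distribution on the unit ball under
  the radial projection \<open>sgn x = x /\<^sub>R norm x\<close>, that is,
  \<open>\<sigma>(A) = m {x. 0 < |x| < 1, x/|x| \<in> A} / m(B(0,1))\<close>, extended to its completion.\<close>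

definition sphere_measure :: "(real^'n) measure" where
  "sphere_measure =
     completion (restrict_space (distr (uniform_measure lborel (ball 0 1)) borel sgn) (sphere 0 1))"

definition rotation_size :: "real^'n^'n \<Rightarrow> real" where
  "rotation_size Q = (SUP x\<in>sphere 0 1. norm (Q *v x - x))"

definition dini_modulus :: "ennreal \<Rightarrow> (real^'n \<Rightarrow> complex) \<Rightarrow> real \<Rightarrow> ennreal" where
  "dini_modulus s \<Omega> \<delta> =
     (SUP Q\<in>{Q. rotation_matrix Q \<and> rotation_size Q < \<delta>}.
        if s = top then (SUP x\<in>sphere 0 1. ennreal (norm (\<Omega> (Q *v x) - \<Omega> x)))
        else epowr (\<integral>\<^sup>+x. ennreal (norm (\<Omega> (Q *v x) - \<Omega> x) powr enn2real s) \<partial>sphere_measure)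
               (1 / enn2real s))"

definition homogeneous_degree_zero :: "(real^'n \<Rightarrow> complex) \<Rightarrow> bool" where
  "homogeneous_degree_zero \<Omega> \<longleftrightarrow> (\<forall>t>0. \<forall>x. \<Omega> (t *\<^sub>R x) = \<Omega> x)"

definition Lp_sphere :: "ennreal \<Rightarrow> (real^'n \<Rightarrow> complex) set" where
  "Lp_sphere s = {\<Omega>. \<Omega> \<in> borel_measurable sphere_measure \<and>
     (if s = top then esssup sphere_measure (\<lambda>x. ennreal (norm (\<Omega> x))) < top
      else (\<integral>\<^sup>+x. ennreal (norm (\<Omega> x) powr enn2real s) \<partial>sphere_measure) < top)}"

definition dini :: "ennreal \<Rightarrow> real \<Rightarrow> (real^'n \<Rightarrow> complex) \<Rightarrow> bool" where
  "dini s \<beta> \<Omega> \<longleftrightarrow> homogeneous_degree_zero \<Omega> \<and> \<Omega> \<in> Lp_sphere s \<and>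
     (\<integral>\<^sup>+\<delta>\<in>{0<..<1}. dini_modulus s \<Omega> \<delta> / ennreal (\<delta> powr (1 + \<beta>)) \<partial>lborel) < top"

subsection \<open>The operator\<close>

text \<open>A Lebesgue integral, hence equal to 0 wherever it does not converge absolutely. For
  \<open>p > n/\<alpha>\<close> the integral may diverge at infinity for some \<open>f\<close> in the weighted Lebesgue space.\<close>

definition T_op :: "(real^'n \<Rightarrow> complex) \<Rightarrow> real \<Rightarrow> (real^'n \<Rightarrow> complex) \<Rightarrow> real^'n \<Rightarrow> complex" where
  "T_op \<Omega> \<alpha> f x =
     (LINT y|lebesgue. \<Omega> (x - y) / complex_of_real (norm (x - y) powr (real CARD('n) - \<alpha>)) * f y)"

subsection \<open>Function spaces\<close>

definition Lpw_norm :: "real \<Rightarrow> (real^'n \<Rightarrow> real) \<Rightarrow> (real^'n \<Rightarrow> complex) \<Rightarrow> ennreal" where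
  "Lpw_norm p w f = epowr (\<integral>\<^sup>+x. ennreal (norm (f x) powr p * w x powr p) \<partial>lebesgue) (1 / p)"

definition Lpw :: "real \<Rightarrow> (real^'n \<Rightarrow> real) \<Rightarrow> (real^'n \<Rightarrow> complex) set" where
  "Lpw p w = {f \<in> borel_measurable lebesgue. Lpw_norm p w f < top}"

definition campanato_norm ::
    "real \<Rightarrow> real \<Rightarrow> (real^'n \<Rightarrow> real) \<Rightarrow> (real^'n \<Rightarrow> complex) \<Rightarrow> ennreal" where
  "campanato_norm \<gamma> l w h =
     (SUP B\<in>{ball z R | z R. R > 0}.
        esssup_on B w * ennreal (1 / measure lebesgue B powr (\<gamma> / real CARD('n)))
        * epowr (eavg B (\<lambda>x. ennreal (norm (h x - avg B h) powr l))) (1 / l))"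

definition campanato :: "real \<Rightarrow> real \<Rightarrow> (real^'n \<Rightarrow> real) \<Rightarrow> (real^'n \<Rightarrow> complex) set" where
  "campanato \<gamma> l w = {h. locally_integrable h \<and> campanato_norm \<gamma> l w h < top}"

end

theory Submission
  imports Defs
begin

text \<open>
  Let \<open>n\<close> be the dimension, \<open>K u = \<Omega> u / norm u powr (n - \<alpha>)\<close> the kernel, and fix a ball \<open>B\<close> of centre
  \<open>z\<close> and radius \<open>R\<close>. It is enough to find one constant \<open>c\<close> such that the \<open>L\<^sup>l\<close> mean of \<open>T f - c\<close> over \<open>B\<close> is at
  most \<open>R powr \<gamma>\<close> times the norm of \<open>f\<close>, divided by the essential supremum of \<open>\<omega>\<close> over \<open>B\<close>
  (lemma \<open>mean_oscillation_le\<close>). The integral that defines \<open>T f\<close> is split at a fixed dyadic multiple of \<open>R\<close>.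

  The weight enters only through Hoelder's inequality. With \<open>1 / q = 1 / s' - 1 / p\<close>, the class
  condition bounds the \<open>L\<^sup>q\<close> mean of \<open>1 / \<omega>\<close> over a ball by a multiple of the inverse of the essential supremum of
  \<open>\<omega>\<close>. Hence the means of \<open>|f|\<close> of orders \<open>s'\<close> and 1 over every larger concentric ball are controlled, with the
  essential supremum over the small ball \<open>B\<close> (lemma \<open>weighted_Lp_local_bounds\<close>).

  The near part is a convolution of an integrable function with \<open>K\<close>, and \<open>K\<close> is locally in
  \<open>L\<^sup>l\<close> because \<open>l * (n - \<alpha>) < n\<close> and \<open>l \<le> s\<close> (lemmas \<open>nn_integral_rough_kernel_powr_ball\<close> and
  \<open>local_convolution_bound\<close>).

  For the far part, \<open>K (x - y) - K (z - y)\<close> is estimated on dyadic annuli by Hoelder's inequality with exponents \<open>s\<close>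
  and \<open>s'\<close>. On the annulus of radius \<open>2 ^ k * R\<close> the \<open>L\<^sup>s\<close> norm of this difference gains a factor
  consisting of the Dini modulus at scale about \<open>2 powr (- k)\<close> and of \<open>2 powr (- k)\<close>, while the remaining
  powers amount to \<open>(2 ^ k * R) powr \<gamma>\<close>. The series converges by the Dini condition, as \<open>\<gamma> < \<beta> \<le> 1\<close>
  (lemmas \<open>dini_kernel_regularity\<close> and \<open>far_difference_bound\<close>). The integral \<open>T f x\<close> itself may diverge at
  infinity, but its differences do not; so on \<open>B\<close> the far integral converges everywhere or nowhere, and in the
  second case \<open>T f\<close> vanishes on \<open>B\<close> (lemma \<open>convolution_near_constant\<close>).

  The gain on annuli is the heart of the matter: the Dini modulus speaks of rotations, but the kernel is
  translated. Averaging over an intermediate point reduces the claim to the mean of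
  \<open>|\<Omega> y - \<Omega> w|\<^sup>s\<close> over \<open>y\<close> in an annulus and \<open>w\<close> in a small ball around \<open>y\<close>. The points \<open>w\<close> near \<open>y\<close> are, up to
  dilations, the images of \<open>y\<close> under the rotations \<open>reflection v \<circ> reflection e\<close> with \<open>v\<close> near \<open>e\<close>, and \<open>w\<close> is a Lipschitz
  function of \<open>v\<close>. A change of variables, for which the Vitali covering lemma suffices, therefore bounds that mean
  by an average over rotations (lemmas \<open>nn_integral_sector_oscillation_le\<close> and
  \<open>nn_integral_shift_oscillation_le\<close>). All norms are expressed by duality (\<open>dual_bound\<close>), which covers \<open>s = \<infinity>\<close> as well.
\<close>

section \<open>Elementary power inequalities\<close>

text \<open>The inequality is trivial for \<open>k \<le> t\<close>; otherwise \<open>(k / t) powr (l - 1) \<ge> 1\<close>. It replaces Jensen's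
  inequality below: integrating it and choosing \<open>t\<close> bounds an \<open>L\<^sup>1\<close> norm by an \<open>L\<^sup>l\<close> norm, with
  a constant 2 that is harmless here.\<close>

lemma le_tangent_powr:
  fixes k t l :: real
  assumes "0 \<le> k" "0 < t" "1 \<le> l"
  shows "k \<le> t + t powr (1 - l) * k powr l"
proof (cases "k \<le> t")
  case True
  then show ?thesis by (smt (verit) mult_nonneg_nonneg powr_ge_zero)
next
  case False
  then have "k > 0" "t < k" using assms by auto
  have "1 \<le> (k / t) powr (l - 1)"
    using assms \<open>t < k\<close> by (intro ge_one_powr_ge_zero) auto
  then have "k * 1 \<le> k * (k / t) powr (l - 1)"
    using \<open>k > 0\<close> by (intro mult_left_mono) auto
  also have "\<dots> = k powr 1 * (k powr (l - 1) * t powr (1 - l))"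
    using \<open>k > 0\<close> assms powr_minus[of t "l - 1"] powr_divide[of k t "l - 1"]
    by (simp add: divide_inverse)
  also have "\<dots> = t powr (1 - l) * k powr l"
    by (simp only: mult.assoc[symmetric] powr_add[symmetric]) (simp add: mult.commute)
  finally show ?thesis using assms by linarith
qed

text \<open>Young's inequality without its sharp coefficients: whichever of the two powers is larger bounds
  the product by itself, because \<open>1 + p / q = p\<close>.\<close>

lemma mult_le_sum_conjugate_powr:
  fixes x y p q :: real
  assumes "0 \<le> x" "0 \<le> y" "1 < p" "1 / p + 1 / q = 1"
  shows "x * y \<le> x powr p + y powr q"
proof -
  have pq: "p + q = p * q" "1 < q"
  proof -
    have "q \<noteq> 0" using assms by auto
    then show *: "p + q = p * q" using assms by (simp add: field_simps)
    have "1 / q = 1 - 1 / p" "0 < 1 / p" "1 / p < 1" using assms by (auto simp: field_simps)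
    then have "0 < 1 / q" "1 / q < 1" by linarith+
    then have "0 < q" by simp
    with \<open>1 / q < 1\<close> show "1 < q" by (simp add: divide_less_eq)
  qed
  have exps: "1 + p / q = p" "1 + q / p = q"
    using pq assms(3) by (simp_all add: divide_simps)
  have *: "x * y \<le> x powr p" if "0 < x" "0 \<le> y" "y powr q \<le> x powr p" "0 < q" "1 + p / q = p" for x y p q :: real
  proof -
    have "y = (y powr q) powr (1/q)" using that by (simp add: powr_powr)
    also have "\<dots> \<le> (x powr p) powr (1/q)" using that by (intro powr_mono2) auto
    also have "\<dots> = x powr (p / q)" by (simp add: powr_powr)
    finally have "x * y \<le> x powr 1 * x powr (p / q)"
      using that by (simp add: mult_left_mono)
    also have "\<dots> = x powr p" using that by (simp only: powr_add[symmetric])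
    finally show ?thesis .
  qed
  show ?thesis
  proof (cases "x = 0 \<or> y = 0")
    case False
    then have "0 < x" "0 < y" using assms by auto
    then show ?thesis
      using *[of x y q p] *[of y x p q] exps assms pq
      by (cases "y powr q \<le> x powr p") (auto simp: mult.commute add_increasing add_increasing2)
  qed auto
qed

lemma powr_add_le:
  fixes x y p :: real
  assumes "0 \<le> x" "0 \<le> y" "0 \<le> p"
  shows "(x + y) powr p \<le> 2 powr p * (x powr p + y powr p)"
proof -
  have "(x + y) powr p \<le> (2 * max x y) powr p" using assms by (intro powr_mono2) auto
  also have "\<dots> = 2 powr p * max x y powr p" using assms by (intro powr_mult)
  also have "\<dots> \<le> 2 powr p * (x powr p + y powr p)"
    by (intro mult_left_mono) (auto simp: max_def)
  finally show ?thesis .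
qed

text \<open>Normalise by \<open>A\<close> and \<open>B\<close> and integrate the preceding inequality. The form with real bounds
  \<open>A\<close>, \<open>B\<close> in place of norms avoids all powers of possibly infinite integrals; this is how norms
  enter throughout.\<close>

lemma Holder_nn_integral:
  fixes f g :: "'a \<Rightarrow> real"
  assumes [measurable]: "f \<in> borel_measurable M" "g \<in> borel_measurable M"
    and nonneg: "\<And>x. 0 \<le> f x" "\<And>x. 0 \<le> g x"
    and "1 < p" "1 / p + 1 / q = 1" "0 < A" "0 < B"
    and f: "(\<integral>\<^sup>+x. ennreal (f x powr p) \<partial>M) \<le> ennreal (A powr p)"
    and g: "(\<integral>\<^sup>+x. ennreal (g x powr q) \<partial>M) \<le> ennreal (B powr q)"
  shows "(\<integral>\<^sup>+x. ennreal (f x * g x) \<partial>M) \<le> ennreal (2 * A * B)"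
proof -
  have *: "f x * g x \<le> A * B * (A powr (-p) * f x powr p + B powr (-q) * g x powr q)" for x
  proof -
    have "(f x / A) * (g x / B) \<le> (f x / A) powr p + (g x / B) powr q"
      using assms nonneg[of x] by (intro mult_le_sum_conjugate_powr) auto
    then have "A * B * ((f x / A) * (g x / B)) \<le> A * B * ((f x / A) powr p + (g x / B) powr q)"
      using assms by (intro mult_left_mono) auto
    moreover have "A * B * ((f x / A) * (g x / B)) = f x * g x" using assms by simp
    moreover have "(f x / A) powr p = A powr (-p) * f x powr p" "(g x / B) powr q = B powr (-q) * g x powr q"
      using assms(7,8) nonneg[of x] powr_divide[of "f x" A p] powr_divide[of "g x" B q]
      by (simp_all only: powr_minus divide_inverse mult.commute less_imp_le)
    ultimately show ?thesis by simp
  qed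
  have "(\<integral>\<^sup>+x. ennreal (f x * g x) \<partial>M) \<le>
     (\<integral>\<^sup>+x. ennreal (A * B) * (ennreal (A powr (-p)) * ennreal (f x powr p) + ennreal (B powr (-q)) * ennreal (g x powr q)) \<partial>M)"
    using * assms by (intro nn_integral_mono) (simp flip: ennreal_mult ennreal_plus)
  also have "\<dots> = ennreal (A * B) * (ennreal (A powr (-p)) * (\<integral>\<^sup>+x. ennreal (f x powr p) \<partial>M)
        + ennreal (B powr (-q)) * (\<integral>\<^sup>+x. ennreal (g x powr q) \<partial>M))"
    by (simp add: nn_integral_cmult nn_integral_add)
  also have "\<dots> \<le> ennreal (A * B) * (ennreal (A powr (-p)) * ennreal (A powr p)
        + ennreal (B powr (-q)) * ennreal (B powr q))"
    by (intro mult_left_mono add_mono f g) auto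
  also have "\<dots> = ennreal (A * B) * ennreal 2"
    using assms by (simp flip: ennreal_mult ennreal_plus powr_add)
  also have "\<dots> = ennreal (A * B * 2)" using assms by (intro ennreal_mult[symmetric]) auto
  also have "A * B * 2 = 2 * A * B" by simp
  finally show ?thesis .
qed

section \<open>Lipschitz images and Lebesgue measure\<close>

lemma emeasure_UN_countable_le:
  assumes [measurable]: "\<And>i. i \<in> I \<Longrightarrow> X i \<in> sets M" and I: "countable I"
  shows "emeasure M (\<Union>i\<in>I. X i) \<le> (\<integral>\<^sup>+i. emeasure M (X i) \<partial>count_space I)"
proof -
  have UN[measurable]: "(\<Union>i\<in>I. X i) \<in> sets M" using I by (intro sets.countable_UN') auto
  have "emeasure M (\<Union>i\<in>I. X i) = (\<integral>\<^sup>+x. indicator (\<Union>i\<in>I. X i) x \<partial>M)" by simp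
  also have "\<dots> \<le> (\<integral>\<^sup>+x. \<integral>\<^sup>+i. indicator (X i) x \<partial>count_space I \<partial>M)"
  proof (intro nn_integral_mono)
    fix x
    show "indicator (\<Union>i\<in>I. X i) x \<le> (\<integral>\<^sup>+i. indicator (X i) x \<partial>count_space I :: ennreal)"
    proof (cases "x \<in> (\<Union>i\<in>I. X i)")
      case True
      then obtain j where "j \<in> I" "x \<in> X j" by auto
      then have "1 = (\<integral>\<^sup>+i. indicator {j} i \<partial>count_space I :: ennreal)" by simp
      also have "\<dots> \<le> (\<integral>\<^sup>+i. indicator (X i) x \<partial>count_space I)"
        using \<open>x \<in> X j\<close> by (intro nn_integral_mono) (auto split: split_indicator)
      finally show ?thesis using True by simp
    qed simp
  qed
  also have "\<dots> = (\<integral>\<^sup>+i. \<integral>\<^sup>+x. indicator (X i) x \<partial>M \<partial>count_space I)"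
    by (subst nn_integral_count_space_nn_integral) (simp_all add: I)
  also have "\<dots> = (\<integral>\<^sup>+i. emeasure M (X i) \<partial>count_space I)"
    by (intro nn_integral_cong) simp
  finally show ?thesis .
qed

text \<open>Cover \<open>S\<close>, inside an open set of nearly the same measure, by balls. By the Vitali covering lemma
  a disjoint subfamily exists whose five-fold enlargements still cover \<open>S\<close>; their images lie in balls
  of radius \<open>5 * L\<close> times the original one, which gives the constant.\<close>

lemma emeasure_lborel_Lipschitz_image_le:
  fixes \<psi> :: "'a::euclidean_space \<Rightarrow> 'a"
  assumes T[measurable]: "T \<in> sets borel" and S[measurable]: "S \<in> sets borel"
    and sub: "T \<subseteq> \<psi> ` S" and L: "0 < L"
    and lip: "\<And>x y. x \<in> S \<Longrightarrow> y \<in> S \<Longrightarrow> norm (\<psi> x - \<psi> y) \<le> L * norm (x - y)"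
  shows "emeasure lborel T \<le> ennreal ((5 * L) ^ DIM('a)) * emeasure lborel S"
proof -
  let ?n = "DIM('a)"
  have key: "emeasure lborel T \<le> ennreal ((5 * L) ^ ?n) * emeasure lborel U"
    if "open U" "S \<subseteq> U" for U
  proof -
    have "\<exists>r>0. r \<le> 1 \<and> ball x r \<subseteq> U" if "x \<in> S" for x
    proof -
      obtain e where "e > 0" "ball x e \<subseteq> U" using \<open>open U\<close> \<open>x \<in> S\<close> \<open>S \<subseteq> U\<close>
        unfolding open_contains_ball by blast
      then show ?thesis by (intro exI[of _ "min e 1"]) auto
    qed
    then obtain r where r: "\<And>x. x \<in> S \<Longrightarrow> 0 < r x \<and> r x \<le> 1 \<and> ball x (r x) \<subseteq> U" by metis
    obtain C where C: "countable C" "C \<subseteq> S"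
      and disj: "pairwise (\<lambda>i j. disjnt (ball i (r i)) (ball j (r j))) C"
      and cov: "S \<subseteq> (\<Union>i\<in>C. ball i (5 * r i))"
      by (rule Vitali_covering_lemma_balls[where S = S and K = S and a = "\<lambda>x. x" and r = r and B = 1]) (use r in force)+
    have "T \<subseteq> (\<Union>i\<in>C. ball (\<psi> i) (5 * L * r i))"
    proof
      fix t assume "t \<in> T"
      then obtain x where x: "x \<in> S" "t = \<psi> x" using sub by auto
      then obtain i where i: "i \<in> C" "dist i x < 5 * r i" using cov by auto
      have "norm (\<psi> i - \<psi> x) \<le> L * norm (i - x)" using x i C by (intro lip) auto
      also have "\<dots> < L * (5 * r i)" using L i by (intro mult_strict_left_mono) (auto simp: dist_norm)
      finally show "t \<in> (\<Union>i\<in>C. ball (\<psi> i) (5 * L * r i))" using i x by (auto simp: dist_norm mult_ac)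
    qed
    then have "emeasure lborel T \<le> emeasure lborel (\<Union>i\<in>C. ball (\<psi> i) (5 * L * r i))"
      by (intro emeasure_mono) (use C in auto)
    also have "\<dots> \<le> (\<integral>\<^sup>+i. emeasure lborel (ball (\<psi> i) (5 * L * r i)) \<partial>count_space C)"
      using C by (intro emeasure_UN_countable_le) auto
    also have "\<dots> = (\<integral>\<^sup>+i. ennreal ((5 * L) ^ ?n) * emeasure lborel (ball i (r i)) \<partial>count_space C)"
    proof (intro nn_integral_cong)
      fix i assume "i \<in> space (count_space C)"
      then have "0 < r i" using C r by auto
      then show "emeasure lborel (ball (\<psi> i) (5 * L * r i)) = ennreal ((5 * L) ^ ?n) * emeasure lborel (ball i (r i))"
        using L by (simp add: emeasure_ball power_mult_distrib mult_ac flip: ennreal_mult)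
    qed
    also have "\<dots> = ennreal ((5 * L) ^ ?n) * (\<integral>\<^sup>+i. emeasure lborel (ball i (r i)) \<partial>count_space C)"
      by (simp add: nn_integral_cmult)
    also have "(\<integral>\<^sup>+i. emeasure lborel (ball i (r i)) \<partial>count_space C) = emeasure lborel (\<Union>i\<in>C. ball i (r i))"
      using C disj by (intro emeasure_UN_countable[symmetric])
        (auto simp: disjoint_family_on_def pairwise_def disjnt_def)
    also have "\<dots> \<le> emeasure lborel U"
      using that r C by (intro emeasure_mono) auto
    finally show ?thesis by (simp add: mult_left_mono)
  qed
  show ?thesis
  proof (cases "emeasure lborel S = \<infinity>")
    case True
    then show ?thesis using L by (simp add: ennreal_mult_top)
  next
    case False
    then obtain s where s: "emeasure lborel S = ennreal s" "0 \<le> s" by (cases "emeasure lborel S") auto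
    show ?thesis
    proof (rule ennreal_le_epsilon)
      fix e :: real assume "0 < e"
      define d where "d = e / (5 * L) ^ ?n"
      have "d > 0" using \<open>0 < e\<close> L by (simp add: d_def)
      obtain U where U: "open U" "S \<subseteq> U" "emeasure lborel (U - S) < d"
        using outer_regular_lborel[OF S \<open>d > 0\<close>] by auto
      have "emeasure lborel U = emeasure lborel (S \<union> (U - S))" using U by (simp add: Un_absorb1)
      also have "\<dots> \<le> emeasure lborel S + emeasure lborel (U - S)"
        using U by (intro emeasure_subadditive) auto
      also have "\<dots> \<le> emeasure lborel S + ennreal d" using U by (intro add_left_mono) auto
      finally have "ennreal ((5 * L) ^ ?n) * emeasure lborel U \<le> ennreal ((5 * L) ^ ?n) * (emeasure lborel S + ennreal d)"
        by (intro mult_left_mono) auto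
      also have "\<dots> = ennreal ((5 * L) ^ ?n) * emeasure lborel S + ennreal e"
        using L \<open>0 < e\<close> by (simp add: distrib_left d_def flip: ennreal_mult)
      finally show "emeasure lborel T \<le> ennreal ((5 * L) ^ DIM('a)) * emeasure lborel S + ennreal e"
        using key[OF U(1,2)] by simp
    qed
  qed
qed

text \<open>A change of variables as an inequality: by the previous lemma, Lebesgue measure on \<open>T\<close> is at most a
  multiple of the image under \<open>\<psi>\<close> of Lebesgue measure on \<open>S\<close>.\<close>

lemma nn_integral_Lipschitz_image_le:
  fixes \<psi> :: "'a::euclidean_space \<Rightarrow> 'a" and F :: "'a \<Rightarrow> ennreal"
  assumes T[measurable]: "T \<in> sets borel" and S[measurable]: "S \<in> sets borel"
    and [measurable]: "\<psi> \<in> borel_measurable borel" "F \<in> borel_measurable borel"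
    and sub: "T \<subseteq> \<psi> ` S" and L: "0 < L"
    and lip: "\<And>x y. x \<in> S \<Longrightarrow> y \<in> S \<Longrightarrow> norm (\<psi> x - \<psi> y) \<le> L * norm (x - y)"
  shows "(\<integral>\<^sup>+w\<in>T. F w \<partial>lborel) \<le> ennreal ((5 * L) ^ DIM('a)) * (\<integral>\<^sup>+v\<in>S. F (\<psi> v) \<partial>lborel)"
proof -
  let ?c = "ennreal ((5 * L) ^ DIM('a))"
  let ?N = "distr (density lborel (\<lambda>v. ?c * indicator S v)) borel \<psi>"
  have "(\<integral>\<^sup>+w\<in>T. F w \<partial>lborel) = (\<integral>\<^sup>+w. F w \<partial>density lborel (indicator T))"
    by (subst nn_integral_density) (auto simp: mult.commute)
  also have "\<dots> \<le> (\<integral>\<^sup>+w. F w \<partial>?N)"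
  proof (rule nn_integral_mono_measure)
    show "density lborel (indicator T) \<le> ?N"
    proof (rule le_measure[THEN iffD2, OF _ ballI])
      show "emeasure (density lborel (indicator T)) A \<le> emeasure ?N A" for A
      proof (cases "A \<in> sets borel")
        case True
        note [measurable] = True
        have pre: "\<psi> -` A \<in> sets borel" using measurable_sets[of \<psi> borel borel A] True by simp
        have "emeasure (density lborel (indicator T)) A = emeasure lborel (T \<inter> A)"
          by (subst emeasure_density) (auto simp flip: indicator_inter_arith)
        also have "\<dots> \<le> ?c * emeasure lborel (S \<inter> \<psi> -` A)"
          by (rule emeasure_lborel_Lipschitz_image_le[where \<psi> = \<psi>]) (use sub L lip pre in auto)
        also have "emeasure lborel (S \<inter> \<psi> -` A) = (\<integral>\<^sup>+v. indicator S v * indicator (\<psi> -` A) v \<partial>lborel)"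
          using pre by (subst indicator_inter_arith[symmetric]) simp
        also have "?c * \<dots> = (\<integral>\<^sup>+v. ?c * indicator S v * indicator (\<psi> -` A) v \<partial>lborel)"
          using pre by (subst nn_integral_cmult[symmetric]) (auto simp: mult.assoc)
        also have "\<dots> = emeasure ?N A"
          using pre by (simp add: emeasure_distr emeasure_density)
        finally show ?thesis .
      qed (simp add: emeasure_notin_sets)
    qed simp
  qed simp
  also have "\<dots> = (\<integral>\<^sup>+v. ?c * (F (\<psi> v) * indicator S v) \<partial>lborel)"
    by (simp add: nn_integral_distr nn_integral_density mult.assoc) (simp only: mult.commute)
  also have "\<dots> = ?c * (\<integral>\<^sup>+v\<in>S. F (\<psi> v) \<partial>lborel)"
    by (rule nn_integral_cmult) auto
  finally show ?thesis .
qed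

section \<open>Rotations as products of two reflections\<close>

definition reflection :: "'a::real_inner \<Rightarrow> 'a \<Rightarrow> 'a" where
  "reflection v x = x - (2 * (v \<bullet> x) / (v \<bullet> v)) *\<^sub>R v"

lemma linear_reflection: "linear (reflection v)"
  by (rule linearI) (simp_all add: reflection_def inner_add_right algebra_simps add_divide_distrib)

lemma inner_reflection: "reflection v x \<bullet> reflection v y = x \<bullet> y"
proof (cases "v = 0")
  case False
  then have "v \<bullet> v \<noteq> 0" by simp
  then show ?thesis
    by (simp add: reflection_def inner_diff_left inner_diff_right inner_commute field_simps)
qed (simp add: reflection_def)

lemma norm_reflection [simp]: "norm (reflection v x) = norm x"
  by (simp add: norm_eq_sqrt_inner inner_reflection)

lemma reflection_scaleR: "c \<noteq> 0 \<Longrightarrow> reflection (c *\<^sub>R v) = reflection v"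
  by (rule ext) (simp add: reflection_def)

lemma reflection_scaleR_right: "reflection v (c *\<^sub>R x) = c *\<^sub>R reflection v x"
  using linear_reflection by (rule linear_cmul)

lemma reflection_self [simp]: "reflection v v = - v"
  by (cases "v = 0") (simp_all add: reflection_def scaleR_2)

lemma reflection_involutory [simp]: "reflection v (reflection v x) = x"
proof (cases "v = 0")
  case False
  then show ?thesis
    by (simp add: reflection_def inner_diff_right)
qed (simp add: reflection_def)

lemma orthogonal_transformation_reflection: "orthogonal_transformation (reflection v)"
  by (simp add: orthogonal_transformation_def linear_reflection inner_reflection)

text \<open>An orthogonal map that carries the line of \<open>v\<close> to the line of \<open>e\<close> conjugates one reflection into
  the other, so both have the same determinant \<open>\<plusminus>1\<close> and the product has determinant 1.\<close>

lemma rotation_matrix_reflection_reflection: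
  fixes v e :: "real^'n"
  assumes "v \<noteq> 0" "e \<noteq> 0"
  shows "rotation_matrix (matrix (reflection v \<circ> reflection e))"
proof -
  define a where "a = (norm e / norm v) *\<^sub>R v"
  have "norm a = norm e" using assms by (simp add: a_def)
  then obtain U where U: "orthogonal_transformation U" "U a = e"
    using orthogonal_transformation_exists by blast
  have lin: "linear U" using U by (simp add: orthogonal_transformation_linear)
  have "reflection a = reflection v"
    using assms by (simp add: a_def reflection_scaleR)
  have "U \<circ> reflection a = reflection e \<circ> U"
  proof
    fix x
    have "U x \<bullet> U y = x \<bullet> y" for x y using U(1) by (simp add: orthogonal_transformation_def)
    from this[of a x] this[of a a] U(2)
    show "(U \<circ> reflection a) x = (reflection e \<circ> U) x"
      by (simp add: reflection_def linear_diff[OF lin] linear_cmul[OF lin])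
  qed
  then have "matrix U ** matrix (reflection v) = matrix (reflection e) ** matrix U"
    using \<open>reflection a = reflection v\<close> lin linear_reflection by (metis matrix_compose)
  then have "det (matrix U) * det (matrix (reflection v)) = det (matrix (reflection e)) * det (matrix U)"
    by (metis det_mul)
  moreover have "\<bar>det (matrix U)\<bar> = 1"
    using U(1) det_orthogonal_matrix[of "matrix U"] by (auto simp: orthogonal_transformation_matrix)
  ultimately have eq: "det (matrix (reflection v)) = det (matrix (reflection e))" by auto
  have om: "orthogonal_matrix (matrix (reflection u))" for u :: "real^'n"
    using orthogonal_transformation_reflection orthogonal_transformation_matrix by blast
  have mul: "matrix (reflection v \<circ> reflection e) = matrix (reflection v) ** matrix (reflection e)"
    by (intro matrix_compose linear_reflection)
  show ?thesis
    unfolding rotation_matrix_def mul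
    using om det_orthogonal_matrix[OF om, of v] eq
    by (auto simp: orthogonal_matrix_mul det_mul)
qed

text \<open>With \<open>y = reflection e x\<close> one has \<open>x = reflection e y\<close>, so the left-hand side compares two
  reflections of the same unit vector \<open>y\<close>, and \<open>v \<mapsto> reflection v y\<close> is Lipschitz near the unit
  sphere.\<close>

lemma norm_reflection_reflection_diff_le:
  fixes v e x :: "'a::real_inner"
  assumes e: "norm e = 1" and ve: "norm (v - e) \<le> 1/2" and x: "norm x = 1"
  shows "norm (reflection v (reflection e x) - x) \<le> 40 * norm (v - e)"
proof -
  define y where "y = reflection e x"
  have y: "norm y = 1" "x = reflection e y" using x by (simp_all add: y_def)
  define h where "h = v - e"
  have v: "v = e + h" by (simp add: h_def)
  have nv: "1/2 \<le> norm v" "norm v \<le> 3/2"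
    using norm_triangle_ineq2[of v e] norm_triangle_ineq2[of e v] e ve by (auto simp: norm_minus_commute)
  have vv: "1/4 \<le> v \<bullet> v" "v \<bullet> v > 0"
  proof -
    have "(1/2)\<^sup>2 \<le> (norm v)\<^sup>2" using nv by (intro power_mono) auto
    then show "1/4 \<le> v \<bullet> v" unfolding power2_norm_eq_inner by (simp add: power2_eq_square)
    then show "v \<bullet> v > 0" by linarith
  qed
  have ee: "e \<bullet> e = 1" using e by (simp add: norm_eq_sqrt_inner)
  have "reflection v y - x = (2 / (v \<bullet> v)) *\<^sub>R ((v \<bullet> v * (e \<bullet> y)) *\<^sub>R e - (v \<bullet> y) *\<^sub>R v)"
    using vv by (simp add: y(2) reflection_def ee scaleR_diff_right)
  also have "norm \<dots> = 2 / (v \<bullet> v) * norm ((v \<bullet> v * (e \<bullet> y)) *\<^sub>R e - (v \<bullet> y) *\<^sub>R v)"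
    using vv by simp
  also have "(v \<bullet> v * (e \<bullet> y)) *\<^sub>R e - (v \<bullet> y) *\<^sub>R v
      = ((v \<bullet> v - 1) * (e \<bullet> y)) *\<^sub>R e - (h \<bullet> y) *\<^sub>R v - (e \<bullet> y) *\<^sub>R h"
    by (simp add: v algebra_simps inner_add_left)
  also have "norm \<dots> \<le> norm (((v \<bullet> v - 1) * (e \<bullet> y)) *\<^sub>R e) + norm ((h \<bullet> y) *\<^sub>R v) + norm ((e \<bullet> y) *\<^sub>R h)"
    by (meson norm_triangle_ineq4 order_trans add_right_mono)
  also have "\<dots> \<le> 5/2 * norm h + 3/2 * norm h + norm h"
  proof (intro add_mono)
    have "v \<bullet> v - 1 = h \<bullet> (v + e)" by (simp add: v ee inner_add_left inner_add_right inner_commute)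
    then have "\<bar>v \<bullet> v - 1\<bar> \<le> norm h * norm (v + e)" by (metis Cauchy_Schwarz_ineq2)
    also have "\<dots> \<le> norm h * (5/2)"
      using norm_triangle_ineq[of v e] nv e by (intro mult_left_mono) auto
    finally have 1: "\<bar>v \<bullet> v - 1\<bar> \<le> 5/2 * norm h" by simp
    have 2: "\<bar>e \<bullet> y\<bar> \<le> 1" using Cauchy_Schwarz_ineq2[of e y] e y by simp
    show "norm (((v \<bullet> v - 1) * (e \<bullet> y)) *\<^sub>R e) \<le> 5/2 * norm h"
      using mult_mono[OF 1 2] e by (simp add: abs_mult)
    have "\<bar>h \<bullet> y\<bar> \<le> norm h" using Cauchy_Schwarz_ineq2[of h y] y by simp
    from mult_mono[OF this nv(2)] show "norm ((h \<bullet> y) *\<^sub>R v) \<le> 3/2 * norm h" by simp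
    show "norm ((e \<bullet> y) *\<^sub>R h) \<le> norm h" using mult_right_mono[OF 2, of "norm h"] by simp
  qed
  also have "2 / (v \<bullet> v) * (5/2 * norm h + 3/2 * norm h + norm h) \<le> 8 * (5/2 * norm h + 3/2 * norm h + norm h)"
    using vv by (intro mult_right_mono) (auto simp: divide_simps)
  finally have "norm (reflection v y - x) \<le> 40 * norm h"
    using vv by (simp add: mult_left_mono divide_right_mono)
  then show ?thesis by (simp add: y_def h_def)
qed

lemma rotation_size_reflection_reflection_le:
  fixes v e :: "real^'n"
  assumes "norm e = 1" "norm (v - e) \<le> 1/2"
  shows "rotation_size (matrix (reflection v \<circ> reflection e)) \<le> 40 * norm (v - e)"
proof -
  have lin: "linear (reflection v \<circ> reflection e)" by (intro linear_compose linear_reflection)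
  show ?thesis
    unfolding rotation_size_def fun_cong[OF matrix_vector_mul(2)[OF lin]]
  proof (rule cSUP_least)
    have "axis undefined (1::real) \<in> sphere (0::real^'n) 1" by (simp add: norm_axis_1)
    then show "sphere (0::real^'n) 1 \<noteq> {}" by blast
  qed (use norm_reflection_reflection_diff_le[OF assms] in auto)
qed

text \<open>For unit vectors, reflecting \<open>u\<close> in its own hyperplane gives \<open>- u\<close>, and the reflection along
  \<open>u + w\<close> sends \<open>- u\<close> to \<open>w\<close>.\<close>

lemma rotation_between:
  fixes u w :: "real^'n"
  assumes "norm u = 1" "norm w = 1" "norm (w - u) \<le> 1"
  obtains Q where "rotation_matrix Q" "Q *v u = w" "rotation_size Q \<le> 20 * norm (w - u)"
proof -
  define v where "v = (1/2) *\<^sub>R (u + w)"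
  have vu: "norm (v - u) = norm (w - u) / 2"
  proof -
    have "v - u = (1/2) *\<^sub>R (u + w) - (1/2) *\<^sub>R (u + u)" by (simp add: v_def)
    also have "\<dots> = (1/2) *\<^sub>R (w - u)" by (subst scaleR_diff_right[symmetric]) simp
    finally have "v - u = (1/2) *\<^sub>R (w - u)" .
    then show ?thesis by simp
  qed
  have "u + w \<noteq> 0" using assms
  proof -
    have "norm u \<le> norm (v - u) + norm v" by (metis norm_triangle_sub norm_minus_commute add.commute)
    then have "norm v \<ge> 1/2" using vu assms by simp
    then show ?thesis by (auto simp: v_def)
  qed
  then have "v \<noteq> 0" "u \<noteq> 0" using assms by (auto simp: v_def)
  have uu: "u \<bullet> u = 1" "w \<bullet> w = 1" using assms by (simp_all add: norm_eq_sqrt_inner)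
  have "2 * ((u + w) \<bullet> u) = (u + w) \<bullet> (u + w)"
    using uu by (simp add: inner_add_left inner_add_right inner_commute)
  moreover have "(u + w) \<bullet> (u + w) \<noteq> 0" using \<open>u + w \<noteq> 0\<close> by (simp only: inner_eq_zero_iff not_False_eq_True)
  ultimately have "reflection (u + w) u = - w" by (simp add: reflection_def)
  then have *: "reflection v (- u) = w"
    using reflection_scaleR[of "1/2" "u + w"] reflection_scaleR_right[of "u + w" "-1" u] by (simp add: v_def)
  let ?Q = "matrix (reflection v \<circ> reflection u)"
  have "?Q *v u = w"
    using fun_cong[OF matrix_vector_mul(2)[of "reflection v \<circ> reflection u"], of u] *
    by (simp add: linear_compose linear_reflection)
  moreover have "rotation_size ?Q \<le> 20 * norm (w - u)"
    using rotation_size_reflection_reflection_le[of u v] assms vu by simp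
  ultimately show thesis
    using that[of ?Q] rotation_matrix_reflection_reflection[OF \<open>v \<noteq> 0\<close> \<open>u \<noteq> 0\<close>] by blast
qed

text \<open>The image of a multiple of \<open>q\<close> under the reflection along \<open>v\<close>, the multiple being chosen so that
  the displacement is \<open>v\<close> itself: \<open>reflected_point q v\<close> and its mirror image differ by \<open>v\<close>. As a
  function of \<open>v\<close> it is rational.\<close>

definition reflected_point :: "'a::real_inner \<Rightarrow> 'a \<Rightarrow> 'a" where
  "reflected_point q v = (v \<bullet> v / (2 * (v \<bullet> q))) *\<^sub>R q - v"

lemma reflected_point_eq_reflection:
  assumes "v \<bullet> q \<noteq> 0"
  shows "reflected_point q v = (v \<bullet> v / (2 * (v \<bullet> q))) *\<^sub>R reflection v q"
proof -
  have "v \<bullet> v \<noteq> 0" using assms by auto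
  then show ?thesis using assms
    by (simp add: reflected_point_def reflection_def scaleR_diff_right)
qed

text \<open>For unit \<open>q\<close> the difference \<open>norm w *\<^sub>R q - w\<close> of two vectors of equal length is the axis of the
  reflection that exchanges them; \<open>reflected_point q\<close> recovers \<open>w\<close> from it, length included.\<close>

lemma reflected_point_surj:
  fixes q w :: "'a::real_inner"
  assumes "norm q = 1" "(norm w *\<^sub>R q - w) \<bullet> q \<noteq> 0"
  shows "reflected_point q (norm w *\<^sub>R q - w) = w"
proof -
  define v where "v = norm w *\<^sub>R q - w"
  have qq: "q \<bullet> q = 1" using assms by (simp add: norm_eq_sqrt_inner)
  have "w \<bullet> w = norm w * norm w" by (simp add: power2_norm_eq_inner[symmetric] power2_eq_square)
  then have "v \<bullet> v = norm w * (2 * (v \<bullet> q))"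
    using qq by (simp add: v_def inner_diff_left inner_diff_right inner_commute algebra_simps)
  moreover have "v \<bullet> q \<noteq> 0" using assms by (simp add: v_def)
  ultimately have "v \<bullet> v / (2 * (v \<bullet> q)) = norm w" by simp
  then have "reflected_point q v = w" by (simp add: reflected_point_def) (simp add: v_def)
  then show ?thesis by (simp add: v_def)
qed

text \<open>The map is rational, so difference quotients are estimated directly, away from the zero set of its
  denominator.\<close>

lemma reflected_point_Lipschitz:
  fixes q v v' :: "'a::real_inner"
  assumes "norm q = 1" "norm v \<le> M" "norm v' \<le> M" "m \<le> v \<bullet> q" "m \<le> v' \<bullet> q" "0 < m"
  shows "norm (reflected_point q v - reflected_point q v') \<le> (3 * M\<^sup>2 / (2 * m\<^sup>2) + 1) * norm (v - v')"
proof -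
  have pos: "0 < v \<bullet> q" "0 < v' \<bullet> q" and M: "0 \<le> M" using assms norm_ge_zero[of v] by linarith+
  define D where "D = v \<bullet> v / (2 * (v \<bullet> q)) - v' \<bullet> v' / (2 * (v' \<bullet> q))"
  have D: "D = ((v \<bullet> v) * ((v' - v) \<bullet> q) + ((v - v') \<bullet> (v + v')) * (v \<bullet> q)) / (2 * (v \<bullet> q) * (v' \<bullet> q))"
    using pos by (simp add: D_def field_simps inner_diff_left inner_diff_right inner_add_right inner_commute)
  have "\<bar>(v \<bullet> v) * ((v' - v) \<bullet> q) + ((v - v') \<bullet> (v + v')) * (v \<bullet> q)\<bar>
     \<le> M * M * norm (v - v') + norm (v - v') * (M + M) * M"
  proof (rule order_trans[OF abs_triangle_ineq] , intro add_mono)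
    have "\<bar>v \<bullet> v\<bar> \<le> M * M" using Cauchy_Schwarz_ineq2[of v v] mult_mono[OF assms(2) assms(2) M] by simp
    moreover have "\<bar>(v' - v) \<bullet> q\<bar> \<le> norm (v - v')"
      using Cauchy_Schwarz_ineq2[of "v' - v" q] assms by (simp add: norm_minus_commute)
    ultimately show "\<bar>(v \<bullet> v) * ((v' - v) \<bullet> q)\<bar> \<le> M * M * norm (v - v')"
      unfolding abs_mult by (intro mult_mono) auto
    have "\<bar>(v - v') \<bullet> (v + v')\<bar> \<le> norm (v - v') * norm (v + v')" by (rule Cauchy_Schwarz_ineq2)
    also have "\<dots> \<le> norm (v - v') * (M + M)"
      using norm_triangle_ineq[of v v'] assms by (intro mult_left_mono) auto
    finally have "\<bar>(v - v') \<bullet> (v + v')\<bar> \<le> norm (v - v') * (M + M)" .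
    moreover have "\<bar>v \<bullet> q\<bar> \<le> M" using Cauchy_Schwarz_ineq2[of v q] assms by simp
    ultimately show "\<bar>((v - v') \<bullet> (v + v')) * (v \<bullet> q)\<bar> \<le> norm (v - v') * (M + M) * M"
      unfolding abs_mult using M by (intro mult_mono) auto
  qed
  also have "\<dots> = 3 * M\<^sup>2 * norm (v - v')" by (simp add: power2_eq_square algebra_simps)
  finally have "\<bar>D\<bar> \<le> 3 * M\<^sup>2 * norm (v - v') / (2 * (v \<bullet> q) * (v' \<bullet> q))"
    unfolding D using pos by (simp add: abs_mult divide_right_mono)
  also have "\<dots> \<le> 3 * M\<^sup>2 * norm (v - v') / (2 * m\<^sup>2)"
    using assms pos by (intro divide_left_mono) (auto simp: power2_eq_square mult_mono)
  finally have "\<bar>D\<bar> \<le> 3 * M\<^sup>2 / (2 * m\<^sup>2) * norm (v - v')" by simp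
  moreover have "reflected_point q v - reflected_point q v' = D *\<^sub>R q - (v - v')"
    by (simp add: reflected_point_def D_def scaleR_diff_left)
  then have "norm (reflected_point q v - reflected_point q v') \<le> \<bar>D\<bar> + norm (v - v')"
    using norm_triangle_ineq4[of "D *\<^sub>R q" "v - v'"] assms by simp
  ultimately show ?thesis by (simp add: distrib_right)
qed

section \<open>Translation oscillation is controlled by rotation oscillation\<close>

lemma nn_integral_lborel_affine:
  fixes F :: "'a::euclidean_space \<Rightarrow> ennreal"
  assumes [measurable]: "F \<in> borel_measurable borel" and c: "c \<noteq> 0"
  shows "(\<integral>\<^sup>+x. F x \<partial>lborel) = ennreal (\<bar>c\<bar> ^ DIM('a)) * (\<integral>\<^sup>+x. F (t + c *\<^sub>R x) \<partial>lborel)"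
  by (subst lborel_affine[OF c, of t]) (simp add: nn_integral_density nn_integral_distr nn_integral_cmult)

lemma nn_integral_lborel_translate:
  fixes F :: "'a::euclidean_space \<Rightarrow> ennreal"
  assumes [measurable]: "F \<in> borel_measurable borel"
  shows "(\<integral>\<^sup>+x. F (x - a) \<partial>lborel) = (\<integral>\<^sup>+x. F x \<partial>lborel)"
  using nn_integral_lborel_affine[of F 1 "-a"] by simp

lemma nn_integral_lborel_scale:
  fixes F :: "'a::euclidean_space \<Rightarrow> ennreal"
  assumes [measurable]: "F \<in> borel_measurable borel" "S \<in> sets borel" and c: "0 < c"
  shows "(\<integral>\<^sup>+x\<in>(*\<^sub>R) c ` S. F x \<partial>lborel) = ennreal (c ^ DIM('a)) * (\<integral>\<^sup>+x\<in>S. F (c *\<^sub>R x) \<partial>lborel)"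
proof -
  have im: "(*\<^sub>R) c ` S = (\<lambda>x. x /\<^sub>R c) -` S" using c
    by (auto simp: image_iff) (metis c divideR_right order_less_irrefl)
  have [measurable]: "(*\<^sub>R) c ` S \<in> sets borel"
    unfolding im using measurable_sets[of "\<lambda>x. x /\<^sub>R c" borel borel S] by simp
  have "(\<integral>\<^sup>+x\<in>(*\<^sub>R) c ` S. F x \<partial>lborel)
      = ennreal (\<bar>c\<bar> ^ DIM('a)) * (\<integral>\<^sup>+x. F (0 + c *\<^sub>R x) * indicator ((*\<^sub>R) c ` S) (0 + c *\<^sub>R x) \<partial>lborel)"
    using c by (intro nn_integral_lborel_affine[where t = 0 and F = "\<lambda>x. F x * indicator ((*\<^sub>R) c ` S) x"]) auto
  also have "(\<integral>\<^sup>+x. F (0 + c *\<^sub>R x) * indicator ((*\<^sub>R) c ` S) (0 + c *\<^sub>R x) \<partial>lborel) = (\<integral>\<^sup>+x\<in>S. F (c *\<^sub>R x) \<partial>lborel)"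
    using c by (intro nn_integral_cong) (auto simp: im split: split_indicator)
  finally show ?thesis using c by simp
qed

lemma nn_integral_ball_scale:
  fixes F :: "'a::euclidean_space \<Rightarrow> ennreal"
  assumes "F \<in> borel_measurable borel" "0 < c"
  shows "(\<integral>\<^sup>+x\<in>ball 0 c. F x \<partial>lborel) = ennreal (c ^ DIM('a)) * (\<integral>\<^sup>+x\<in>ball 0 1. F (c *\<^sub>R x) \<partial>lborel)"
proof -
  have "(*\<^sub>R) c ` ball 0 1 = (ball 0 c :: 'a set)" using assms by (simp add: ball_scale)
  then show ?thesis using nn_integral_lborel_scale[of F "ball 0 1" c] assms by simp
qed

text \<open>Compare \<open>O' y\<close> with \<open>O' w\<close> for all \<open>w\<close> near \<open>y\<close> by rotations. Up to a dilation, which \<open>O'\<close> does not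
  see, every such \<open>w\<close> is \<open>reflection v (reflection e y)\<close> for a \<open>v\<close> within \<open>O(\<delta>)\<close> of \<open>e\<close>, and the
  dependence of \<open>w\<close> on \<open>v\<close> is Lipschitz as long as \<open>y\<close> stays away from the hyperplane orthogonal to
  \<open>e\<close>; hence the sector. The integral over \<open>w\<close> is thus at most one over \<open>v\<close>, and after exchanging the
  order of integration each \<open>v\<close> contributes the oscillation of \<open>O'\<close> under a single small rotation. Here
  \<open>v\<close> differs from \<open>e\<close> by less than \<open>2 * sqrt n * \<delta>\<close> for the dimension \<open>n\<close>, and the rotation has at most
  40 times this size; hence the factor 80.\<close>

lemma nn_integral_sector_oscillation_le:
  fixes O' :: "real^'n \<Rightarrow> complex" and e :: "real^'n"
  assumes [measurable]: "O' \<in> borel_measurable borel" and hom: "homogeneous_degree_zero O'"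
    and e: "norm e = 1" and \<delta>: "0 < \<delta>" "\<delta> \<le> 1 / (4 * real CARD('n))"
    and d: "80 * sqrt (real CARD('n)) * \<delta> \<le> d"
    and E: "\<And>Q. rotation_matrix Q \<Longrightarrow> rotation_size Q < d \<Longrightarrow>
      (\<integral>\<^sup>+x\<in>ball 0 1. ennreal (norm (O' (Q *v x) - O' x) powr s) \<partial>lborel) \<le> E"
  defines "Sct \<equiv> {y::real^'n. 1/2 \<le> norm y \<and> norm y < 3 \<and> norm y / sqrt (real CARD('n)) \<le> - (e \<bullet> y)}"
  shows "(\<integral>\<^sup>+y\<in>Sct. (\<integral>\<^sup>+w\<in>ball y \<delta>. ennreal (norm (O' y - O' w) powr s) \<partial>lborel) \<partial>lborel)
    \<le> ennreal ((30 * (24 * real CARD('n) + 1)) ^ CARD('n) * (6 * sqrt (real CARD('n))) ^ CARD('n)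
          * unit_ball_vol (real CARD('n)) * \<delta> ^ CARD('n)) * E"
proof -
  define n where "n = real CARD('n)"
  define r where "r = sqrt n"
  have n: "n \<ge> 1" unfolding n_def by simp
  have "r * r = n" using n by (simp add: r_def)
  moreover have "r \<ge> 1" using n by (simp add: r_def)
  ultimately have r: "r \<ge> 1" "r * r = n" "r > 0" by auto
  have \<delta>n: "\<delta> * (4 * n) \<le> 1" using \<delta>(2) n by (simp add: n_def pos_le_divide_eq)
  have \<delta>r: "2 * r * \<delta> \<le> 1 / (2 * r)"
  proof -
    have "2 * r * \<delta> * (2 * r) = \<delta> * (4 * (r * r))" by simp
    also have "\<dots> \<le> 1" using \<delta>n r(2) by simp
    finally show ?thesis using r(3) pos_le_divide_eq[of "2 * r"] by simp
  qed
  have \<delta>r': "2 * r * \<delta> \<le> 1 / 2"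
  proof -
    have "1 / (2 * r) \<le> 1 / 2" using r by (simp add: field_simps)
    then show ?thesis using \<delta>r by linarith
  qed
  \<comment> \<open>The axes \<open>v\<close> that are needed to reach all of \<open>ball y \<delta>\<close>, normalised by \<open>\<kappa>\<close> below so that they do not depend on \<open>y\<close>.\<close>
  define V where "V = ball e (2 * r * \<delta>)"
  have Vm[measurable]: "V \<in> sets borel" by (simp add: V_def)
  have Sm[measurable]: "Sct \<in> sets borel" unfolding Sct_def by measurable
  have ee: "e \<bullet> e = 1" using e by (simp add: norm_eq_sqrt_inner)
  define L where "L = 6 * (24 * n + 1)"
  have "L > 0" using n by (simp add: L_def)
  let ?G = "\<lambda>y v. ennreal (norm (O' y - O' (reflection v (reflection e y))) powr s)"
  have [measurable]: "(\<lambda>x. reflection (f x) (g x)) \<in> borel_measurable M"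
    if [measurable]: "f \<in> borel_measurable M" "g \<in> borel_measurable M" for f g :: "'b \<Rightarrow> real^'n" and M
    unfolding reflection_def by measurable
  have inner: "(\<integral>\<^sup>+w\<in>ball y \<delta>. ennreal (norm (O' y - O' w) powr s) \<partial>lborel)
     \<le> ennreal ((5 * L) ^ CARD('n)) * (\<integral>\<^sup>+v\<in>V. ?G y v \<partial>lborel)" if y: "y \<in> Sct" for y
  proof -
    \<comment> \<open>The displacement of \<open>y\<close> under the reflection along \<open>e\<close> is \<open>\<kappa> *\<^sub>R e\<close>; in the sector it is bounded from below.\<close>
    define \<kappa> where "\<kappa> = - 2 * (e \<bullet> y)"
    define q where "q = reflection e (y /\<^sub>R norm y)"
    have ny: "1/2 \<le> norm y" "norm y < 3" "norm y / r \<le> - (e \<bullet> y)" "norm y > 0" using y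
      by (auto simp: Sct_def r_def n_def)
    have "norm y * 2 \<ge> 1" using ny by simp
    have \<kappa>: "1 / r \<le> \<kappa>" "\<kappa> \<le> 6" "\<kappa> > 0"
    proof -
      have "1 / r \<le> 2 * (norm y / r)" using ny r by (simp add: divide_right_mono)
      then show "1 / r \<le> \<kappa>" using ny by (simp add: \<kappa>_def)
      then show "\<kappa> > 0" using r by (smt (verit) divide_pos_pos)
      have "\<bar>e \<bullet> y\<bar> \<le> norm y" using Cauchy_Schwarz_ineq2[of e y] e by simp
      then show "\<kappa> \<le> 6" using ny by (simp add: \<kappa>_def)
    qed
    have q1: "norm q = 1" using ny by (simp add: q_def)
    have yq: "norm y *\<^sub>R q = reflection e y"
      using ny by (simp add: q_def flip: reflection_scaleR_right)
    have yq': "norm y *\<^sub>R q - y = \<kappa> *\<^sub>R e"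
      by (simp add: yq reflection_def \<kappa>_def ee)
    have eq: "1 / r \<le> e \<bullet> q"
    proof -
      have "norm y * (e \<bullet> q) = - (e \<bullet> y)"
        using arg_cong[OF yq, of "\<lambda>z. e \<bullet> z"] by (simp add: reflection_def inner_diff_right ee)
      then have "e \<bullet> q = - (e \<bullet> y) / norm y" using ny by (simp add: field_simps)
      moreover have "1 / r = (norm y / r) / norm y" using ny by simp
      ultimately show ?thesis using ny(3,4) by (simp only: divide_right_mono less_imp_le)
    qed
    have V: "norm v \<le> 2" "1 / (2 * r) \<le> v \<bullet> q" if "v \<in> V" for v
    proof -
      have ve: "norm (v - e) < 2 * r * \<delta>" using that by (simp add: V_def dist_norm norm_minus_commute)
      then show "norm v \<le> 2" using norm_triangle_ineq[of "v - e" e] e \<delta>r' by simp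
      have "v \<bullet> q = e \<bullet> q + (v - e) \<bullet> q" by (simp add: inner_diff_left)
      moreover have "\<bar>(v - e) \<bullet> q\<bar> \<le> norm (v - e)" using Cauchy_Schwarz_ineq2[of "v - e" q] q1 by simp
      moreover have "1 / r - 1 / (2 * r) = 1 / (2 * r)" using r by (simp add: field_simps)
      ultimately show "1 / (2 * r) \<le> v \<bullet> q" using eq ve \<delta>r by linarith
    qed
    have [measurable]: "(\<lambda>v. \<kappa> *\<^sub>R reflected_point q v) \<in> borel_measurable borel"
      unfolding reflected_point_def by measurable
    have "(\<integral>\<^sup>+w\<in>ball y \<delta>. ennreal (norm (O' y - O' w) powr s) \<partial>lborel)
      \<le> ennreal ((5 * L) ^ DIM(real^'n)) * (\<integral>\<^sup>+v\<in>V. ennreal (norm (O' y - O' (\<kappa> *\<^sub>R reflected_point q v)) powr s) \<partial>lborel)"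
    proof (rule nn_integral_Lipschitz_image_le[where \<psi> = "\<lambda>v. \<kappa> *\<^sub>R reflected_point q v" and F = "\<lambda>w. ennreal (norm (O' y - O' w) powr s)"])
      show "ball y \<delta> \<subseteq> (\<lambda>v. \<kappa> *\<^sub>R reflected_point q v) ` V"
      proof
        fix w assume "w \<in> ball y \<delta>"
        then have wy: "norm (w - y) < \<delta>" by (simp add: dist_norm norm_minus_commute)
        define v where "v = (norm w *\<^sub>R q - w) /\<^sub>R \<kappa>"
        have \<kappa>v: "\<kappa> *\<^sub>R v = norm w *\<^sub>R q - w" using \<kappa> by (simp add: v_def)
        have "\<kappa> *\<^sub>R (v - e) = (norm w - norm y) *\<^sub>R q - (w - y)"
          using yq' by (simp add: scaleR_diff_right \<kappa>v scaleR_diff_left algebra_simps)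
        then have "\<kappa> * norm (v - e) \<le> \<bar>norm w - norm y\<bar> + norm (w - y)"
          using norm_triangle_ineq4[of "(norm w - norm y) *\<^sub>R q" "w - y"] \<kappa> q1
          by (metis norm_scaleR abs_of_pos mult.right_neutral)
        also have "\<dots> < 2 * \<delta>" using norm_triangle_ineq3[of w y] wy by linarith
        finally have 1: "\<kappa> * norm (v - e) < 2 * \<delta>" .
        have "norm (v - e) \<le> r * (\<kappa> * norm (v - e))"
        proof -
          have "1 \<le> r * \<kappa>" using \<kappa>(1) r by (simp add: field_simps)
          from mult_right_mono[OF this, of "norm (v - e)"] show ?thesis by (simp add: mult.assoc)
        qed
        also have "\<dots> < r * (2 * \<delta>)" using 1 r by (intro mult_strict_left_mono)
        finally have vV: "v \<in> V" by (simp add: V_def dist_norm norm_minus_commute mult_ac)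
        have "v \<bullet> q > 0" using V(2)[OF vV] r by (smt (verit) divide_pos_pos)
        then have "(norm w *\<^sub>R q - w) \<bullet> q \<noteq> 0" using \<kappa> by (simp flip: \<kappa>v)
        then have "w = reflected_point q (\<kappa> *\<^sub>R v)" using q1 by (simp add: \<kappa>v reflected_point_surj)
        also have "\<dots> = \<kappa> *\<^sub>R reflected_point q v"
          using \<kappa> by (simp add: reflected_point_def scaleR_diff_right)
        finally show "w \<in> (\<lambda>v. \<kappa> *\<^sub>R reflected_point q v) ` V" using vV by blast
      qed
    next
      fix v v' assume v: "v \<in> V" "v' \<in> V"
      have *: "3 * 2\<^sup>2 / (2 * (1 / (2 * r))\<^sup>2) + 1 = 24 * n + 1"
        using r by (simp add: power2_eq_square field_simps flip: r(2))
      have "norm (\<kappa> *\<^sub>R reflected_point q v - \<kappa> *\<^sub>R reflected_point q v') = \<kappa> * norm (reflected_point q v - reflected_point q v')"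
        using \<kappa> by (simp flip: scaleR_diff_right)
      also have "\<dots> \<le> 6 * ((24 * n + 1) * norm (v - v'))"
        using reflected_point_Lipschitz[OF q1 V(1)[OF v(1)] V(1)[OF v(2)] V(2)[OF v(1)] V(2)[OF v(2)]] r \<kappa>
        unfolding * by (intro mult_mono) (auto simp: zero_less_divide_iff)
      finally show "norm (\<kappa> *\<^sub>R reflected_point q v - \<kappa> *\<^sub>R reflected_point q v') \<le> L * norm (v - v')"
        unfolding L_def by (simp only: mult.assoc)
    qed (use \<open>L > 0\<close> in auto)
    also have "(\<integral>\<^sup>+v\<in>V. ennreal (norm (O' y - O' (\<kappa> *\<^sub>R reflected_point q v)) powr s) \<partial>lborel) = (\<integral>\<^sup>+v\<in>V. ?G y v \<partial>lborel)"
    proof (intro nn_integral_cong)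
      fix v
      have "O' (\<kappa> *\<^sub>R reflected_point q v) = O' (reflection v (reflection e y))" if v: "v \<in> V"
      proof -
        have vq: "v \<bullet> q > 0" using V(2)[OF v] r by (smt (verit) divide_pos_pos)
        then have "v \<bullet> v > 0" by auto
        have "O' (reflection v (reflection e y)) = O' (norm y *\<^sub>R reflection v q)"
          by (simp flip: yq reflection_scaleR_right)
        also have "\<dots> = O' (reflection v q)" using hom ny by (simp add: homogeneous_degree_zero_def)
        also have "\<dots> = O' ((\<kappa> * (v \<bullet> v / (2 * (v \<bullet> q)))) *\<^sub>R reflection v q)"
          using hom vq \<open>v \<bullet> v > 0\<close> \<kappa> unfolding homogeneous_degree_zero_def
          by (metis divide_pos_pos mult_pos_pos zero_less_numeral)
        also have "\<dots> = O' (\<kappa> *\<^sub>R reflected_point q v)" using vq by (simp add: reflected_point_eq_reflection)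
        finally show ?thesis ..
      qed
      then show "ennreal (norm (O' y - O' (\<kappa> *\<^sub>R reflected_point q v)) powr s) * indicator V v = ?G y v * indicator V v"
        by (auto split: split_indicator)
    qed
    finally show ?thesis by simp
  qed
  have outer: "(\<integral>\<^sup>+y\<in>Sct. ?G y v \<partial>lborel) \<le> ennreal (3 ^ CARD('n)) * E" if v: "v \<in> V" for v
  proof -
    have ve: "norm (v - e) < 2 * r * \<delta>" using v by (simp add: V_def dist_norm norm_minus_commute)
    then have v0: "v \<noteq> 0" "e \<noteq> 0" using e \<delta>r' by auto
    define Q where "Q = matrix (reflection v \<circ> reflection e)"
    have Q: "rotation_matrix Q" unfolding Q_def by (rule rotation_matrix_reflection_reflection[OF v0])
    have Qx: "Q *v x = reflection v (reflection e x)" for x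
      unfolding Q_def using fun_cong[OF matrix_vector_mul(2)[of "reflection v \<circ> reflection e"], of x]
      by (simp add: linear_compose linear_reflection)
    have "rotation_size Q \<le> 40 * norm (v - e)"
      unfolding Q_def using ve \<delta>r' by (intro rotation_size_reflection_reflection_le e) auto
    also have "\<dots> < 40 * (2 * r * \<delta>)" using ve by (intro mult_strict_left_mono) auto
    also have "\<dots> \<le> d" using d by (simp add: r_def n_def)
    finally have size: "rotation_size Q < d" .
    have Qh: "norm (O' (Q *v (3 *\<^sub>R x)) - O' (3 *\<^sub>R x)) = norm (O' (Q *v x) - O' x)" for x
      using hom by (simp add: homogeneous_degree_zero_def matrix_vector_mult_scaleR)
    have "(\<integral>\<^sup>+y\<in>Sct. ?G y v \<partial>lborel) \<le> (\<integral>\<^sup>+x\<in>ball 0 3. ennreal (norm (O' (Q *v x) - O' x) powr s) \<partial>lborel)"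
      by (intro nn_integral_mono) (auto split: split_indicator simp: Qx norm_minus_commute Sct_def)
    also have "\<dots> = ennreal (3 ^ CARD('n)) * (\<integral>\<^sup>+x\<in>ball 0 1. ennreal (norm (O' (Q *v x) - O' x) powr s) \<partial>lborel)"
      by (subst nn_integral_ball_scale) (simp_all add: Qh, simp add: Qx)
    also have "\<dots> \<le> ennreal (3 ^ CARD('n)) * E" by (intro mult_left_mono E Q size) auto
    finally show ?thesis .
  qed
  have "(\<integral>\<^sup>+y\<in>Sct. (\<integral>\<^sup>+w\<in>ball y \<delta>. ennreal (norm (O' y - O' w) powr s) \<partial>lborel) \<partial>lborel)
      \<le> (\<integral>\<^sup>+y. ennreal ((5 * L) ^ CARD('n)) * (\<integral>\<^sup>+v. ?G y v * indicator V v * indicator Sct y \<partial>lborel) \<partial>lborel)"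
  proof (intro nn_integral_mono)
    fix y
    show "(\<integral>\<^sup>+w\<in>ball y \<delta>. ennreal (norm (O' y - O' w) powr s) \<partial>lborel) * indicator Sct y
       \<le> ennreal ((5 * L) ^ CARD('n)) * (\<integral>\<^sup>+v. ?G y v * indicator V v * indicator Sct y \<partial>lborel)"
      using inner[of y] by (cases "y \<in> Sct") auto
  qed
  also have "\<dots> = ennreal ((5 * L) ^ CARD('n)) * (\<integral>\<^sup>+y. (\<integral>\<^sup>+v. ?G y v * indicator V v * indicator Sct y \<partial>lborel) \<partial>lborel)"
    by (rule nn_integral_cmult) measurable
  also have "(\<integral>\<^sup>+y. (\<integral>\<^sup>+v. ?G y v * indicator V v * indicator Sct y \<partial>lborel) \<partial>lborel)
      = (\<integral>\<^sup>+v. (\<integral>\<^sup>+y. ?G y v * indicator V v * indicator Sct y \<partial>lborel) \<partial>lborel)"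
    by (rule lborel_pair.Fubini') measurable
  also have "ennreal ((5 * L) ^ CARD('n)) * \<dots> \<le> ennreal ((5 * L) ^ CARD('n)) * (\<integral>\<^sup>+v. ennreal (3 ^ CARD('n)) * E * indicator V v \<partial>lborel)"
  proof (intro mult_left_mono nn_integral_mono)
    fix v
    show "(\<integral>\<^sup>+y. ?G y v * indicator V v * indicator Sct y \<partial>lborel) \<le> ennreal (3 ^ CARD('n)) * E * indicator V v"
      using outer[of v] by (cases "v \<in> V") auto
  qed simp
  also have "(\<integral>\<^sup>+v. ennreal (3 ^ CARD('n)) * E * indicator V v \<partial>lborel) = ennreal (3 ^ CARD('n)) * E * emeasure lborel V"
    by (simp add: nn_integral_cmult_indicator)
  also have "emeasure lborel V = ennreal (unit_ball_vol n * (2 * r * \<delta>) ^ CARD('n))"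
    using r \<delta> by (simp add: V_def emeasure_ball n_def)
  also have "ennreal ((5 * L) ^ CARD('n)) * (ennreal (3 ^ CARD('n)) * E * ennreal (unit_ball_vol n * (2 * r * \<delta>) ^ CARD('n)))
     = ennreal ((5 * L) ^ CARD('n)) * ennreal (3 ^ CARD('n)) * ennreal (unit_ball_vol n * (2 * r * \<delta>) ^ CARD('n)) * E"
    by (simp add: mult_ac)
  also have "\<dots> = ennreal ((5 * L) ^ CARD('n) * 3 ^ CARD('n) * (unit_ball_vol n * (2 * r * \<delta>) ^ CARD('n))) * E"
    using \<open>L > 0\<close> r \<delta> n by (simp add: ennreal_mult)
  also have "(5 * L) ^ CARD('n) * 3 ^ CARD('n) * (unit_ball_vol n * (2 * r * \<delta>) ^ CARD('n))
    = (30 * (24 * n + 1)) ^ CARD('n) * (6 * r) ^ CARD('n) * unit_ball_vol n * \<delta> ^ CARD('n)"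
  proof -
    have "3 ^ CARD('n) * (2 * r * \<delta>) ^ CARD('n) = (6 * r) ^ CARD('n) * \<delta> ^ CARD('n)"
    proof -
      have "3 ^ CARD('n) * (2 * r * \<delta>) ^ CARD('n) = (3 * (2 * r * \<delta>)) ^ CARD('n)" by (rule power_mult_distrib[symmetric])
      also have "3 * (2 * r * \<delta>) = 6 * r * \<delta>" by simp
      finally show ?thesis by (simp add: power_mult_distrib)
    qed
    then show ?thesis by (simp add: L_def mult_ac)
  qed
  finally show ?thesis unfolding r_def n_def .
qed

text \<open>The sectors around the vectors \<open>\<plusminus>b\<close>, with \<open>b\<close> in the standard basis, cover the space, because some
  coordinate of \<open>y\<close> is at least \<open>norm y\<close> divided by the square root of the dimension.\<close>

lemma nn_integral_annulus_oscillation_le: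
  fixes O' :: "real^'n \<Rightarrow> complex"
  assumes [measurable]: "O' \<in> borel_measurable borel" and hom: "homogeneous_degree_zero O'"
    and \<delta>: "0 < \<delta>" "\<delta> \<le> 1 / (4 * real CARD('n))"
    and d: "80 * sqrt (real CARD('n)) * \<delta> \<le> d"
    and E: "\<And>Q. rotation_matrix Q \<Longrightarrow> rotation_size Q < d \<Longrightarrow>
      (\<integral>\<^sup>+x\<in>ball 0 1. ennreal (norm (O' (Q *v x) - O' x) powr s) \<partial>lborel) \<le> E"
  shows "(\<integral>\<^sup>+y\<in>{y. 1/2 \<le> norm y \<and> norm y < 3}. (\<integral>\<^sup>+w\<in>ball y \<delta>. ennreal (norm (O' y - O' w) powr s) \<partial>lborel) \<partial>lborel)
    \<le> ennreal (2 * real CARD('n) * ((30 * (24 * real CARD('n) + 1)) ^ CARD('n) * (6 * sqrt (real CARD('n))) ^ CARD('n)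
          * unit_ball_vol (real CARD('n)) * \<delta> ^ CARD('n))) * E"
proof -
  let ?c = "(30 * (24 * real CARD('n) + 1)) ^ CARD('n) * (6 * sqrt (real CARD('n))) ^ CARD('n)
          * unit_ball_vol (real CARD('n)) * \<delta> ^ CARD('n)"
  define H where "H y = (\<integral>\<^sup>+w\<in>ball y \<delta>. ennreal (norm (O' y - O' w) powr s) \<partial>lborel)" for y
  have bm: "Measurable.pred (borel \<Otimes>\<^sub>M borel) (\<lambda>x :: (real^'n) \<times> (real^'n). snd x \<in> ball (fst x) \<delta>)" for \<delta>
    unfolding mem_ball by measurable
  have [measurable]: "H \<in> borel_measurable borel" 
  proof -
    note [measurable] = bm
    show ?thesis unfolding H_def by measurable
  qed
  define Ax where "Ax = Basis \<union> uminus ` (Basis :: (real^'n) set)"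
  define Sct where "Sct e = {y::real^'n. 1/2 \<le> norm y \<and> norm y < 3 \<and> norm y / sqrt (real CARD('n)) \<le> - (e \<bullet> y)}" for e
  have [measurable]: "Sct e \<in> sets borel" for e unfolding Sct_def by measurable
  have fin: "finite Ax" by (simp add: Ax_def)
  have card: "card Ax \<le> 2 * CARD('n)"
  proof -
    have "card Ax \<le> card (Basis :: (real^'n) set) + card (uminus ` (Basis :: (real^'n) set))"
      unfolding Ax_def by (rule card_Un_le)
    also have "\<dots> \<le> 2 * card (Basis :: (real^'n) set)" using card_image_le[of "Basis :: (real^'n) set" uminus] by simp
    finally show ?thesis by simp
  qed
  have cover: "\<exists>e\<in>Ax. norm y / sqrt (real CARD('n)) \<le> - (e \<bullet> y)" for y :: "real^'n"
  proof -
    have "infnorm y \<in> (\<lambda>i. \<bar>y \<bullet> i\<bar>) ` Basis" unfolding infnorm_Max by (intro Max_in) auto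
    then obtain b where b: "b \<in> Basis" "infnorm y = \<bar>y \<bullet> b\<bar>" by auto
    have "norm y \<le> sqrt (real CARD('n)) * infnorm y" using norm_le_infnorm[of y] by simp
    then have "norm y / sqrt (real CARD('n)) \<le> \<bar>y \<bullet> b\<bar>" using b(2) by (simp add: pos_divide_le_eq mult.commute)
    then have "norm y / sqrt (real CARD('n)) \<le> - (b \<bullet> y) \<or> norm y / sqrt (real CARD('n)) \<le> - (- b \<bullet> y)"
      by (auto simp: abs_if inner_commute split: if_splits)
    moreover have "b \<in> Ax" "- b \<in> Ax" using b(1) by (auto simp: Ax_def)
    ultimately show ?thesis by blast
  qed
  have "(\<integral>\<^sup>+y\<in>{y. 1/2 \<le> norm y \<and> norm y < 3}. H y \<partial>lborel) \<le> (\<integral>\<^sup>+y. (\<Sum>e\<in>Ax. H y * indicator (Sct e) y) \<partial>lborel)"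
  proof (intro nn_integral_mono)
    fix y :: "real^'n"
    show "H y * indicator {y. 1/2 \<le> norm y \<and> norm y < 3} y \<le> (\<Sum>e\<in>Ax. H y * indicator (Sct e) y)"
    proof (cases "1/2 \<le> norm y \<and> norm y < 3")
      case True
      obtain e where e: "e \<in> Ax" "norm y / sqrt (real CARD('n)) \<le> - (e \<bullet> y)" using cover by blast
      have "H y * indicator {y. 1/2 \<le> norm y \<and> norm y < 3} y = H y * indicator (Sct e) y"
        using True e by (simp add: Sct_def)
      also have "\<dots> \<le> (\<Sum>e\<in>Ax. H y * indicator (Sct e) y)"
        using fin e by (intro member_le_sum) auto
      finally show ?thesis .
    qed simp
  qed
  also have "\<dots> = (\<Sum>e\<in>Ax. \<integral>\<^sup>+y\<in>Sct e. H y \<partial>lborel)" by (rule nn_integral_sum) measurable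
  also have "\<dots> \<le> (\<Sum>e\<in>Ax. ennreal ?c * E)"
  proof (rule sum_mono)
    fix e assume "e \<in> Ax"
    then have "norm e = 1" by (auto simp: Ax_def)
    then show "(\<integral>\<^sup>+y\<in>Sct e. H y \<partial>lborel) \<le> ennreal ?c * E"
      unfolding H_def Sct_def by (intro nn_integral_sector_oscillation_le[where d = d] hom \<delta> d E) auto
  qed
  also have "\<dots> = ennreal (real (card Ax)) * (ennreal ?c * E)"
    by (simp add: ennreal_of_nat_eq_real_of_nat)
  also have "\<dots> \<le> ennreal (2 * real CARD('n)) * (ennreal ?c * E)"
    using card by (intro mult_right_mono ennreal_leI) auto
  also have "\<dots> = ennreal (2 * real CARD('n) * ?c) * E"
    using \<delta> by (subst ennreal_mult) (auto simp: mult.assoc)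
  finally show ?thesis by (simp add: H_def)
qed

text \<open>The map \<open>y \<mapsto> y - a\<close> does not act on the sphere by a rotation. Therefore insert an intermediate point
  \<open>w\<close>, averaged over the ball of radius \<open>norm a\<close> around \<open>y\<close>: both \<open>y\<close> and \<open>y - a\<close> are within
  \<open>2 * norm a\<close> of \<open>w\<close> (so the factor 80 becomes 160), and by translation invariance of Lebesgue measure both terms reduce to the
  preceding lemma.\<close>

lemma nn_integral_shift_oscillation_le:
  fixes O' :: "real^'n \<Rightarrow> complex"
  assumes [measurable]: "O' \<in> borel_measurable borel" and hom: "homogeneous_degree_zero O'"
    and s: "1 \<le> s" and a: "norm a \<le> 1 / (8 * real CARD('n))"
    and d: "160 * sqrt (real CARD('n)) * norm a \<le> d"
    and E: "\<And>Q. rotation_matrix Q \<Longrightarrow> rotation_size Q < d \<Longrightarrow>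
      (\<integral>\<^sup>+x\<in>ball 0 1. ennreal (norm (O' (Q *v x) - O' x) powr s) \<partial>lborel) \<le> E"
  shows "(\<integral>\<^sup>+y\<in>{y. 1 \<le> norm y \<and> norm y < 2}. ennreal (norm (O' (y - a) - O' y) powr s) \<partial>lborel)
    \<le> ennreal (2 * 2 powr s * (2 * real CARD('n) * ((30 * (24 * real CARD('n) + 1)) ^ CARD('n) * (6 * sqrt (real CARD('n))) ^ CARD('n)
          * 2 ^ CARD('n)))) * E"
proof (cases "a = 0")
  case True
  then show ?thesis using s by simp
next
  case False
  define \<delta> where "\<delta> = norm a"
  have \<delta>: "\<delta> > 0" using False by (simp add: \<delta>_def)
  let ?N = "real CARD('n)"
  let ?c = "2 * ?N * ((30 * (24 * ?N + 1)) ^ CARD('n) * (6 * sqrt ?N) ^ CARD('n))"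
  define c where "c = ?c"
  have c: "0 \<le> c" by (simp add: c_def)
  define H where "H y = (\<integral>\<^sup>+w\<in>ball y (2 * \<delta>). ennreal (norm (O' y - O' w) powr s) \<partial>lborel)" for y
  have bm: "Measurable.pred (borel \<Otimes>\<^sub>M borel) (\<lambda>x :: (real^'n) \<times> (real^'n). snd x \<in> ball (fst x) \<delta>)" for \<delta>
    unfolding mem_ball by measurable
  have Hm[measurable]: "H \<in> borel_measurable borel" 
  proof -
    note [measurable] = bm
    show ?thesis unfolding H_def by measurable
  qed
  let ?A = "{y::real^'n. 1/2 \<le> norm y \<and> norm y < 3}" and ?S = "{y::real^'n. 1 \<le> norm y \<and> norm y < 2}"
  have Am[measurable]: "?A \<in> sets borel" "?S \<in> sets borel" by measurable
  have vol: "emeasure lborel (ball y \<delta>) = ennreal (unit_ball_vol ?N * \<delta> ^ CARD('n))" for y :: "real^'n"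
    using \<delta> by (simp add: emeasure_ball)
  have pt: "ennreal (norm (O' (y - a) - O' y) powr s) * emeasure lborel (ball y \<delta>)
     \<le> ennreal (2 powr s) * (H (y - a) + H y)" for y
  proof -
    have sub: "ball y \<delta> \<subseteq> ball (y - a) (2 * \<delta>)" "ball y \<delta> \<subseteq> ball y (2 * \<delta>)"
    proof -
      show "ball y \<delta> \<subseteq> ball (y - a) (2 * \<delta>)"
      proof
        fix w assume "w \<in> ball y \<delta>"
        then have "norm (y - w) < \<delta>" by (simp add: dist_norm)
        moreover have "norm (y - a - w) \<le> norm (y - w) + norm a"
          using norm_triangle_ineq4[of "y - w" a] by (simp add: algebra_simps)
        ultimately show "w \<in> ball (y - a) (2 * \<delta>)" by (simp add: dist_norm \<delta>_def)
      qed
    qed (use \<delta> in auto)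
    have "ennreal (norm (O' (y - a) - O' y) powr s) * emeasure lborel (ball y \<delta>)
       = (\<integral>\<^sup>+w\<in>ball y \<delta>. ennreal (norm (O' (y - a) - O' y) powr s) \<partial>lborel)"
      by (simp add: nn_integral_cmult_indicator)
    also have "\<dots> \<le> (\<integral>\<^sup>+w. ennreal (2 powr s) * (ennreal (norm (O' (y - a) - O' w) powr s) * indicator (ball (y - a) (2 * \<delta>)) w
        + ennreal (norm (O' y - O' w) powr s) * indicator (ball y (2 * \<delta>)) w) \<partial>lborel)"
    proof (intro nn_integral_mono)
      fix w
      have "norm (O' (y - a) - O' y) powr s \<le> (norm (O' (y - a) - O' w) + norm (O' y - O' w)) powr s"
        using norm_triangle_ineq4[of "O' (y - a) - O' w" "O' y - O' w"] s by (intro powr_mono2) auto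
      also have "\<dots> \<le> 2 powr s * (norm (O' (y - a) - O' w) powr s + norm (O' y - O' w) powr s)"
        using s by (intro powr_add_le) auto
      finally have "ennreal (norm (O' (y - a) - O' y) powr s) \<le>
         ennreal (2 powr s) * (ennreal (norm (O' (y - a) - O' w) powr s) + ennreal (norm (O' y - O' w) powr s))"
        by (simp flip: ennreal_mult ennreal_plus)
      then show "ennreal (norm (O' (y - a) - O' y) powr s) * indicator (ball y \<delta>) w \<le> ennreal (2 powr s) * (ennreal (norm (O' (y - a) - O' w) powr s) * indicator (ball (y - a) (2 * \<delta>)) w
        + ennreal (norm (O' y - O' w) powr s) * indicator (ball y (2 * \<delta>)) w)"
        using sub by (cases "w \<in> ball y \<delta>") (auto simp: subset_iff)
    qed
    also have "\<dots> = ennreal (2 powr s) * (H (y - a) + H y)"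
    proof -
      have m: "(\<lambda>w. ennreal (norm (O' z - O' w) powr s) * indicator (ball y r) w) \<in> borel_measurable lborel" for z y :: "real^'n" and r
        by (rule borel_measurable_times_ennreal) (measurable, simp)
      show ?thesis unfolding H_def
        by (subst nn_integral_cmult[OF borel_measurable_add[OF m m]], subst nn_integral_add[OF m m], rule refl)
    qed
    finally show ?thesis .
  qed
  have HA: "(\<integral>\<^sup>+y\<in>?A. H y \<partial>lborel) \<le> ennreal (c * (unit_ball_vol ?N * (2 * \<delta>) ^ CARD('n))) * E"
    using nn_integral_annulus_oscillation_le[of O' "2 * \<delta>" d s E] hom a \<delta> d E
    by (simp add: H_def \<delta>_def c_def mult_ac field_simps)
  have sh: "?S \<subseteq> ?A" "y \<in> ?S \<Longrightarrow> y - a \<in> ?A" for y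
  proof -
    have "8 * ?N \<ge> 2" by (rule order_trans[of _ "8 * 1"]) (simp, intro mult_left_mono, auto)
    then have "1 / (8 * ?N) \<le> 1 / 2" by (intro divide_left_mono) auto
    with a have "norm a \<le> 1 / 2" by linarith
    then show "y - a \<in> ?A" if "y \<in> ?S"
      using that norm_triangle_ineq2[of y a] norm_triangle_ineq4[of y a] by simp
  qed auto
  have "ennreal (unit_ball_vol ?N * \<delta> ^ CARD('n)) * (\<integral>\<^sup>+y\<in>?S. ennreal (norm (O' (y - a) - O' y) powr s) \<partial>lborel)
    = (\<integral>\<^sup>+y. ennreal (unit_ball_vol ?N * \<delta> ^ CARD('n)) * (ennreal (norm (O' (y - a) - O' y) powr s) * indicator ?S y) \<partial>lborel)"
    by (rule nn_integral_cmult[symmetric]) measurable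
  also have "\<dots> \<le> (\<integral>\<^sup>+y. ennreal (2 powr s) * (H (y - a) * indicator ?A (y - a) + H y * indicator ?A y) \<partial>lborel)"
  proof (intro nn_integral_mono)
    fix y
    show "ennreal (unit_ball_vol ?N * \<delta> ^ CARD('n)) * (ennreal (norm (O' (y - a) - O' y) powr s) * indicator ?S y)
       \<le> ennreal (2 powr s) * (H (y - a) * indicator ?A (y - a) + H y * indicator ?A y)"
    proof (cases "y \<in> ?S")
      case True
      then have "y \<in> ?A" "y - a \<in> ?A" using sh by auto
      then show ?thesis using pt[of y] True by (simp add: vol mult.commute)
    qed simp
  qed
  also have "\<dots> = ennreal (2 powr s) * ((\<integral>\<^sup>+y. H (y - a) * indicator ?A (y - a) \<partial>lborel) + (\<integral>\<^sup>+y\<in>?A. H y \<partial>lborel))"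
    by (simp add: nn_integral_cmult nn_integral_add)
  also have "(\<integral>\<^sup>+y. H (y - a) * indicator ?A (y - a) \<partial>lborel) = (\<integral>\<^sup>+y\<in>?A. H y \<partial>lborel)"
    by (rule nn_integral_lborel_translate[where F = "\<lambda>y. H y * indicator ?A y"]) measurable
  also have "ennreal (2 powr s) * ((\<integral>\<^sup>+y\<in>?A. H y \<partial>lborel) + (\<integral>\<^sup>+y\<in>?A. H y \<partial>lborel))
     = ennreal (2 powr s * 2) * (\<integral>\<^sup>+y\<in>?A. H y \<partial>lborel)"
    by (simp add: ennreal_mult mult.assoc mult_2)
  also have "\<dots> \<le> ennreal (2 powr s * 2) * (ennreal (c * (unit_ball_vol ?N * (2 * \<delta>) ^ CARD('n))) * E)"
    by (intro mult_left_mono HA) auto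
  also have "\<dots> = ennreal (unit_ball_vol ?N * \<delta> ^ CARD('n)) * (ennreal (2 * 2 powr s * (c * 2 ^ CARD('n))) * E)"
  proof -
    have eq: "(2 powr s * 2) * (c * (unit_ball_vol ?N * (2 * \<delta>) ^ CARD('n))) = (unit_ball_vol ?N * \<delta> ^ CARD('n)) * (2 * 2 powr s * (c * 2 ^ CARD('n)))"
      by (simp add: power_mult_distrib)
    have *: "ennreal u * (ennreal v * E) = ennreal (u * v) * E" if "0 \<le> u" "0 \<le> v" for u v
      using that by (simp add: ennreal_mult mult.assoc)
    have "ennreal (2 powr s * 2) * (ennreal (c * (unit_ball_vol ?N * (2 * \<delta>) ^ CARD('n))) * E)
      = ennreal (2 powr s * 2 * (c * (unit_ball_vol ?N * (2 * \<delta>) ^ CARD('n)))) * E"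
      using c \<delta> by (intro *) auto
    also have "\<dots> = ennreal (unit_ball_vol ?N * \<delta> ^ CARD('n)) * (ennreal (2 * 2 powr s * (c * 2 ^ CARD('n))) * E)"
      unfolding eq using c \<delta> by (intro *[symmetric]) auto
    finally show ?thesis .
  qed
  finally have le: "ennreal (unit_ball_vol ?N * \<delta> ^ CARD('n)) * (\<integral>\<^sup>+y\<in>?S. ennreal (norm (O' (y - a) - O' y) powr s) \<partial>lborel)
     \<le> ennreal (unit_ball_vol ?N * \<delta> ^ CARD('n)) * (ennreal (2 * 2 powr s * (c * 2 ^ CARD('n))) * E)" .
  have "unit_ball_vol ?N * \<delta> ^ CARD('n) > 0" using \<delta> by simp
  then have "(\<integral>\<^sup>+y\<in>?S. ennreal (norm (O' (y - a) - O' y) powr s) \<partial>lborel) \<le> ennreal (2 * 2 powr s * (c * 2 ^ CARD('n))) * E"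
    using ennreal_mult_le_mult_iff[THEN iffD1, OF _ _ le] by (simp add: ennreal_eq_0_iff)
  then show ?thesis by (simp only: mult.assoc c_def)
qed

section \<open>Norms by duality and the oscillation of the kernel\<close>

definition annulus :: "real \<Rightarrow> 'a::real_normed_vector set" where
  "annulus r = {u. r \<le> norm u \<and> norm u < 2 * r}"

lemma annulus_borel [measurable]: "annulus r \<in> sets (borel :: 'a::euclidean_space measure)"
  unfolding annulus_def by measurable

text \<open>\<open>F\<close> has norm at most \<open>c\<close> on \<open>S\<close> in the Lebesgue space whose exponent is conjugate to \<open>t\<close>, tested against
  all nonnegative \<open>g\<close> of finite \<open>L\<^sup>t\<close> norm. This form treats finite and infinite exponents alike; for
  exponent \<open>\<infinity>\<close> one has \<open>t = 1\<close>.\<close>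

definition dual_bound :: "real \<Rightarrow> 'a::euclidean_space set \<Rightarrow> ('a \<Rightarrow> real) \<Rightarrow> real \<Rightarrow> bool" where
  "dual_bound t S F c \<longleftrightarrow> (\<forall>g\<in>borel_measurable borel. (\<forall>x. 0 \<le> g x) \<longrightarrow>
     (\<forall>B>0. (\<integral>\<^sup>+x\<in>S. ennreal (g x powr t) \<partial>lborel) \<le> ennreal (B powr t) \<longrightarrow>
        (\<integral>\<^sup>+x\<in>S. ennreal (F x * g x) \<partial>lborel) \<le> ennreal (c * B)))"

lemma dual_boundI:
  assumes "\<And>g B. g \<in> borel_measurable borel \<Longrightarrow> (\<And>x. 0 \<le> g x) \<Longrightarrow> 0 < B \<Longrightarrow>
     (\<integral>\<^sup>+x\<in>S. ennreal (g x powr t) \<partial>lborel) \<le> ennreal (B powr t) \<Longrightarrow>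
     (\<integral>\<^sup>+x\<in>S. ennreal (F x * g x) \<partial>lborel) \<le> ennreal (c * B)"
  shows "dual_bound t S F c"
  using assms unfolding dual_bound_def by blast

lemma dual_boundD:
  assumes "dual_bound t S F c" "g \<in> borel_measurable borel" "\<And>x. 0 \<le> g x" "0 < B"
     "(\<integral>\<^sup>+x\<in>S. ennreal (g x powr t) \<partial>lborel) \<le> ennreal (B powr t)"
   shows "(\<integral>\<^sup>+x\<in>S. ennreal (F x * g x) \<partial>lborel) \<le> ennreal (c * B)"
  using assms unfolding dual_bound_def by blast

text \<open>Hoelder's inequality, for finite exponents.\<close>

lemma dual_bound_powr:
  fixes F :: "'a::euclidean_space \<Rightarrow> real"
  assumes [measurable]: "F \<in> borel_measurable borel" "S \<in> sets borel" and F: "\<And>x. 0 \<le> F x"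
    and "1 < p" "1 / p + 1 / t = 1" "0 < M"
    and M: "(\<integral>\<^sup>+x\<in>S. ennreal (F x powr p) \<partial>lborel) \<le> ennreal (M powr p)"
  shows "dual_bound t S F (2 * M)"
proof (rule dual_boundI)
  fix g B assume g[measurable]: "g \<in> borel_measurable borel" and nn: "\<And>x. 0 \<le> g x" and "0 < B"
    and B: "(\<integral>\<^sup>+x\<in>S. ennreal (g x powr t) \<partial>lborel) \<le> ennreal (B powr t)"
  let ?N = "density lborel (indicator S)"
  have d: "(\<integral>\<^sup>+x. f x \<partial>?N) = (\<integral>\<^sup>+x\<in>S. f x \<partial>lborel)" if [measurable]: "f \<in> borel_measurable borel" for f
    by (subst nn_integral_density) (auto simp: mult.commute)
  have "(\<integral>\<^sup>+x. ennreal (F x * g x) \<partial>?N) \<le> ennreal (2 * M * B)"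
    by (rule Holder_nn_integral[where p = p and q = t]) (use assms nn B \<open>0 < B\<close> in \<open>simp_all add: d\<close>)
  then show "(\<integral>\<^sup>+x\<in>S. ennreal (F x * g x) \<partial>lborel) \<le> ennreal (2 * M * B)" by (simp add: d)
qed

text \<open>The pair of exponents \<open>\<infinity>\<close> and 1.\<close>

lemma dual_bound_AE:
  fixes F :: "'a::euclidean_space \<Rightarrow> real"
  assumes [measurable]: "S \<in> sets borel" and M: "0 \<le> M" "AE x in lborel. x \<in> S \<longrightarrow> F x \<le> M"
  shows "dual_bound 1 S F M"
proof (rule dual_boundI)
  fix g B assume g[measurable]: "g \<in> borel_measurable borel" and nn: "\<And>x. 0 \<le> g x" and "0 < B"
    and B: "(\<integral>\<^sup>+x\<in>S. ennreal (g x powr 1) \<partial>lborel) \<le> ennreal (B powr 1)"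
  have "(\<integral>\<^sup>+x\<in>S. ennreal (F x * g x) \<partial>lborel) \<le> (\<integral>\<^sup>+x. ennreal M * (ennreal (g x) * indicator S x) \<partial>lborel)"
  proof (rule nn_integral_mono_AE)
    show "AE x in lborel. ennreal (F x * g x) * indicator S x \<le> ennreal M * (ennreal (g x) * indicator S x)"
      using M(2)
    proof eventually_elim
      case (elim x)
      then show ?case using nn[of x] M(1)
        by (auto simp: mult_right_mono split: split_indicator simp flip: ennreal_mult)
    qed
  qed
  also have "\<dots> = ennreal M * (\<integral>\<^sup>+x\<in>S. ennreal (g x) \<partial>lborel)"
    by (rule nn_integral_cmult) simp
  also have "\<dots> \<le> ennreal M * ennreal B"
    using B nn \<open>0 < B\<close> by (intro mult_left_mono) auto
  finally show "(\<integral>\<^sup>+x\<in>S. ennreal (F x * g x) \<partial>lborel) \<le> ennreal (M * B)"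
    using M \<open>0 < B\<close> by (simp add: ennreal_mult)
qed

lemma dual_bound_add:
  fixes F G :: "'a::euclidean_space \<Rightarrow> real"
  assumes [measurable]: "F \<in> borel_measurable borel" "G \<in> borel_measurable borel" "S \<in> sets borel"
    and F: "\<And>x. 0 \<le> F x" "dual_bound t S F c" "0 \<le> c"
    and G: "\<And>x. 0 \<le> G x" "dual_bound t S G d" "0 \<le> d"
  shows "dual_bound t S (\<lambda>x. F x + G x) (c + d)"
proof (rule dual_boundI)
  fix g B assume g[measurable]: "g \<in> borel_measurable borel" and nn: "\<And>x. 0 \<le> g x" and "0 < B"
    and B: "(\<integral>\<^sup>+x\<in>S. ennreal (g x powr t) \<partial>lborel) \<le> ennreal (B powr t)"
  have "(\<integral>\<^sup>+x\<in>S. ennreal ((F x + G x) * g x) \<partial>lborel)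
     = (\<integral>\<^sup>+x. ennreal (F x * g x) * indicator S x + ennreal (G x * g x) * indicator S x \<partial>lborel)"
    using F G nn by (intro nn_integral_cong) (auto simp: distrib_right split: split_indicator)
  also have "\<dots> = (\<integral>\<^sup>+x\<in>S. ennreal (F x * g x) \<partial>lborel) + (\<integral>\<^sup>+x\<in>S. ennreal (G x * g x) \<partial>lborel)"
    by (rule nn_integral_add) simp_all
  also have "\<dots> \<le> ennreal (c * B) + ennreal (d * B)"
    by (intro add_mono dual_boundD[OF F(2) g nn] dual_boundD[OF G(2) g nn] B \<open>0 < B\<close>)
  finally show "(\<integral>\<^sup>+x\<in>S. ennreal ((F x + G x) * g x) \<partial>lborel) \<le> ennreal ((c + d) * B)"
    using F(3) G(3) \<open>0 < B\<close> by (simp add: distrib_right)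
qed

lemma dual_bound_cmult:
  fixes F :: "'a::euclidean_space \<Rightarrow> real"
  assumes [measurable]: "F \<in> borel_measurable borel" "S \<in> sets borel"
    and F: "\<And>x. 0 \<le> F x" "dual_bound t S F c" "0 \<le> c" "0 \<le> k"
  shows "dual_bound t S (\<lambda>x. k * F x) (k * c)"
proof (rule dual_boundI)
  fix g B assume g[measurable]: "g \<in> borel_measurable borel" and nn: "\<And>x. 0 \<le> g x" and "0 < B"
    and B: "(\<integral>\<^sup>+x\<in>S. ennreal (g x powr t) \<partial>lborel) \<le> ennreal (B powr t)"
  have "(\<integral>\<^sup>+x\<in>S. ennreal ((k * F x) * g x) \<partial>lborel)
     = (\<integral>\<^sup>+x. ennreal k * (ennreal (F x * g x) * indicator S x) \<partial>lborel)"
    using F nn by (intro nn_integral_cong) (auto simp: mult.assoc ennreal_mult split: split_indicator)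
  also have "\<dots> = ennreal k * (\<integral>\<^sup>+x\<in>S. ennreal (F x * g x) \<partial>lborel)"
    by (rule nn_integral_cmult) simp
  also have "\<dots> \<le> ennreal k * ennreal (c * B)"
    by (intro mult_left_mono dual_boundD[OF F(2) g nn] B \<open>0 < B\<close>) simp
  finally show "(\<integral>\<^sup>+x\<in>S. ennreal ((k * F x) * g x) \<partial>lborel) \<le> ennreal ((k * c) * B)"
    using F \<open>0 < B\<close> by (simp add: ennreal_mult mult.assoc)
qed

lemma dual_bound_mono:
  assumes "dual_bound t S G c" "\<And>x. x \<in> S \<Longrightarrow> F x \<le> G x" "c \<le> c'"
  shows "dual_bound t S F c'"
proof (rule dual_boundI)
  fix g B assume g: "g \<in> borel_measurable borel" and nn: "\<And>x. 0 \<le> g x" and "0 < B"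
    and B: "(\<integral>\<^sup>+x\<in>S. ennreal (g x powr t) \<partial>lborel) \<le> ennreal (B powr t)"
  have "(\<integral>\<^sup>+x\<in>S. ennreal (F x * g x) \<partial>lborel) \<le> (\<integral>\<^sup>+x\<in>S. ennreal (G x * g x) \<partial>lborel)"
    using assms(2) nn by (intro nn_integral_mono) (auto simp: mult_right_mono ennreal_leI split: split_indicator)
  also have "\<dots> \<le> ennreal (c * B)" by (intro dual_boundD[OF assms(1) g nn] B \<open>0 < B\<close>)
  also have "\<dots> \<le> ennreal (c' * B)" using assms(3) \<open>0 < B\<close> by (intro ennreal_leI mult_right_mono) auto
  finally show "(\<integral>\<^sup>+x\<in>S. ennreal (F x * g x) \<partial>lborel) \<le> ennreal (c' * B)" .
qed

lemma dual_bound_subset: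
  assumes "dual_bound t S F c" "T \<subseteq> S" "T \<in> sets borel" "\<And>x. 0 \<le> F x" "0 < t"
  shows "dual_bound t T F c"
proof (rule dual_boundI)
  fix g B assume g[measurable]: "g \<in> borel_measurable borel" and nn: "\<And>x. 0 \<le> g x" and "0 < B"
    and B: "(\<integral>\<^sup>+x\<in>T. ennreal (g x powr t) \<partial>lborel) \<le> ennreal (B powr t)"
  note [measurable] = assms(3)
  define h where "h x = g x * indicator T x" for x
  have h: "h \<in> borel_measurable borel" unfolding h_def by measurable
  have h0: "\<And>x. 0 \<le> h x" using nn by (simp add: h_def)
  have "(\<integral>\<^sup>+x\<in>S. ennreal (h x powr t) \<partial>lborel) = (\<integral>\<^sup>+x\<in>T. ennreal (g x powr t) \<partial>lborel)"
    using assms(2,5) by (intro nn_integral_cong) (auto simp: h_def split: split_indicator)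
  with B have "(\<integral>\<^sup>+x\<in>S. ennreal (h x powr t) \<partial>lborel) \<le> ennreal (B powr t)" by simp
  from dual_boundD[OF assms(1) h h0 \<open>0 < B\<close> this]
  have "(\<integral>\<^sup>+x\<in>S. ennreal (F x * h x) \<partial>lborel) \<le> ennreal (c * B)" .
  also have "(\<integral>\<^sup>+x\<in>S. ennreal (F x * h x) \<partial>lborel) = (\<integral>\<^sup>+x\<in>T. ennreal (F x * g x) \<partial>lborel)"
    using assms(2) by (intro nn_integral_cong) (auto simp: h_def split: split_indicator)
  finally show "(\<integral>\<^sup>+x\<in>T. ennreal (F x * g x) \<partial>lborel) \<le> ennreal (c * B)" .
qed

text \<open>Only the volume of the ball depends on \<open>r\<close>, since \<open>O'\<close> is invariant under dilations.\<close>

lemma dual_bound_ball_homogeneous: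
  fixes O' :: "real^'n \<Rightarrow> complex"
  assumes [measurable]: "O' \<in> borel_measurable borel" and hom: "homogeneous_degree_zero O'"
    and p: "1 < p" "1 / p + 1 / t = 1" and M: "0 < M" and r: "0 < r"
    and le: "(\<integral>\<^sup>+x\<in>ball 0 1. ennreal (norm (O' x) powr p) \<partial>lborel) \<le> ennreal (M powr p)"
  shows "dual_bound t (ball 0 r) (\<lambda>x. norm (O' x)) (2 * (M * r powr (real CARD('n) / p)))"
proof (rule dual_bound_powr)
  have "(\<integral>\<^sup>+x\<in>ball 0 r. ennreal (norm (O' x) powr p) \<partial>lborel) = ennreal (r ^ CARD('n)) * (\<integral>\<^sup>+x\<in>ball 0 1. ennreal (norm (O' x) powr p) \<partial>lborel)"
    using r hom by (subst nn_integral_ball_scale) (auto simp: homogeneous_degree_zero_def)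
  also have "\<dots> \<le> ennreal (r ^ CARD('n)) * ennreal (M powr p)" by (intro mult_left_mono le) auto
  also have "\<dots> = ennreal ((M * r powr (real CARD('n) / p)) powr p)"
    using r M p by (simp add: powr_mult powr_powr powr_realpow mult.commute flip: ennreal_mult)
  finally show "(\<integral>\<^sup>+x\<in>ball 0 r. ennreal (norm (O' x) powr p) \<partial>lborel) \<le> ennreal ((M * r powr (real CARD('n) / p)) powr p)" .
qed (use p M r in auto)

text \<open>The shift estimate on the annulus of radii 1 and 2, transported to radius \<open>r\<close> by homogeneity. The
  constant \<open>A\<close> is uniform in the function, the annulus and the shift.\<close>

lemma dual_bound_annulus_oscillation:
  fixes s t :: real
  assumes s: "1 < s" "1 / s + 1 / t = 1"
  shows "\<exists>A>0. \<forall>(O' :: real^'n \<Rightarrow> complex) r a d \<eta>.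
    O' \<in> borel_measurable borel \<longrightarrow> homogeneous_degree_zero O' \<longrightarrow> 0 < r \<longrightarrow>
    norm a / r \<le> 1 / (8 * real CARD('n)) \<longrightarrow> 160 * sqrt (real CARD('n)) * (norm a / r) \<le> d \<longrightarrow> 0 < \<eta> \<longrightarrow>
    (\<forall>Q. rotation_matrix Q \<longrightarrow> rotation_size Q < d \<longrightarrow>
      (\<integral>\<^sup>+x\<in>ball 0 1. ennreal (norm (O' (Q *v x) - O' x) powr s) \<partial>lborel) \<le> ennreal (unit_ball_vol (real CARD('n)) * \<eta> powr s)) \<longrightarrow>
    dual_bound t (annulus r) (\<lambda>u. norm (O' (u - a) - O' u)) (A * r powr (real CARD('n) / s) * \<eta>)"
proof -
  let ?N = "real CARD('n)"
  define c where "c = 2 * 2 powr s * (2 * ?N * ((30 * (24 * ?N + 1)) ^ CARD('n) * (6 * sqrt ?N) ^ CARD('n) * 2 ^ CARD('n))) * unit_ball_vol ?N"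
  have c: "c > 0" unfolding c_def by (intro mult_pos_pos zero_less_power) (auto intro: add_pos_pos)
  show ?thesis
  proof (intro exI[of _ "2 * c powr (1/s)"] conjI allI impI)
    fix O' :: "real^'n \<Rightarrow> complex" and r d \<eta> :: real and a :: "real^'n"
    assume Om[measurable]: "O' \<in> borel_measurable borel" and hom: "homogeneous_degree_zero O'" and r: "0 < r"
      and a: "norm a / r \<le> 1 / (8 * real CARD('n))" and d: "160 * sqrt (real CARD('n)) * (norm a / r) \<le> d"
      and \<eta>: "0 < \<eta>"
      and E: "\<forall>Q. rotation_matrix Q \<longrightarrow> rotation_size Q < d \<longrightarrow>
      (\<integral>\<^sup>+x\<in>ball 0 1. ennreal (norm (O' (Q *v x) - O' x) powr s) \<partial>lborel) \<le> ennreal (unit_ball_vol (real CARD('n)) * \<eta> powr s)"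
    have im: "(*\<^sub>R) r ` {y. 1 \<le> norm y \<and> norm y < 2} = (annulus r :: (real^'n) set)"
    proof (intro equalityI subsetI)
      fix u :: "real^'n" assume "u \<in> annulus r"
      then have "u = r *\<^sub>R (u /\<^sub>R r)" "1 \<le> norm (u /\<^sub>R r)" "norm (u /\<^sub>R r) < 2"
        using r by (auto simp: annulus_def field_simps)
      then show "u \<in> (*\<^sub>R) r ` {y. 1 \<le> norm y \<and> norm y < 2}" by blast
    qed (use r in \<open>auto simp: annulus_def\<close>)
    have Oh: "O' (r *\<^sub>R x - a) = O' (x - a /\<^sub>R r)" "O' (r *\<^sub>R x) = O' x" for x
    proof -
      have "r *\<^sub>R x - a = r *\<^sub>R (x - a /\<^sub>R r)" using r by (simp add: scaleR_diff_right)
      then show "O' (r *\<^sub>R x - a) = O' (x - a /\<^sub>R r)" "O' (r *\<^sub>R x) = O' x"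
        using hom r by (simp_all add: homogeneous_degree_zero_def)
    qed
    have "dual_bound t (annulus r) (\<lambda>u. norm (O' (u - a) - O' u)) (2 * (c powr (1/s) * r powr (?N / s) * \<eta>))"
    proof (rule dual_bound_powr[OF _ _ _ s])
      have "(\<integral>\<^sup>+u\<in>annulus r. ennreal (norm (O' (u - a) - O' u) powr s) \<partial>lborel)
        = ennreal (r ^ DIM(real^'n)) * (\<integral>\<^sup>+y\<in>{y. 1 \<le> norm y \<and> norm y < 2}. ennreal (norm (O' (r *\<^sub>R y - a) - O' (r *\<^sub>R y)) powr s) \<partial>lborel)"
        unfolding im[symmetric] using r by (intro nn_integral_lborel_scale) auto
      also have "\<dots> \<le> ennreal (r ^ CARD('n)) * (ennreal (2 * 2 powr s * (2 * ?N * ((30 * (24 * ?N + 1)) ^ CARD('n) * (6 * sqrt ?N) ^ CARD('n) * 2 ^ CARD('n)))) * ennreal (unit_ball_vol (real CARD('n)) * \<eta> powr s))"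
        unfolding Oh DIM_cart DIM_real mult_1_right
      proof (rule mult_left_mono)
        have na: "norm (a /\<^sub>R r) = norm a / r" using r by (simp add: divide_inverse mult.commute)
        show "(\<integral>\<^sup>+y\<in>{y. 1 \<le> norm y \<and> norm y < 2}. ennreal (norm (O' (y - a /\<^sub>R r) - O' y) powr s) \<partial>lborel)
          \<le> ennreal (2 * 2 powr s * (2 * ?N * ((30 * (24 * ?N + 1)) ^ CARD('n) * (6 * sqrt ?N) ^ CARD('n) * 2 ^ CARD('n)))) * ennreal (unit_ball_vol (real CARD('n)) * \<eta> powr s)"
        proof (rule nn_integral_shift_oscillation_le[where d = d])
          show "160 * sqrt ?N * norm (a /\<^sub>R r) \<le> d" unfolding na by (rule d)
          show "norm (a /\<^sub>R r) \<le> 1 / (8 * ?N)" unfolding na by (rule a)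
          show "1 \<le> s" using s by simp
        next
          fix Q :: "real^'n^'n" assume "rotation_matrix Q" "rotation_size Q < d"
          then show "(\<integral>\<^sup>+x\<in>ball 0 1. ennreal (norm (O' (Q *v x) - O' x) powr s) \<partial>lborel) \<le> ennreal (unit_ball_vol ?N * \<eta> powr s)"
            using E by blast
        qed (rule Om hom)+
      qed simp
      also have "\<dots> = ennreal ((c powr (1/s) * r powr (?N / s) * \<eta>) powr s)"
      proof -
        have "(c powr (1/s) * r powr (?N / s) * \<eta>) powr s = c * r ^ CARD('n) * \<eta> powr s"
          using c r \<eta> s by (simp add: powr_mult powr_powr powr_realpow)
        then show ?thesis using r c by (simp add: c_def mult_ac flip: ennreal_mult)
      qed
      finally show "(\<integral>\<^sup>+u\<in>annulus r. ennreal (norm (O' (u - a) - O' u) powr s) \<partial>lborel) \<le> ennreal ((c powr (1/s) * r powr (?N / s) * \<eta>) powr s)" .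
    qed (use c r \<eta> in auto)
    then show "dual_bound t (annulus r) (\<lambda>u. norm (O' (u - a) - O' u)) (2 * c powr (1/s) * r powr (?N / s) * \<eta>)"
      by (simp add: mult.assoc)
  qed (use c in auto)
qed

subsection \<open>The Riesz-type kernel\<close>

text \<open>At the origin the value is 0, because \<open>0 powr \<kappa> = 0\<close> and division by 0 yields 0.\<close>

definition rough_kernel :: "('a::real_normed_vector \<Rightarrow> complex) \<Rightarrow> real \<Rightarrow> 'a \<Rightarrow> complex" where
  "rough_kernel O' \<kappa> u = O' u / complex_of_real (norm u powr \<kappa>)"

lemma measurable_rough_kernel [measurable]:
  fixes O' :: "'a::euclidean_space \<Rightarrow> complex"
  assumes [measurable]: "O' \<in> borel_measurable borel"
  shows "rough_kernel O' \<kappa> \<in> borel_measurable borel"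
  unfolding rough_kernel_def by measurable

lemma powr_neg_diff_le:
  fixes x y \<rho> \<kappa> :: real
  assumes "\<rho> \<le> x" "\<rho> \<le> y" "0 < \<rho>" "0 \<le> \<kappa>"
  shows "\<bar>x powr (-\<kappa>) - y powr (-\<kappa>)\<bar> \<le> \<kappa> * \<rho> powr (-\<kappa> - 1) * \<bar>x - y\<bar>"
proof -
  have "norm (x powr (-\<kappa>) - y powr (-\<kappa>)) \<le> \<kappa> * \<rho> powr (-\<kappa> - 1) * norm (x - y)"
  proof (rule field_differentiable_bound[where S = "{\<rho>..}" and f' = "\<lambda>t. (-\<kappa>) * t powr (-\<kappa> - 1)"])
    fix z assume z: "z \<in> {\<rho>..}"
    then show "((\<lambda>t. t powr (-\<kappa>)) has_field_derivative (-\<kappa>) * z powr (-\<kappa> - 1)) (at z within {\<rho>..})"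
      using assms by (auto intro!: derivative_eq_intros)
    have "z powr (-\<kappa> - 1) \<le> \<rho> powr (-\<kappa> - 1)"
      using assms z by (intro powr_mono2') auto
    then show "norm ((-\<kappa>) * z powr (-\<kappa> - 1)) \<le> \<kappa> * \<rho> powr (-\<kappa> - 1)"
      using assms by (simp add: abs_mult mult_left_mono)
  qed (use assms in auto)
  then show ?thesis by simp
qed

text \<open>Split the difference of the kernels into the difference of the angular parts and the difference of
  the radial parts. Both \<open>u\<close> and \<open>u - a\<close> have norm at least \<open>r / 2\<close>.\<close>

lemma norm_rough_kernel_diff_le:
  fixes O' :: "'a::real_normed_vector \<Rightarrow> complex"
  assumes u: "u \<in> annulus r" and a: "norm a \<le> r / 2" and r: "0 < r" and \<kappa>: "0 \<le> \<kappa>"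
  shows "norm (rough_kernel O' \<kappa> (u - a) - rough_kernel O' \<kappa> u)
    \<le> (r/2) powr (-\<kappa>) * norm (O' (u - a) - O' u) + \<kappa> * (r/2) powr (-\<kappa> - 1) * norm a * norm (O' u)"
proof -
  have nu: "r / 2 \<le> norm u" "r / 2 \<le> norm (u - a)"
    using u r a norm_triangle_ineq2[of u a] by (auto simp: annulus_def)
  have K: "rough_kernel O' \<kappa> v = complex_of_real (norm v powr (-\<kappa>)) * O' v" for v
    by (simp add: rough_kernel_def powr_minus divide_inverse mult.commute)
  have "rough_kernel O' \<kappa> (u - a) - rough_kernel O' \<kappa> u
     = complex_of_real (norm (u - a) powr (-\<kappa>)) * (O' (u - a) - O' u)
       + complex_of_real (norm (u - a) powr (-\<kappa>) - norm u powr (-\<kappa>)) * O' u"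
    by (simp add: K algebra_simps)
  also have "norm \<dots> \<le> norm (u - a) powr (-\<kappa>) * norm (O' (u - a) - O' u)
       + \<bar>norm (u - a) powr (-\<kappa>) - norm u powr (-\<kappa>)\<bar> * norm (O' u)"
    by (rule norm_triangle_le) (simp add: norm_mult del: of_real_diff)
  also have "\<dots> \<le> (r/2) powr (-\<kappa>) * norm (O' (u - a) - O' u) + (\<kappa> * (r/2) powr (-\<kappa> - 1) * norm a) * norm (O' u)"
  proof (intro add_mono mult_right_mono)
    show "norm (u - a) powr (-\<kappa>) \<le> (r/2) powr (-\<kappa>)"
      using nu r \<kappa> by (intro powr_mono2') auto
    have "\<bar>norm (u - a) powr (-\<kappa>) - norm u powr (-\<kappa>)\<bar> \<le> \<kappa> * (r/2) powr (-\<kappa> - 1) * \<bar>norm (u - a) - norm u\<bar>"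
      using nu r \<kappa> by (intro powr_neg_diff_le) auto
    also have "\<bar>norm (u - a) - norm u\<bar> \<le> norm a" using norm_triangle_ineq3[of "u - a" u] by simp
    finally show "\<bar>norm (u - a) powr (-\<kappa>) - norm u powr (-\<kappa>)\<bar> \<le> \<kappa> * (r/2) powr (-\<kappa> - 1) * norm a"
      using \<kappa> by (simp add: mult_left_mono)
  qed auto
  finally show ?thesis by simp
qed

text \<open>The kernel condition on one annulus: relative to \<open>r\<close>, the angular part contributes its oscillation
  \<open>\<eta>\<close> and the radial part contributes \<open>norm a / r \<le> \<epsilon>\<close>.\<close>

lemma dual_bound_rough_kernel_diff:
  fixes O' :: "'a::euclidean_space \<Rightarrow> complex"
  assumes [measurable]: "O' \<in> borel_measurable borel"
    and a: "norm a \<le> r * \<epsilon>" "\<epsilon> \<le> 1/2" and r: "0 < r" and \<kappa>: "0 \<le> \<kappa>" and t: "0 < t"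
    and osc: "dual_bound t (annulus r) (\<lambda>u. norm (O' (u - a) - O' u)) (A * r powr \<nu> * \<eta>)"
    and size: "dual_bound t (ball 0 (2 * r)) (\<lambda>u. norm (O' u)) (A * (2 * r) powr \<nu>)"
    and A: "0 \<le> A" "0 \<le> \<eta>"
  shows "dual_bound t (annulus r) (\<lambda>u. norm (rough_kernel O' \<kappa> (u - a) - rough_kernel O' \<kappa> u))
    ((2 powr \<kappa> + \<kappa> * 2 powr (\<kappa> + 1 + \<nu>)) * A * r powr (\<nu> - \<kappa>) * (\<eta> + \<epsilon>))"
proof -
  have \<epsilon>: "0 \<le> \<epsilon>" using a r norm_ge_zero[of a] by (metis dual_order.trans zero_le_mult_iff less_le_not_le)
  have "r * \<epsilon> \<le> r * (1/2)" using a(2) r by (intro mult_left_mono) auto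
  then have ra: "norm a \<le> r / 2" using a(1) by linarith
  let ?b = "(r/2) powr (-\<kappa>)" and ?c = "\<kappa> * (r/2) powr (-\<kappa> - 1) * norm a"
  have cc: "0 \<le> ?c" using \<kappa> by simp
  have size': "dual_bound t (annulus r) (\<lambda>u. norm (O' u)) (A * (2 * r) powr \<nu>)"
    by (rule dual_bound_subset[OF size]) (use t in \<open>auto simp: annulus_def\<close>)
  have db: "dual_bound t (annulus r) (\<lambda>u. ?b * norm (O' (u - a) - O' u) + ?c * norm (O' u))
     (?b * (A * r powr \<nu> * \<eta>) + ?c * (A * (2 * r) powr \<nu>))"
    by (intro dual_bound_add dual_bound_cmult osc size') (use A cc in auto)
  have "?b * (A * r powr \<nu> * \<eta>) + ?c * (A * (2 * r) powr \<nu>)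
    \<le> ?b * (A * r powr \<nu> * \<eta>) + (\<kappa> * (r/2) powr (-\<kappa> - 1) * (r * \<epsilon>)) * (A * (2 * r) powr \<nu>)"
    using a A \<kappa> by (intro add_left_mono mult_right_mono mult_left_mono) auto
  also have "\<dots> = 2 powr \<kappa> * A * (r powr (-\<kappa>) * r powr \<nu>) * \<eta> + \<kappa> * (2 powr (\<kappa> + 1) * 2 powr \<nu>) * A * (r powr (-\<kappa> - 1) * r powr 1 * r powr \<nu>) * \<epsilon>"
  proof -
    have e: "(r/2) powr x = 2 powr (-x) * r powr x" for x
    proof -
      have "(r/2) powr x = r powr x / 2 powr x" using r by (simp add: powr_divide)
      then show ?thesis by (simp add: powr_minus_divide)
    qed
    have e3: "(2 * r) powr \<nu> = 2 powr \<nu> * r powr \<nu>" using r by (simp add: powr_mult)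
    have "- (- \<kappa> - 1) = \<kappa> + 1" by simp
    then show ?thesis using r unfolding e e3 by (simp add: add.commute)
  qed
  also have "\<dots> = 2 powr \<kappa> * A * r powr (\<nu> - \<kappa>) * \<eta> + \<kappa> * 2 powr (\<kappa> + 1 + \<nu>) * A * r powr (\<nu> - \<kappa>) * \<epsilon>"
    unfolding powr_add[symmetric] by simp
  also have "\<dots> \<le> (2 powr \<kappa> + \<kappa> * 2 powr (\<kappa> + 1 + \<nu>)) * A * r powr (\<nu> - \<kappa>) * (\<eta> + \<epsilon>)"
    using \<kappa> A \<epsilon> by (simp add: algebra_simps)
  finally show ?thesis
    by (intro dual_bound_mono[OF db] norm_rough_kernel_diff_le ra r \<kappa>)
qed

section \<open>The sphere measure in terms of the unit ball\<close>

lemma measurable_sgn [measurable]: "sgn \<in> borel_measurable (borel :: 'a::euclidean_space measure)"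
  unfolding sgn_div_norm[abs_def] by measurable

lemma sgn_sgn_vector [simp]: "sgn (sgn x) = sgn (x :: 'a::real_normed_vector)"
  by (cases "x = 0") (simp_all add: sgn_div_norm)

lemma sgn_scaleR_pos: "0 < c \<Longrightarrow> sgn (c *\<^sub>R x) = sgn (x :: 'a::real_normed_vector)"
  by (simp add: sgn_scaleR)

lemma sphere_in_sets_distr [simp]: "sphere 0 1 \<inter> space (distr M borel f) \<in> sets (distr M (borel :: 'a::euclidean_space measure) f)"
  by simp

text \<open>Both sides say that the uniform distribution on the unit ball does not charge the cone over \<open>C\<close>.\<close>

lemma AE_distr_sgn_notin_iff:
  fixes C :: "'a::euclidean_space set"
  assumes [measurable]: "C \<in> sets borel"
  shows "(AE x in distr (uniform_measure lborel (ball 0 1)) borel sgn. x \<notin> C)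
    \<longleftrightarrow> emeasure lborel (ball 0 1 \<inter> sgn -` C) = 0"
proof -
  have pre: "sgn -` C \<in> sets borel" using measurable_sets[OF measurable_sgn, of C] by simp
  have V: "emeasure lborel (ball (0::'a) 1) \<noteq> 0" "emeasure lborel (ball (0::'a) 1) \<noteq> top"
    using unit_ball_vol_pos[of "real DIM('a)", THEN less_imp_neq] by (auto simp: emeasure_ball)
  have "(AE x in distr (uniform_measure lborel (ball 0 1)) borel sgn. x \<notin> C)
     \<longleftrightarrow> emeasure (distr (uniform_measure lborel (ball 0 1)) borel sgn) C = 0"
    by (subst AE_iff_null_sets[symmetric]) (auto simp: null_sets_def)
  also have "emeasure (distr (uniform_measure lborel (ball 0 1)) borel sgn) C = emeasure lborel (ball 0 1 \<inter> sgn -` C) / emeasure lborel (ball (0::'a) 1)"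
    using pre by (subst emeasure_distr) auto
  also have "\<dots> = 0 \<longleftrightarrow> emeasure lborel (ball 0 1 \<inter> sgn -` C) = 0"
    using V by (auto simp: ennreal_divide_eq_0_iff)
  finally show ?thesis .
qed

text \<open>A cone that is null in the unit ball is null in every ball, by scaling.\<close>

lemma AE_lborel_cone:
  fixes C :: "'a::euclidean_space set"
  assumes [measurable]: "C \<in> sets borel" and inv: "\<And>x. sgn x \<in> C \<longleftrightarrow> x \<in> C"
    and null: "emeasure lborel (ball 0 1 \<inter> C) = 0"
  shows "AE x in lborel. x \<notin> C"
proof -
  have "AE x in lborel. x \<notin> C \<inter> ball 0 (real k + 1)" for k :: nat
  proof (subst AE_iff_null_sets[symmetric])
    have "emeasure lborel (C \<inter> ball 0 (real k + 1)) = (\<integral>\<^sup>+x\<in>ball 0 (real k + 1). indicator C x \<partial>lborel)"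
      by (subst indicator_inter_arith[symmetric]) simp
    also have "\<dots> = ennreal ((real k + 1) ^ DIM('a)) * (\<integral>\<^sup>+x\<in>ball 0 1. indicator C ((real k + 1) *\<^sub>R x) \<partial>lborel)"
      by (rule nn_integral_ball_scale) auto
    also have "(\<integral>\<^sup>+x\<in>ball 0 1. indicator C ((real k + 1) *\<^sub>R x) \<partial>lborel) = (\<integral>\<^sup>+x. indicator (ball 0 1 \<inter> C) x \<partial>lborel)"
    proof (intro nn_integral_cong)
      fix x :: 'a
      have "(real k + 1) *\<^sub>R x \<in> C \<longleftrightarrow> x \<in> C"
        using inv[of "(real k + 1) *\<^sub>R x"] inv[of x] sgn_scaleR_pos[of "real k + 1" x] by simp
      then show "indicator C ((real k + 1) *\<^sub>R x) * indicator (ball 0 1) x = (indicator (ball 0 1 \<inter> C) x :: ennreal)"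
        by (auto split: split_indicator)
    qed
    also have "\<dots> = 0" using null by simp
    finally show "C \<inter> ball 0 (real k + 1) \<in> null_sets lborel" by (simp add: null_sets_def)
  qed simp
  then have "AE x in lborel. \<forall>k::nat. x \<notin> C \<inter> ball 0 (real k + 1)" by (subst AE_all_countable) blast
  then show ?thesis
  proof eventually_elim
    case (elim x)
    obtain k :: nat where "norm x \<le> real k" using real_arch_simple by blast
    then have "x \<in> ball 0 (real k + 1)" by simp
    with elim show ?case by blast
  qed
qed

text \<open>Null sets of the sphere are exchanged for Borel null cones of the whole space: a Borel set is needed
  because the sphere carries a completed measure, and a cone because homogeneous functions only see
  directions.\<close>

lemma AE_sphere_measureE:
  fixes P :: "real^'n \<Rightarrow> bool"
  assumes "AE x in sphere_measure. P x"
  obtains C where "C \<in> sets borel" "\<And>x. sgn x \<in> C \<longleftrightarrow> x \<in> C" "AE x in lborel. x \<notin> C"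
    "\<And>x. norm x = 1 \<Longrightarrow> x \<notin> C \<Longrightarrow> P x"
proof -
  let ?\<mu> = "distr (uniform_measure lborel (ball 0 1)) borel sgn :: (real^'n) measure"
  have "AE x in ?\<mu>. x \<in> sphere 0 1 \<longrightarrow> P x"
    using assms unfolding sphere_measure_def AE_completion_iff by (subst (asm) AE_restrict_space_iff) auto
  then obtain N where N: "{x \<in> space ?\<mu>. \<not> (x \<in> sphere 0 1 \<longrightarrow> P x)} \<subseteq> N" "emeasure ?\<mu> N = 0" "N \<in> sets ?\<mu>"
    by (rule AE_E)
  then have Nb[measurable]: "N \<in> sets borel" by simp
  have "N \<in> null_sets ?\<mu>" using N by (simp add: null_sets_def)
  then have "AE x in ?\<mu>. x \<notin> N" by (rule AE_not_in)
  then have null: "emeasure lborel (ball 0 1 \<inter> sgn -` N) = 0"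
    by (subst (asm) AE_distr_sgn_notin_iff) auto
  show thesis
  proof (rule that[of "sgn -` N"])
    show "sgn -` N \<in> sets borel" using measurable_sets[OF measurable_sgn Nb] by simp
    then show "AE x in lborel. x \<notin> sgn -` N" using null by (intro AE_lborel_cone) auto
    show "P x" if "norm x = 1" "x \<notin> sgn -` N" for x
    proof -
      have "sgn x = x" using that by (simp add: sgn_div_norm)
      then show ?thesis using that N(1) by auto
    qed
  qed simp
qed

lemma AE_sphere_measureI:
  fixes C :: "(real^'n) set"
  assumes [measurable]: "C \<in> sets borel" and inv: "\<And>x. sgn x \<in> C \<longleftrightarrow> x \<in> C"
    and "AE x in lborel. x \<notin> C"
  shows "AE x in sphere_measure. x \<notin> C"
proof -
  let ?\<mu> = "distr (uniform_measure lborel (ball 0 1)) borel sgn :: (real^'n) measure"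
  have "C \<in> null_sets lborel" using assms by (subst AE_iff_null_sets) auto
  then have "emeasure lborel (ball 0 1 \<inter> C) = 0" by (auto intro: emeasure_eq_0[of C])
  moreover have "sgn -` C = C" using inv by auto
  ultimately have "AE x in ?\<mu>. x \<notin> C" by (subst AE_distr_sgn_notin_iff) auto
  then show ?thesis
    unfolding sphere_measure_def AE_completion_iff by (subst AE_restrict_space_iff) auto
qed

text \<open>The normalised surface measure is by definition a radial projection, so integrals over the sphere
  are integrals over the ball; this makes polar coordinates unnecessary.\<close>

lemma nn_integral_sphere_measure:
  fixes F :: "real^'n \<Rightarrow> ennreal"
  assumes [measurable]: "F \<in> borel_measurable borel"
  shows "(\<integral>\<^sup>+x. F x \<partial>sphere_measure) = (\<integral>\<^sup>+x\<in>ball 0 1. F (sgn x) \<partial>lborel) / ennreal (unit_ball_vol (real CARD('n)))"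
proof -
  have [measurable]: "sphere (0::real^'n) 1 \<in> sets borel" by simp
  have "(\<integral>\<^sup>+x. F x \<partial>sphere_measure) = (\<integral>\<^sup>+x\<in>sphere 0 1. F x \<partial>distr (uniform_measure lborel (ball 0 1)) borel sgn)"
    unfolding sphere_measure_def nn_integral_completion by (rule nn_integral_restrict_space) simp
  also have "\<dots> = (\<integral>\<^sup>+x. F (sgn x) * indicator (sphere 0 1) (sgn x) \<partial>uniform_measure lborel (ball 0 1))"
    by (rule nn_integral_distr) auto
  also have "\<dots> = (\<integral>\<^sup>+x. F (sgn x) * indicator (sphere 0 1) (sgn x) * indicator (ball 0 1) x \<partial>lborel) / emeasure lborel (ball (0::real^'n) 1)"
    by (rule nn_integral_uniform_measure) auto
  also have "(\<integral>\<^sup>+x. F (sgn x) * indicator (sphere 0 1) (sgn x) * indicator (ball 0 1) x \<partial>lborel) = (\<integral>\<^sup>+x\<in>ball 0 1. F (sgn x) \<partial>lborel)"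
  proof (rule nn_integral_cong_AE)
    have "AE x in lborel. x \<noteq> (0::real^'n)" by (rule AE_lborel_singleton)
    then show "AE x in lborel. F (sgn x) * indicator (sphere 0 1) (sgn x) * indicator (ball 0 1) x = F (sgn x) * indicator (ball 0 1) (x::real^'n)"
      by eventually_elim (auto simp: norm_sgn)
  qed
  finally show ?thesis by (simp add: emeasure_ball)
qed

lemma homogeneous_degree_zero_sgn:
  assumes "homogeneous_degree_zero \<Omega>" "x \<noteq> 0"
  shows "\<Omega> (sgn x) = \<Omega> x"
  using assms by (simp add: homogeneous_degree_zero_def sgn_div_norm)

text \<open>Change \<open>\<Omega>\<close> on a null cone to make it Borel on the whole space and still homogeneous. Borel
  measurability is what the iterated integrals below require.\<close>

lemma borel_representative:
  fixes \<Omega> :: "real^'n \<Rightarrow> complex"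
  assumes meas: "\<Omega> \<in> borel_measurable sphere_measure" and hom: "homogeneous_degree_zero \<Omega>"
  obtains O' C where "O' \<in> borel_measurable borel" "homogeneous_degree_zero O'" "\<And>x. O' (sgn x) = O' x"
    "C \<in> sets borel" "\<And>x. sgn x \<in> C \<longleftrightarrow> x \<in> C" "AE x in lborel. x \<notin> C"
    "\<And>x. x \<noteq> 0 \<Longrightarrow> x \<notin> C \<Longrightarrow> O' x = \<Omega> x"
proof -
  let ?\<mu> = "distr (uniform_measure lborel (ball 0 1)) borel sgn :: (real^'n) measure"
  let ?M = "restrict_space ?\<mu> (sphere 0 1)"
  have "(\<lambda>x. Re (\<Omega> x)) \<in> borel_measurable (completion ?M)" "(\<lambda>x. Im (\<Omega> x)) \<in> borel_measurable (completion ?M)"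
    using meas by (auto simp flip: sphere_measure_def)
  note this[THEN completion_ex_borel_measurable_real]
  then obtain a b where a: "a \<in> borel_measurable ?M" "AE x in ?M. Re (\<Omega> x) = a x"
    and b: "b \<in> borel_measurable ?M" "AE x in ?M. Im (\<Omega> x) = b x"
    by blast
  define a' b' where "a' x = (if x \<in> sphere 0 1 then a x else 0)" and "b' x = (if x \<in> sphere 0 1 then b x else 0)" for x
  have [measurable]: "a' \<in> borel_measurable borel" "b' \<in> borel_measurable borel"
  proof -
    have "(\<lambda>x. if x \<in> sphere 0 1 then f x else 0) \<in> borel_measurable ?\<mu>" if "f \<in> borel_measurable ?M" for f :: "real^'n \<Rightarrow> real"
      by (rule measurable_restrict_space_iff[THEN iffD1, OF _ _ that]) simp_all
    from this[OF a(1)] this[OF b(1)] show "a' \<in> borel_measurable borel" "b' \<in> borel_measurable borel"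
      unfolding a'_def b'_def by simp_all
  qed
  define O' where "O' x = Complex (a' (sgn x)) (b' (sgn x))" for x
  have "AE x in sphere_measure. Re (\<Omega> x) = a x \<and> Im (\<Omega> x) = b x"
    unfolding sphere_measure_def AE_completion_iff using a(2) b(2) by eventually_elim simp
  then obtain C where C: "C \<in> sets borel" "\<And>x. sgn x \<in> C \<longleftrightarrow> x \<in> C" "AE x in lborel. x \<notin> C"
    "\<And>x. norm x = 1 \<Longrightarrow> x \<notin> C \<Longrightarrow> Re (\<Omega> x) = a x \<and> Im (\<Omega> x) = b x"
    by (rule AE_sphere_measureE) (rule that)
  show thesis
  proof (rule that[of O' C])
    have "O' = (\<lambda>x. complex_of_real (a' (sgn x)) + \<i> * complex_of_real (b' (sgn x)))"
      by (auto simp: O'_def complex_eq_iff)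
    then show "O' \<in> borel_measurable borel" by simp
    show "homogeneous_degree_zero O'" by (simp add: homogeneous_degree_zero_def O'_def sgn_scaleR_pos)
    show "O' (sgn x) = O' x" for x by (simp add: O'_def)
    show "O' x = \<Omega> x" if "x \<noteq> 0" "x \<notin> C" for x
    proof -
      have "norm (sgn x) = 1" "sgn x \<notin> C" using that C(2) by (auto simp: norm_sgn)
      from C(4)[OF this] have "O' x = \<Omega> (sgn x)"
        using \<open>norm (sgn x) = 1\<close> by (simp add: O'_def a'_def b'_def complex_eq_iff)
      then show ?thesis using homogeneous_degree_zero_sgn[OF hom] that by simp
    qed
  qed (rule C)+
qed

text \<open>A rotation is a Lipschitz bijection, so it preserves null sets.\<close>

lemma rotated_cone_null:
  fixes C :: "(real^'n) set"
  assumes [measurable]: "C \<in> sets borel" and C: "AE x in lborel. x \<notin> C" and Q: "rotation_matrix Q"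
  shows "AE x in lborel. Q *v x \<notin> C"
proof -
  have tr: "transpose Q *v (Q *v x) = x" for x :: "real^'n"
    using Q by (simp add: rotation_matrix_def orthogonal_matrix matrix_vector_mul_assoc)
  have "orthogonal_transformation ((*v) (transpose Q))"
    using Q by (simp add: rotation_matrix_def orthogonal_transformation_matrix orthogonal_matrix_transpose)
  then have nm: "norm (transpose Q *v x) = norm x" for x by (rule orthogonal_transformation_norm)
  have m: "(\<lambda>x. Q *v x) \<in> borel_measurable borel"
    by (intro borel_measurable_continuous_onI linear_continuous_on) (simp add: matrix_vector_mul_bounded_linear)
  have T: "(\<lambda>x. Q *v x) -` C \<in> sets borel" using measurable_sets[OF m, of C] by simp
  have "emeasure lborel ((\<lambda>x. Q *v x) -` C) \<le> ennreal ((5 * 1) ^ DIM(real^'n)) * emeasure lborel C"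
  proof (rule emeasure_lborel_Lipschitz_image_le[OF T, where \<psi> = "(*v) (transpose Q)"])
    show "(\<lambda>x. Q *v x) -` C \<subseteq> (*v) (transpose Q) ` C"
    proof
      fix x assume "x \<in> (\<lambda>x. Q *v x) -` C"
      then show "x \<in> (*v) (transpose Q) ` C" by (intro image_eqI[of _ _ "Q *v x"] tr[symmetric]) simp
    qed
    show "norm (transpose Q *v x - transpose Q *v y) \<le> 1 * norm (x - y)" for x y
      using nm[of "x - y"] by (simp add: matrix_vector_mult_diff_distrib)
  qed auto
  also have "emeasure lborel C = 0" using C by (subst (asm) AE_iff_null_sets[symmetric]) auto
  finally have "(\<lambda>x. Q *v x) -` C \<in> null_sets lborel" using T by (simp add: null_sets_def)
  then show ?thesis using AE_not_in by fastforce
qed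

text \<open>Both \<open>C\<close> and its rotated copy are null cones, so the Borel representative has the same rotation
  differences as \<open>\<Omega>\<close> in the integral sense.\<close>

lemma nn_integral_rotation_difference_eq:
  fixes \<Omega> O' :: "real^'n \<Rightarrow> complex"
  assumes [measurable]: "O' \<in> borel_measurable borel" and O': "\<And>x. O' (sgn x) = O' x"
    and C: "C \<in> sets borel" "\<And>x. sgn x \<in> C \<longleftrightarrow> x \<in> C" "AE x in lborel. x \<notin> C"
    and eq: "\<And>x. x \<noteq> 0 \<Longrightarrow> x \<notin> C \<Longrightarrow> O' x = \<Omega> x" and Q: "rotation_matrix Q"
  shows "(\<integral>\<^sup>+x\<in>ball 0 1. ennreal (norm (O' (Q *v x) - O' x) powr s) \<partial>lborel)
     = ennreal (unit_ball_vol (real CARD('n))) * (\<integral>\<^sup>+x. ennreal (norm (\<Omega> (Q *v x) - \<Omega> x) powr s) \<partial>sphere_measure)"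
proof -
  have [measurable]: "(\<lambda>x. Q *v x) \<in> borel_measurable borel"
    by (intro borel_measurable_continuous_onI linear_continuous_on) (simp add: matrix_vector_mul_bounded_linear)
  have "orthogonal_transformation ((*v) Q)"
    using Q by (simp add: rotation_matrix_def orthogonal_transformation_matrix)
  then have nm: "norm (Q *v x) = norm x" for x by (simp add: orthogonal_transformation_norm)
  have sg: "sgn (Q *v x) = Q *v sgn x" for x
    by (simp add: sgn_div_norm nm matrix_vector_mult_scaleR)
  let ?D = "(\<lambda>x. Q *v x) -` C"
  have D: "?D \<in> sets borel" using measurable_sets[of "\<lambda>x. Q *v x" borel borel C] C by simp
  have 1: "AE x in sphere_measure. x \<notin> C" by (rule AE_sphere_measureI[OF C])
  have "AE x in lborel. x \<notin> ?D" using rotated_cone_null[OF C(1,3) Q] by simp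
  moreover have "sgn x \<in> ?D \<longleftrightarrow> x \<in> ?D" for x using C(2)[of "Q *v x"] by (simp add: sg)
  ultimately have 2: "AE x in sphere_measure. x \<notin> ?D" using D by (intro AE_sphere_measureI) auto
  have 3: "AE x in sphere_measure. norm x = 1"
    by (rule AE_I2) (auto simp: sphere_measure_def space_restrict_space)
  have "(\<integral>\<^sup>+x. ennreal (norm (\<Omega> (Q *v x) - \<Omega> x) powr s) \<partial>sphere_measure) = (\<integral>\<^sup>+x. ennreal (norm (O' (Q *v x) - O' x) powr s) \<partial>sphere_measure)"
  proof (rule nn_integral_cong_AE)
    show "AE x in sphere_measure. ennreal (norm (\<Omega> (Q *v x) - \<Omega> x) powr s) = ennreal (norm (O' (Q *v x) - O' x) powr s)"
      using 1 2 3
    proof eventually_elim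
      case (elim x)
      then have "Q *v x \<noteq> 0" "x \<noteq> 0" using nm[of x] by auto
      then show ?case using eq[of x] eq[of "Q *v x"] elim by simp
    qed
  qed
  also have "\<dots> = (\<integral>\<^sup>+x\<in>ball 0 1. ennreal (norm (O' (Q *v sgn x) - O' (sgn x)) powr s) \<partial>lborel) / ennreal (unit_ball_vol (real CARD('n)))"
    by (rule nn_integral_sphere_measure) measurable
  also have "(\<integral>\<^sup>+x\<in>ball 0 1. ennreal (norm (O' (Q *v sgn x) - O' (sgn x)) powr s) \<partial>lborel) = (\<integral>\<^sup>+x\<in>ball 0 1. ennreal (norm (O' (Q *v x) - O' x) powr s) \<partial>lborel)"
    using O' by (simp flip: sg)
  finally have e: "(\<integral>\<^sup>+x. ennreal (norm (\<Omega> (Q *v x) - \<Omega> x) powr s) \<partial>sphere_measure)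
    = (\<integral>\<^sup>+x\<in>ball 0 1. ennreal (norm (O' (Q *v x) - O' x) powr s) \<partial>lborel) / ennreal (unit_ball_vol (real CARD('n)))" .
  have "ennreal V * (X / ennreal V) = X" if "0 < V" for V X
    using that mult_divide_eq_ennreal[of "ennreal V" X] by (simp add: ennreal_times_divide mult.commute)
  then show ?thesis unfolding e by simp
qed

section \<open>Consequences of the Dini condition\<close>

lemma epowr_le_imp_le:
  assumes "epowr X (1 / p) \<le> ennreal c" "0 < p" "0 \<le> c"
  shows "X \<le> ennreal (c powr p)"
proof (cases "X = top")
  case True
  then show ?thesis using assms by (simp add: epowr_def top_unique)
next
  case False
  then have "enn2real X powr (1/p) \<le> c" using assms by (simp add: epowr_def)
  then have "(enn2real X powr (1/p)) powr p \<le> c powr p" using assms by (intro powr_mono2) auto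
  then have "enn2real X \<le> c powr p" using assms by (simp add: powr_powr)
  then have "ennreal (enn2real X) \<le> ennreal (c powr p)" by (rule ennreal_leI)
  then show ?thesis using False by (simp add: ennreal_enn2real_if)
qed

lemma epowr_le:
  assumes "X \<le> ennreal (c powr p)" "0 < p" "0 \<le> c"
  shows "epowr X (1 / p) \<le> ennreal c"
proof -
  have "X \<noteq> top" using assms by (auto simp: top_unique)
  have "enn2real X \<le> enn2real (ennreal (c powr p))" using assms(1) by (intro enn2real_mono) auto
  then have "enn2real X \<le> c powr p" by simp
  then have "enn2real X powr (1/p) \<le> (c powr p) powr (1/p)" using assms by (intro powr_mono2) auto
  then have "enn2real X powr (1/p) \<le> c" using assms by (simp add: powr_powr)
  then show ?thesis using \<open>X \<noteq> top\<close> by (simp add: epowr_def ennreal_leI)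
qed

lemma two_powr_neg_add: "2 powr (- real (m + k)) = 2 powr (- real k) / (2::real) ^ m"
  by (simp add: powr_minus powr_realpow power_add divide_inverse flip: of_nat_add)

text \<open>On the dyadic interval that starts at \<open>2 powr (- real (Suc j))\<close> the modulus is at least its value at
  the left end point, and the weight is comparable to a constant.\<close>

lemma dyadic_sum_le_integral:
  fixes \<eta> :: "real \<Rightarrow> ennreal"
  assumes mono: "\<And>x y. 0 < x \<Longrightarrow> x \<le> y \<Longrightarrow> \<eta> x \<le> \<eta> y" and \<beta>: "0 \<le> \<beta>"
  shows "(\<Sum>j. \<eta> (2 powr (- real (Suc j))) * ennreal (2 powr (\<beta> * real (Suc j))))
    \<le> ennreal (2 powr (1 + \<beta>)) * (\<integral>\<^sup>+\<delta>\<in>{0<..<1}. \<eta> \<delta> / ennreal (\<delta> powr (1 + \<beta>)) \<partial>lborel)"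
proof -
  define I where "I j = {2 powr (- real (Suc j))..<2 powr (- real j)}" for j :: nat
  define c where "c j = \<eta> (2 powr (- real (Suc j))) / ennreal (2 powr (- real j * (1 + \<beta>)))" for j :: nat
  have disj: "disjoint_family I"
    unfolding disjoint_family_on_def
  proof (intro ballI impI)
    fix i j :: nat assume "i \<noteq> j"
    have *: "I a \<inter> I b = {}" if "a < b" for a b
    proof -
      have "2 powr (- real b) \<le> (2::real) powr (- real (Suc a))" using that by (intro powr_mono) auto
      then show ?thesis by (auto simp: I_def)
    qed
    show "I i \<inter> I j = {}" using *[of i j] *[of j i] \<open>i \<noteq> j\<close> by (cases "i < j") auto
  qed
  have le: "(\<Sum>j. c j * indicator (I j) \<delta>) \<le> \<eta> \<delta> / ennreal (\<delta> powr (1 + \<beta>)) * indicator {0<..<1} \<delta>" for \<delta>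
  proof (cases "\<exists>j. \<delta> \<in> I j")
    case True
    then obtain j where j: "\<delta> \<in> I j" by blast
    have pos: "0 < \<delta>" using j less_le_trans[of 0 "2 powr (- real (Suc j))" \<delta>] by (simp add: I_def)
    have "2 powr (- real j) \<le> (2::real) powr 0" by (intro powr_mono) auto
    then have "\<delta> < 1" using j by (auto simp: I_def)
    have "(\<Sum>j. c j * indicator (I j) \<delta>) = c j" by (rule suminf_cmult_indicator[OF disj j])
    also have "\<dots> \<le> \<eta> \<delta> / ennreal (\<delta> powr (1 + \<beta>))"
      unfolding c_def
    proof (rule divide_right_mono_ennreal[THEN order_trans])
      show "\<eta> (2 powr (- real (Suc j))) \<le> \<eta> \<delta>" using j by (intro mono) (auto simp: I_def)
      have "\<delta> powr (1 + \<beta>) \<le> (2 powr (- real j)) powr (1 + \<beta>)"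
        using j pos \<beta> by (intro powr_mono2) (auto simp: I_def)
      then show "\<eta> \<delta> / ennreal (2 powr (- real j * (1 + \<beta>))) \<le> \<eta> \<delta> / ennreal (\<delta> powr (1 + \<beta>))"
        unfolding powr_powr using pos
          by (auto simp: divide_ennreal_def inverse_ennreal intro!: mult_left_mono ennreal_leI le_imp_inverse_le)
    qed
    finally show ?thesis using pos \<open>\<delta> < 1\<close> by simp
  next
    case False
    then show ?thesis by simp
  qed
  have summand: "c j * emeasure lborel (I j) = ennreal (2 powr (- (1 + \<beta>))) * (\<eta> (2 powr (- real (Suc j))) * ennreal (2 powr (\<beta> * real (Suc j))))" for j
  proof -
    have "(2::real) powr (- real (Suc j)) \<le> 2 powr (- real j)" by (intro powr_mono) auto
    then have "emeasure lborel (I j) = ennreal (2 powr (- real j) - 2 powr (- real (Suc j)))"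
      unfolding I_def by simp
    also have "2 powr (- real j) - 2 powr (- real (Suc j)) = (2::real) powr (- real (Suc j))"
      using powr_add[of 2 "- real (Suc j)" 1] by simp
    finally have "c j * emeasure lborel (I j) = \<eta> (2 powr (- real (Suc j))) * (ennreal (2 powr (real j * (1 + \<beta>))) * ennreal (2 powr (- real (Suc j))))"
      by (simp add: c_def divide_ennreal_def inverse_ennreal powr_minus mult.assoc)
    also have "ennreal (2 powr (real j * (1 + \<beta>))) * ennreal (2 powr (- real (Suc j))) = ennreal (2 powr (- (1 + \<beta>))) * ennreal (2 powr (\<beta> * real (Suc j)))"
      by (simp add: algebra_simps flip: ennreal_mult powr_add)
    finally show ?thesis by (simp add: mult_ac)
  qed
  have "ennreal (2 powr (- (1 + \<beta>))) * (\<Sum>j. \<eta> (2 powr (- real (Suc j))) * ennreal (2 powr (\<beta> * real (Suc j))))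
    = (\<Sum>j. c j * emeasure lborel (I j))"
    by (simp only: summand ennreal_suminf_cmult)
  also have "\<dots> = (\<Sum>j. \<integral>\<^sup>+\<delta>. c j * indicator (I j) \<delta> \<partial>lborel)"
    by (intro suminf_cong nn_integral_cmult_indicator[symmetric]) (simp add: I_def)
  also have "\<dots> = (\<integral>\<^sup>+\<delta>. (\<Sum>j. c j * indicator (I j) \<delta>) \<partial>lborel)"
    by (intro nn_integral_suminf[symmetric]) (simp add: I_def)
  also have "\<dots> \<le> (\<integral>\<^sup>+\<delta>\<in>{0<..<1}. \<eta> \<delta> / ennreal (\<delta> powr (1 + \<beta>)) \<partial>lborel)"
    by (intro nn_integral_mono le)
  finally have "ennreal (2 powr (1 + \<beta>)) * (ennreal (2 powr (- (1 + \<beta>))) * (\<Sum>j. \<eta> (2 powr (- real (Suc j))) * ennreal (2 powr (\<beta> * real (Suc j)))))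
     \<le> ennreal (2 powr (1 + \<beta>)) * (\<integral>\<^sup>+\<delta>\<in>{0<..<1}. \<eta> \<delta> / ennreal (\<delta> powr (1 + \<beta>)) \<partial>lborel)"
    by (intro mult_left_mono) auto
  moreover have "ennreal (2 powr (1 + \<beta>)) * ennreal (2 powr (- (1 + \<beta>))) = 1"
    by (simp flip: ennreal_mult powr_add)
  ultimately show ?thesis by (simp flip: mult.assoc)
qed

lemma dini_modulus_mono:
  "x \<le> y \<Longrightarrow> dini_modulus s \<Omega> x \<le> dini_modulus s \<Omega> y"
  unfolding dini_modulus_def by (intro SUP_subset_mono) auto

lemma dini_summable:
  assumes "dini s \<beta> \<Omega>" "0 \<le> \<beta>" "\<gamma> \<le> \<beta>"
  shows "dini_modulus s \<Omega> (2 powr (- real (Suc j))) < top"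
    and "summable (\<lambda>j. enn2real (dini_modulus s \<Omega> (2 powr (- real (Suc j)))) * 2 powr (\<gamma> * real (Suc j)))"
proof -
  let ?f = "\<lambda>j. dini_modulus s \<Omega> (2 powr (- real (Suc j)))"
  have fin: "(\<Sum>j. ?f j * ennreal (2 powr (\<beta> * real (Suc j)))) < top"
  proof (rule le_less_trans[OF dyadic_sum_le_integral])
    show "ennreal (2 powr (1 + \<beta>)) * (\<integral>\<^sup>+\<delta>\<in>{0<..<1}. dini_modulus s \<Omega> \<delta> / ennreal (\<delta> powr (1 + \<beta>)) \<partial>lborel) < top"
      using assms(1) by (simp add: dini_def ennreal_mult_less_top)
  qed (use assms in \<open>auto intro: dini_modulus_mono\<close>)
  have "?f j * ennreal (2 powr (\<beta> * real (Suc j))) < top" for j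
    using fin by (rule ennreal_suminf_lessD)
  then have top: "?f j < top" for j
  proof -
    have "?f j * ennreal (2 powr (\<beta> * real (Suc j))) < top" by fact
    then have "?f j = 0 \<or> ?f j < top" by (auto simp: ennreal_mult_less_top)
    then show ?thesis by auto
  qed
  then show "dini_modulus s \<Omega> (2 powr (- real (Suc j))) < top" by blast
  have eq: "?f j * ennreal (2 powr (\<beta> * real (Suc j))) = ennreal (enn2real (?f j) * 2 powr (\<beta> * real (Suc j)))" for j
    using top[of j] by (simp add: ennreal_mult)
  have "summable (\<lambda>j. enn2real (?f j) * 2 powr (\<beta> * real (Suc j)))"
    using fin unfolding eq by (intro summable_suminf_not_top mult_nonneg_nonneg) (simp_all only: less_top enn2real_nonneg powr_ge_zero)
  then show "summable (\<lambda>j. enn2real (?f j) * 2 powr (\<gamma> * real (Suc j)))"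
  proof (rule summable_comparison_test'[where N = 0])
    fix j
    have "2 powr (\<gamma> * real (Suc j)) \<le> (2::real) powr (\<beta> * real (Suc j))"
      using assms by (intro powr_mono mult_right_mono) auto
    then show "norm (enn2real (?f j) * 2 powr (\<gamma> * real (Suc j))) \<le> enn2real (?f j) * 2 powr (\<beta> * real (Suc j))"
      by (simp add: abs_mult mult_left_mono)
  qed
qed


lemma conj_exp_ennreal:
  assumes "1 < \<sigma>"
  shows "conj_exp (ennreal \<sigma>) = ennreal (\<sigma> / (\<sigma> - 1))"
proof -
  have "inverse (ennreal \<sigma>) = ennreal (1 / \<sigma>)" using assms by (simp add: inverse_ennreal divide_inverse)
  moreover have "1 - ennreal (1 / \<sigma>) = ennreal (1 - 1 / \<sigma>)"
    using assms by (subst ennreal_1[symmetric], subst ennreal_minus) auto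
  moreover have "0 < 1 - 1 / \<sigma>" "inverse (1 - 1 / \<sigma>) = \<sigma> / (\<sigma> - 1)" using assms by (auto simp: field_simps)
  ultimately show ?thesis by (simp add: conj_exp_def inverse_ennreal)
qed

lemma nn_integral_representative_powr:
  fixes \<Omega> O' :: "real^'n \<Rightarrow> complex"
  assumes [measurable]: "O' \<in> borel_measurable borel" and O': "\<And>x. O' (sgn x) = O' x"
    and C: "C \<in> sets borel" "\<And>x. sgn x \<in> C \<longleftrightarrow> x \<in> C" "AE x in lborel. x \<notin> C"
    and eq: "\<And>x. x \<noteq> 0 \<Longrightarrow> x \<notin> C \<Longrightarrow> O' x = \<Omega> x"
    and fin: "(\<integral>\<^sup>+x. ennreal (norm (\<Omega> x) powr s) \<partial>sphere_measure) < top"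
  shows "(\<integral>\<^sup>+x\<in>ball 0 1. ennreal (norm (O' x) powr s) \<partial>lborel) < top"
proof -
  have 1: "AE x in sphere_measure. x \<notin> C" by (rule AE_sphere_measureI[OF C])
  have 3: "AE x in sphere_measure. norm (x::real^'n) = 1"
    by (rule AE_I2) (auto simp: sphere_measure_def space_restrict_space)
  have "(\<integral>\<^sup>+x. ennreal (norm (\<Omega> x) powr s) \<partial>sphere_measure) = (\<integral>\<^sup>+x. ennreal (norm (O' x) powr s) \<partial>sphere_measure)"
  proof (rule nn_integral_cong_AE)
    show "AE x in sphere_measure. ennreal (norm (\<Omega> x) powr s) = ennreal (norm (O' x) powr s)"
      using 1 3
    proof eventually_elim
      case (elim x)
      then have "x \<noteq> 0" by auto
      then show ?case using eq[of x] elim by simp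
    qed
  qed
  also have "\<dots> = (\<integral>\<^sup>+x\<in>ball 0 1. ennreal (norm (O' (sgn x)) powr s) \<partial>lborel) / ennreal (unit_ball_vol (real CARD('n)))"
    by (rule nn_integral_sphere_measure) measurable
  finally have "(\<integral>\<^sup>+x\<in>ball 0 1. ennreal (norm (O' x) powr s) \<partial>lborel) / ennreal (unit_ball_vol (real CARD('n))) < top"
    using fin by (simp add: O')
  then show ?thesis
    by (cases "(\<integral>\<^sup>+x\<in>ball 0 1. ennreal (norm (O' x) powr s) \<partial>lborel) = top") (auto simp: ennreal_top_divide less_top)
qed

text \<open>Size and oscillation of the Borel representative, as norms by duality, in terms of the Dini modulus.
  For finite \<open>s\<close> the oscillation is the shift estimate. For \<open>s = \<infinity>\<close> the bound is pointwise: the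
  directions of \<open>u\<close> and \<open>u - a\<close> are joined by one small rotation, and the modulus is a supremum over all
  points. The number \<open>m\<close> absorbs the loss between the size of a shift and that of the rotations.\<close>

lemma dini_representative_bounds:
  fixes \<Omega> O' :: "real^'n \<Rightarrow> complex"
  assumes dini: "dini s \<beta> \<Omega>" and s: "1 < s" and s': "s' = enn2real (conj_exp s)"
    and \<beta>: "0 \<le> \<beta>" and m: "160 * real CARD('n) \<le> 2 ^ m"
    and Om[measurable]: "O' \<in> borel_measurable borel" and hom: "homogeneous_degree_zero O'" and O': "\<And>x. O' (sgn x) = O' x"
    and C: "C \<in> sets borel" "\<And>x. sgn x \<in> C \<longleftrightarrow> x \<in> C" "AE x in lborel. x \<notin> C"
    and eq: "\<And>x. x \<noteq> 0 \<Longrightarrow> x \<notin> C \<Longrightarrow> O' x = \<Omega> x"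
  defines "\<nu> \<equiv> real CARD('n) * (1 - 1 / s')"
    and "\<eta> \<equiv> \<lambda>j. enn2real (dini_modulus s \<Omega> (2 powr (- real (Suc j))))"
  shows "1 \<le> s'"
    and "\<exists>A>0. \<forall>r>0. dual_bound s' (ball 0 r) (\<lambda>u. norm (O' u)) (A * r powr \<nu>)"
    and "\<exists>A>0. \<forall>j r a. 0 < r \<longrightarrow> norm a \<le> r * 2 powr (- real (m + Suc j)) \<longrightarrow>
      dual_bound s' (annulus r) (\<lambda>u. norm (O' (u - a) - O' u)) (A * r powr \<nu> * (\<eta> j + 2 powr (- real (m + Suc j))))"
    and "\<And>l. 0 \<le> l \<Longrightarrow> ennreal l \<le> s \<Longrightarrow> (\<integral>\<^sup>+x\<in>ball 0 1. ennreal (norm (O' x) powr l) \<partial>lborel) < top"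
proof -
  let ?N = "real CARD('n)"
  have "1 \<le> s' \<and> (\<exists>A>0. \<forall>r>0. dual_bound s' (ball 0 r) (\<lambda>u. norm (O' u)) (A * r powr \<nu>)) \<and>
     (\<exists>A>0. \<forall>j r a. 0 < r \<longrightarrow> norm a \<le> r * 2 powr (- real (m + Suc j)) \<longrightarrow>
      dual_bound s' (annulus r) (\<lambda>u. norm (O' (u - a) - O' u)) (A * r powr \<nu> * (\<eta> j + 2 powr (- real (m + Suc j))))) \<and>
     (\<forall>l. 0 \<le> l \<longrightarrow> ennreal l \<le> s \<longrightarrow> (\<integral>\<^sup>+x\<in>ball 0 1. ennreal (norm (O' x) powr l) \<partial>lborel) < top)"
  proof (cases "s = top")
    case True
    then have s'1: "s' = 1" "\<nu> = 0" by (simp_all add: s' conj_exp_top \<nu>_def)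
    have "esssup sphere_measure (\<lambda>x. ennreal (norm (\<Omega> x))) < top"
      using dini True by (simp add: dini_def Lp_sphere_def)
    then obtain M where M: "esssup sphere_measure (\<lambda>x. ennreal (norm (\<Omega> x))) = ennreal M" "0 \<le> M"
      by (cases "esssup sphere_measure (\<lambda>x. ennreal (norm (\<Omega> x)))") auto
    have "AE x in sphere_measure. ennreal (norm (\<Omega> x)) \<le> ennreal M"
      unfolding M(1)[symmetric] by (rule esssup_AE)
    then obtain D where D: "D \<in> sets borel" "\<And>x. sgn x \<in> D \<longleftrightarrow> x \<in> D" "AE x in lborel. x \<notin> D"
      "\<And>x. norm x = 1 \<Longrightarrow> x \<notin> D \<Longrightarrow> ennreal (norm (\<Omega> x)) \<le> ennreal M"
      by (rule AE_sphere_measureE) (rule that)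
    have n0: "AE x in lborel. x \<noteq> (0::real^'n)" by (rule AE_lborel_singleton)
    have bd: "AE x in lborel. norm (O' x) \<le> M"
      using n0 C(3) D(3)
    proof eventually_elim
      case (elim x)
      have "O' x = O' (sgn x)" by (simp add: O')
      also have "\<dots> = \<Omega> (sgn x)" using elim C(2) by (intro eq) (auto simp: sgn_zero_iff)
      finally have "norm (O' x) = norm (\<Omega> (sgn x))" by simp
      moreover have "ennreal (norm (\<Omega> (sgn x))) \<le> ennreal M" using elim D(2) by (intro D(4)) (auto simp: norm_sgn)
      ultimately show ?case using M by simp
    qed
    have hom\<Omega>: "homogeneous_degree_zero \<Omega>" using dini by (simp add: dini_def)
    have 2: "\<forall>r>0. dual_bound s' (ball 0 r) (\<lambda>u. norm (O' u)) ((M + 1) * r powr \<nu>)"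
      unfolding s'1
    proof (intro allI impI)
      fix r :: real assume "0 < r"
      have "dual_bound 1 (ball 0 r) (\<lambda>u. norm (O' u)) (M + 1)"
        using bd M by (intro dual_bound_AE) (auto elim!: eventually_mono)
      then show "dual_bound 1 (ball 0 r) (\<lambda>u. norm (O' u)) ((M + 1) * r powr 0)" using \<open>0 < r\<close> by simp
    qed
    have 3: "dual_bound s' (annulus r) (\<lambda>u. norm (O' (u - a) - O' u)) (1 * r powr \<nu> * (\<eta> j + 2 powr (- real (m + Suc j))))"
      if r: "0 < r" and a: "norm a \<le> r * 2 powr (- real (m + Suc j))" for j r and a :: "real^'n"
    proof -
      let ?\<delta> = "2 powr (- real (Suc j))"
      have \<epsilon>: "80 * (norm a / r) \<le> ?\<delta> / 2"
      proof -
        have "norm a / r \<le> 2 powr (- real (m + Suc j))" using r a by (simp add: pos_divide_le_eq mult.commute)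
        also have "2 powr (- real (m + Suc j)) = ?\<delta> / 2 ^ m"
          by (rule two_powr_neg_add)
        also have "\<dots> \<le> ?\<delta> / 160"
        proof -
          have "160 * 1 \<le> 160 * ?N" by (intro mult_left_mono) auto
          then have "160 \<le> (2::real) ^ m" using m by linarith
          then show ?thesis by (intro divide_left_mono) auto
        qed
        finally show ?thesis by linarith
      qed
      have \<delta>1: "?\<delta> \<le> 1" by (rule order_trans[OF powr_mono[of _ 0]]) auto
      have ar: "norm a < r"
      proof -
        have "norm a / r < 1" using \<epsilon> \<delta>1 by linarith
        then show ?thesis using r by (simp add: divide_less_eq)
      qed
      have osc: "norm (\<Omega> (u - a) - \<Omega> u) \<le> \<eta> j" if u: "u \<in> annulus r" for u
      proof -
        define x y where "x = sgn u" and "y = sgn (u - a)"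
        have nu: "r \<le> norm u" using u by (simp add: annulus_def)
        have u0: "u \<noteq> 0" using nu r by auto
        have ua0: "u - a \<noteq> 0" using nu ar by auto
        have xy: "norm x = 1" "norm y = 1" using u0 ua0 by (auto simp: x_def y_def norm_sgn)
        have "norm u *\<^sub>R (y - x) = (norm u - norm (u - a)) *\<^sub>R y - a"
        proof -
          have "norm u *\<^sub>R x = u" "norm (u - a) *\<^sub>R y = u - a" using u0 ua0 by (simp_all add: x_def y_def sgn_div_norm)
          then show ?thesis by (simp add: scaleR_diff_right scaleR_diff_left)
        qed
        then have "norm u * norm (y - x) \<le> \<bar>norm u - norm (u - a)\<bar> + norm a"
          using norm_triangle_ineq4[of "(norm u - norm (u - a)) *\<^sub>R y" a] xy
          by (metis norm_scaleR abs_norm_cancel mult.right_neutral)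
        also have "\<dots> \<le> 2 * norm a" using norm_triangle_ineq3[of u "u - a"] by simp
        finally have "norm u * norm (y - x) \<le> 2 * norm a" .
        then have "r * norm (y - x) \<le> 2 * norm a"
          using mult_right_mono[OF nu norm_ge_zero[of "y - x"]] by linarith
        then have yx: "norm (y - x) \<le> 2 * (norm a / r)" using r by (simp add: field_simps)
        have "norm (y - x) \<le> 1" using yx \<epsilon> \<delta>1 by linarith
        then obtain Q where Q: "rotation_matrix Q" "Q *v x = y" "rotation_size Q \<le> 20 * norm (y - x)"
          using rotation_between[OF xy] by blast
        have "0 < ?\<delta>" by simp
        then have "rotation_size Q < ?\<delta>" using Q(3) yx \<epsilon> by linarith
        then have "ennreal (norm (\<Omega> y - \<Omega> x)) \<le> dini_modulus s \<Omega> ?\<delta>"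
          unfolding dini_modulus_def True using Q xy
          by (intro SUP_upper2[of Q]) (auto intro!: SUP_upper2[of x])
        then have "norm (\<Omega> y - \<Omega> x) \<le> \<eta> j"
          using enn2real_mono[of "ennreal (norm (\<Omega> y - \<Omega> x))" "dini_modulus s \<Omega> ?\<delta>"] dini_summable(1)[OF dini \<beta> order_refl, of j]
          by (simp add: \<eta>_def)
        then show ?thesis
          using homogeneous_degree_zero_sgn[OF hom\<Omega>] u0 ua0 by (simp add: x_def y_def)
      qed
      have "C \<in> null_sets lborel" using C by (subst AE_iff_null_sets) auto
      then have "emeasure lborel C = 0" by auto
      note [measurable] = C(1)
      have "(\<lambda>u. u - a) -` C \<in> sets borel" using measurable_sets[of "\<lambda>u. u - a" borel borel C] by simp
      moreover have "emeasure lborel ((\<lambda>u. u - a) -` C) = 0"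
      proof -
        have "emeasure lborel ((\<lambda>u. u - a) -` C) = (\<integral>\<^sup>+u. indicator C (u - a) \<partial>lborel)"
        proof -
          have "indicator C (u - a) = (indicator ((\<lambda>u. u - a) -` C) u :: ennreal)" for u
            by (auto split: split_indicator)
          then show ?thesis using \<open>(\<lambda>u. u - a) -` C \<in> sets borel\<close> by simp
        qed
        also have "\<dots> = (\<integral>\<^sup>+u. indicator C u \<partial>lborel)" by (rule nn_integral_lborel_translate) simp
        finally show ?thesis using \<open>emeasure lborel C = 0\<close> by simp
      qed
      ultimately have sh: "AE u in lborel. u \<notin> (\<lambda>u. u - a) -` C" by (intro AE_not_in) (simp add: null_sets_def)
      have "dual_bound 1 (annulus r) (\<lambda>u. norm (O' (u - a) - O' u)) (\<eta> j)"
      proof (rule dual_bound_AE)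
        show "AE u in lborel. u \<in> annulus r \<longrightarrow> norm (O' (u - a) - O' u) \<le> \<eta> j"
          using sh C(3)
        proof eventually_elim
          case (elim u)
          show ?case
          proof
            assume u: "u \<in> annulus r"
            then have "u \<noteq> 0" "u - a \<noteq> 0" using r ar by (auto simp: annulus_def)
            then show "norm (O' (u - a) - O' u) \<le> \<eta> j" using osc[OF u] elim eq by simp
          qed
        qed
      qed (auto simp: \<eta>_def)
      then show ?thesis unfolding s'1 by (rule dual_bound_mono) (use r in auto)
    qed
    have 4: "(\<integral>\<^sup>+x\<in>ball 0 1. ennreal (norm (O' x) powr l) \<partial>lborel) < top" if "0 \<le> l" for l
    proof -
      have "(\<integral>\<^sup>+x\<in>ball 0 1. ennreal (norm (O' x) powr l) \<partial>lborel) \<le> (\<integral>\<^sup>+x\<in>ball (0::real^'n) 1. ennreal (M powr l) \<partial>lborel)"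
        using bd that by (intro nn_integral_mono_AE) (auto elim!: eventually_mono split: split_indicator intro!: ennreal_leI powr_mono2)
      also have "\<dots> < top" by (simp add: nn_integral_cmult_indicator ennreal_mult_less_top emeasure_ball)
      finally show ?thesis .
    qed
    show ?thesis
    proof (intro conjI)
      show "\<exists>A>0. \<forall>r>0. dual_bound s' (ball 0 r) (\<lambda>u. norm (O' u)) (A * r powr \<nu>)"
        using 2 M by (intro exI[of _ "M + 1"]) auto
      show "\<exists>A>0. \<forall>j r a. 0 < r \<longrightarrow> norm a \<le> r * 2 powr (- real (m + Suc j)) \<longrightarrow>
        dual_bound s' (annulus r) (\<lambda>u. norm (O' (u - a) - O' u)) (A * r powr \<nu> * (\<eta> j + 2 powr (- real (m + Suc j))))"
        using 3 by (intro exI[of _ 1] conjI allI impI) auto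
    qed (use 4 s'1 in auto)
  next
    case False
    then obtain \<sigma> where \<sigma>: "s = ennreal \<sigma>" "1 < \<sigma>" using s
      by (cases s) (auto simp: ennreal_less_iff simp flip: ennreal_1)
    have s'eq: "s' = \<sigma> / (\<sigma> - 1)" using \<sigma> by (simp add: s' conj_exp_ennreal)
    have conj: "1 / \<sigma> + 1 / s' = 1" using \<sigma> by (simp add: s'eq field_simps)
    have \<nu>: "\<nu> = ?N / \<sigma>"
    proof -
      have "1 - 1 / s' = 1 / \<sigma>" using conj by linarith
      then show ?thesis by (simp add: \<nu>_def)
    qed
    have "(\<integral>\<^sup>+x. ennreal (norm (\<Omega> x) powr \<sigma>) \<partial>sphere_measure) < top"
      using dini \<sigma> by (simp add: dini_def Lp_sphere_def)
    then have fin: "(\<integral>\<^sup>+x\<in>ball 0 1. ennreal (norm (O' x) powr \<sigma>) \<partial>lborel) < top"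
      by (intro nn_integral_representative_powr[OF Om O' C eq])
    then obtain X where X: "(\<integral>\<^sup>+x\<in>ball 0 1. ennreal (norm (O' x) powr \<sigma>) \<partial>lborel) = ennreal X" "0 \<le> X"
      by (cases "\<integral>\<^sup>+x\<in>ball 0 1. ennreal (norm (O' x) powr \<sigma>) \<partial>lborel") auto
    define M where "M = (X + 1) powr (1 / \<sigma>)"
    have M: "0 < M" "X \<le> M powr \<sigma>" using X \<sigma> by (auto simp: M_def powr_powr)
    have 1: "1 \<le> s'" using \<sigma> by (simp add: s'eq)
    have 2: "dual_bound s' (ball 0 r) (\<lambda>u. norm (O' u)) ((2 * M) * r powr \<nu>)" if "0 < r" for r
      using dual_bound_ball_homogeneous[OF Om hom \<sigma>(2) conj M(1) that] M X by (simp add: \<nu> mult.assoc ennreal_leI)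
    obtain A where A: "A > 0" "\<And>O' :: real^'n \<Rightarrow> complex. \<And>r a d \<eta>.
      O' \<in> borel_measurable borel \<Longrightarrow> homogeneous_degree_zero O' \<Longrightarrow> 0 < r \<Longrightarrow>
      norm a / r \<le> 1 / (8 * real CARD('n)) \<Longrightarrow> 160 * sqrt (real CARD('n)) * (norm a / r) \<le> d \<Longrightarrow> 0 < \<eta> \<Longrightarrow>
      (\<forall>Q. rotation_matrix Q \<longrightarrow> rotation_size Q < d \<longrightarrow>
        (\<integral>\<^sup>+x\<in>ball 0 1. ennreal (norm (O' (Q *v x) - O' x) powr \<sigma>) \<partial>lborel) \<le> ennreal (unit_ball_vol (real CARD('n)) * \<eta> powr \<sigma>)) \<Longrightarrow>
      dual_bound s' (annulus r) (\<lambda>u. norm (O' (u - a) - O' u)) (A * r powr (real CARD('n) / \<sigma>) * \<eta>)"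
      using dual_bound_annulus_oscillation[OF \<sigma>(2) conj, where 'n = 'n] by blast
    have 3: "dual_bound s' (annulus r) (\<lambda>u. norm (O' (u - a) - O' u)) (A * r powr \<nu> * (\<eta> j + 2 powr (- real (m + Suc j))))"
      if r: "0 < r" and a: "norm a \<le> r * 2 powr (- real (m + Suc j))" for j r and a :: "real^'n"
      unfolding \<nu>
    proof (rule A(2)[OF Om hom r, where d = "2 powr (- real (Suc j))"])
      let ?\<delta> = "2 powr (- real (Suc j))"
      have N: "1 \<le> ?N" by simp
      have \<delta>1: "?\<delta> \<le> 1" by (rule order_trans[OF powr_mono[of _ 0]]) auto
      have "norm a / r \<le> 2 powr (- real (m + Suc j))" using r a by (simp add: pos_divide_le_eq mult.commute)
      also have "2 powr (- real (m + Suc j)) = ?\<delta> / 2 ^ m"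
          by (rule two_powr_neg_add)
      also have "\<dots> \<le> ?\<delta> / (160 * ?N)"
        using m N by (intro divide_left_mono) auto
      finally have *: "norm a / r \<le> ?\<delta> / (160 * ?N)" .
      also have "\<dots> \<le> 1 / (8 * ?N)" using N \<delta>1 by (intro frac_le) auto
      finally show "norm a / r \<le> 1 / (8 * ?N)" .
      have "160 * sqrt ?N * (norm a / r) \<le> 160 * sqrt ?N * (?\<delta> / (160 * ?N))"
        using * by (intro mult_left_mono) auto
      also have "\<dots> = ?\<delta> * (sqrt ?N / ?N)" by simp
      also have "\<dots> \<le> ?\<delta> * 1"
      proof (intro mult_left_mono)
        have "sqrt ?N * 1 \<le> sqrt ?N * sqrt ?N" using N by (intro mult_left_mono) auto
        then show "sqrt ?N / ?N \<le> 1" using N by (simp add: divide_le_eq)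
      qed simp
      finally show "160 * sqrt ?N * (norm a / r) \<le> ?\<delta>" by simp
      have \<eta>0: "0 \<le> \<eta> j" by (simp add: \<eta>_def)
      then show "0 < \<eta> j + 2 powr (- real (m + Suc j))" by (intro add_nonneg_pos) auto
      show "\<forall>Q. rotation_matrix Q \<longrightarrow> rotation_size Q < ?\<delta> \<longrightarrow>
        (\<integral>\<^sup>+x\<in>ball 0 1. ennreal (norm (O' (Q *v x) - O' x) powr \<sigma>) \<partial>lborel) \<le> ennreal (unit_ball_vol ?N * (\<eta> j + 2 powr (- real (m + Suc j))) powr \<sigma>)"
      proof (intro allI impI)
        fix Q :: "real^'n^'n" assume Q: "rotation_matrix Q" "rotation_size Q < ?\<delta>"
        let ?I = "\<integral>\<^sup>+x. ennreal (norm (\<Omega> (Q *v x) - \<Omega> x) powr \<sigma>) \<partial>sphere_measure"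
        have "epowr ?I (1 / \<sigma>) \<le> dini_modulus s \<Omega> ?\<delta>"
          unfolding dini_modulus_def using \<sigma> Q by (intro SUP_upper2[of Q]) auto
        also have "\<dots> = ennreal (\<eta> j)" using dini_summable(1)[OF dini \<beta> order_refl, of j] by (simp add: \<eta>_def)
        finally have "?I \<le> ennreal (\<eta> j powr \<sigma>)" using \<sigma> \<eta>0 by (intro epowr_le_imp_le) auto
        also have "\<dots> \<le> ennreal ((\<eta> j + 2 powr (- real (m + Suc j))) powr \<sigma>)"
          using \<eta>0 \<sigma> by (intro ennreal_leI powr_mono2) auto
        finally have I: "?I \<le> ennreal ((\<eta> j + 2 powr (- real (m + Suc j))) powr \<sigma>)" .
        show "(\<integral>\<^sup>+x\<in>ball 0 1. ennreal (norm (O' (Q *v x) - O' x) powr \<sigma>) \<partial>lborel) \<le> ennreal (unit_ball_vol ?N * (\<eta> j + 2 powr (- real (m + Suc j))) powr \<sigma>)"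
        proof -
          have "(\<integral>\<^sup>+x\<in>ball 0 1. ennreal (norm (O' (Q *v x) - O' x) powr \<sigma>) \<partial>lborel) = ennreal (unit_ball_vol ?N) * ?I"
            by (rule nn_integral_rotation_difference_eq[OF Om O' C eq Q(1)])
          also have "\<dots> \<le> ennreal (unit_ball_vol ?N) * ennreal ((\<eta> j + 2 powr (- real (m + Suc j))) powr \<sigma>)"
            using I by (rule mult_left_mono) simp
          finally show ?thesis by (simp only: ennreal_mult unit_ball_vol_nonneg of_nat_0_le_iff powr_ge_zero)
        qed
      qed
    qed
    have 4: "(\<integral>\<^sup>+x\<in>ball 0 1. ennreal (norm (O' x) powr l) \<partial>lborel) < top" if "0 \<le> l" "ennreal l \<le> s" for l
    proof -
      have l: "l \<le> \<sigma>" using that \<sigma> by simp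
      have [measurable]: "ball (0::real^'n) 1 \<in> sets borel" by simp
      have "(\<integral>\<^sup>+x\<in>ball 0 1. ennreal (norm (O' x) powr l) \<partial>lborel)
         \<le> (\<integral>\<^sup>+x. indicator (ball 0 1) x + ennreal (norm (O' x) powr \<sigma>) * indicator (ball 0 1) x \<partial>lborel)"
      proof (intro nn_integral_mono)
        fix x
        have "norm (O' x) powr l \<le> 1 + norm (O' x) powr \<sigma>"
        proof (cases "norm (O' x) \<le> 1")
          case True
          then have "norm (O' x) powr l \<le> 1 powr l" using that by (intro powr_mono2) auto
          then show ?thesis by (smt (verit) powr_ge_zero powr_one_eq_one)
        next
          case False
          then have "norm (O' x) powr l \<le> norm (O' x) powr \<sigma>" using l by (intro powr_mono) auto
          then show ?thesis by linarith
        qed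
        then show "ennreal (norm (O' x) powr l) * indicator (ball 0 1) x \<le> indicator (ball 0 1) x + ennreal (norm (O' x) powr \<sigma>) * indicator (ball 0 1) x"
          using ennreal_leI[of "norm (O' x) powr l" "1 + norm (O' x) powr \<sigma>"] by (auto split: split_indicator)
      qed
      also have "\<dots> = emeasure lborel (ball (0::real^'n) 1) + (\<integral>\<^sup>+x\<in>ball 0 1. ennreal (norm (O' x) powr \<sigma>) \<partial>lborel)"
        by (subst nn_integral_add) auto
      also have "\<dots> < top" using fin by (simp add: emeasure_ball)
      finally show ?thesis .
    qed
    show ?thesis
    proof (intro conjI)
      show "\<exists>A>0. \<forall>r>0. dual_bound s' (ball 0 r) (\<lambda>u. norm (O' u)) (A * r powr \<nu>)"
        using 2 M by (intro exI[of _ "2 * M"]) auto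
      show "\<exists>A>0. \<forall>j r a. 0 < r \<longrightarrow> norm a \<le> r * 2 powr (- real (m + Suc j)) \<longrightarrow>
        dual_bound s' (annulus r) (\<lambda>u. norm (O' (u - a) - O' u)) (A * r powr \<nu> * (\<eta> j + 2 powr (- real (m + Suc j))))"
        using 3 A(1) by (intro exI[of _ A] conjI allI impI) auto
    qed (use 4 1 in auto)
  qed
  note * = this
  show "1 \<le> s'"
    and "\<exists>A>0. \<forall>r>0. dual_bound s' (ball 0 r) (\<lambda>u. norm (O' u)) (A * r powr \<nu>)"
    and "\<exists>A>0. \<forall>j r a. 0 < r \<longrightarrow> norm a \<le> r * 2 powr (- real (m + Suc j)) \<longrightarrow>
      dual_bound s' (annulus r) (\<lambda>u. norm (O' (u - a) - O' u)) (A * r powr \<nu> * (\<eta> j + 2 powr (- real (m + Suc j))))"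
    and "\<And>l. 0 \<le> l \<Longrightarrow> ennreal l \<le> s \<Longrightarrow> (\<integral>\<^sup>+x\<in>ball 0 1. ennreal (norm (O' x) powr l) \<partial>lborel) < top"
    subgoal using * by (rule conjunct1)
    subgoal using *[THEN conjunct2] by (rule conjunct1)
    subgoal using *[THEN conjunct2, THEN conjunct2] by (rule conjunct1)
    subgoal for l using *[THEN conjunct2, THEN conjunct2, THEN conjunct2] by blast
    done
qed

text \<open>The kernel condition in the form in which it is summed: \<open>e k\<close> is the oscillation of the kernel at
  relative scale \<open>2 powr (- real k)\<close>. It consists of a value of the Dini modulus and of a term of order
  \<open>2 powr (- real k)\<close>; the first is summable against \<open>2 powr (\<gamma> * real k)\<close> since \<open>\<gamma> \<le> \<beta>\<close>, the second
  since \<open>\<gamma> < 1\<close>.\<close>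

lemma dini_kernel_regularity:
  fixes \<Omega> :: "real^'n \<Rightarrow> complex"
  assumes dini: "dini s \<beta> \<Omega>" and s: "1 < s" and s': "s' = enn2real (conj_exp s)"
    and \<beta>: "0 \<le> \<beta>" and \<gamma>: "\<gamma> \<le> \<beta>" "\<gamma> < 1" and \<kappa>: "0 \<le> \<kappa>"
  obtains O' A e k0 where "O' \<in> borel_measurable borel" "homogeneous_degree_zero O'" "AE x in lborel. O' x = \<Omega> x"
    "1 \<le> s'" "0 < (A::real)" "\<And>k::nat. 0 < (e k :: real)" "summable (\<lambda>k. e k * 2 powr (\<gamma> * real k))"
    "\<And>k r a. k0 \<le> k \<Longrightarrow> 0 < r \<Longrightarrow> norm a \<le> r * 2 powr (- real k) \<Longrightarrow>
       dual_bound s' (annulus r) (\<lambda>u. norm (rough_kernel O' \<kappa> (u - a) - rough_kernel O' \<kappa> u))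
         (A * r powr (real CARD('n) * (1 - 1 / s') - \<kappa>) * e k)"
    "\<And>l. 0 \<le> l \<Longrightarrow> ennreal l \<le> s \<Longrightarrow> (\<integral>\<^sup>+x\<in>ball 0 1. ennreal (norm (O' x) powr l) \<partial>lborel) < top"
proof -
  define \<nu> where "\<nu> = real CARD('n) * (1 - 1 / s')"
  define \<eta> where "\<eta> j = enn2real (dini_modulus s \<Omega> (2 powr (- real (Suc j))))" for j
  have \<eta>0: "0 \<le> \<eta> j" for j by (simp add: \<eta>_def)
  obtain O' C where Om[measurable]: "O' \<in> borel_measurable borel" and hom: "homogeneous_degree_zero O'" and O': "\<And>x. O' (sgn x) = O' x"
    and C: "C \<in> sets borel" "\<And>x. sgn x \<in> C \<longleftrightarrow> x \<in> C" "AE x in lborel. x \<notin> C"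
    and eq: "\<And>x. x \<noteq> 0 \<Longrightarrow> x \<notin> C \<Longrightarrow> O' x = \<Omega> x"
  proof (rule borel_representative)
    show "\<Omega> \<in> borel_measurable sphere_measure" "homogeneous_degree_zero \<Omega>"
      using dini by (simp_all add: dini_def Lp_sphere_def)
  qed (rule that)
  obtain m :: nat where "160 * real CARD('n) \<le> real m" using real_arch_simple by blast
  also have "real m \<le> 2 ^ m" by (rule less_imp_le[OF of_nat_less_two_power])
  finally have m: "160 * real CARD('n) \<le> 2 ^ m" .
  note aux = dini_representative_bounds[OF dini s s' \<beta> m Om hom O' C eq, folded \<nu>_def \<eta>_def]
  obtain A1 where A1: "0 < A1" "\<And>r. 0 < r \<Longrightarrow> dual_bound s' (ball 0 r) (\<lambda>u. norm (O' u)) (A1 * r powr \<nu>)"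
    using aux(2) by blast
  obtain A2 where A2: "0 < A2" "\<And>j r a. 0 < r \<Longrightarrow> norm a \<le> r * 2 powr (- real (m + Suc j)) \<Longrightarrow>
      dual_bound s' (annulus r) (\<lambda>u. norm (O' (u - a) - O' u)) (A2 * r powr \<nu> * (\<eta> j + 2 powr (- real (m + Suc j))))"
    using aux(3) by blast
  define k0 where "k0 = Suc m"
  \<comment> \<open>Below \<open>k0\<close> the value is arbitrary; 1 keeps all terms positive.\<close>
  define e where "e k = (if k0 \<le> k then \<eta> (k - k0) + 2 * 2 powr (- real k) else 1)" for k
  define A where "A = (2 powr \<kappa> + \<kappa> * 2 powr (\<kappa> + 1 + \<nu>)) * (A1 + A2)"
  have "0 \<le> \<kappa> * 2 powr (\<kappa> + 1 + \<nu>)" using \<kappa> by simp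
  then have "0 < 2 powr \<kappa> + \<kappa> * 2 powr (\<kappa> + 1 + \<nu>)" by (intro add_pos_nonneg) auto
  then have A: "0 < A" using A1 A2 by (simp add: A_def)
  have epos: "0 < e k" for k using \<eta>0 by (auto simp: e_def intro!: add_nonneg_pos)
  have bound: "dual_bound s' (annulus r) (\<lambda>u. norm (rough_kernel O' \<kappa> (u - a) - rough_kernel O' \<kappa> u)) (A * r powr (\<nu> - \<kappa>) * e k)"
    if k: "k0 \<le> k" and r: "0 < r" and a: "norm a \<le> r * 2 powr (- real k)" for k r and a :: "real^'n"
  proof -
    define j where "j = k - k0"
    have kj: "k = m + Suc j" using k by (simp add: j_def k0_def)
    have "2 powr (- real k) \<le> (2::real) powr (- 1)" using kj by (intro powr_mono) auto
    then have half: "2 powr (- real k) \<le> (1/2::real)" by (simp add: powr_minus)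
    have "dual_bound s' (annulus r) (\<lambda>u. norm (O' (u - a) - O' u)) (A2 * r powr \<nu> * (\<eta> j + 2 powr (- real k)))"
      using A2(2)[OF r, of a j] a by (simp add: kj)
    then have osc: "dual_bound s' (annulus r) (\<lambda>u. norm (O' (u - a) - O' u)) ((A1 + A2) * r powr \<nu> * (\<eta> j + 2 powr (- real k)))"
    proof (rule dual_bound_mono)
      show "A2 * r powr \<nu> * (\<eta> j + 2 powr (- real k)) \<le> (A1 + A2) * r powr \<nu> * (\<eta> j + 2 powr (- real k))"
        using A1(1) \<eta>0[of j] by (intro mult_right_mono) auto
    qed simp
    have size: "dual_bound s' (ball 0 (2 * r)) (\<lambda>u. norm (O' u)) ((A1 + A2) * (2 * r) powr \<nu>)"
    proof (rule dual_bound_mono[OF A1(2)])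
      show "A1 * (2 * r) powr \<nu> \<le> (A1 + A2) * (2 * r) powr \<nu>"
        using A2(1) by (intro mult_right_mono) auto
    qed (use r in auto)
    have "dual_bound s' (annulus r) (\<lambda>u. norm (rough_kernel O' \<kappa> (u - a) - rough_kernel O' \<kappa> u))
      ((2 powr \<kappa> + \<kappa> * 2 powr (\<kappa> + 1 + \<nu>)) * (A1 + A2) * r powr (\<nu> - \<kappa>) * ((\<eta> j + 2 powr (- real k)) + 2 powr (- real k)))"
      using aux(1) A1(1) A2(1) \<eta>0[of j] by (intro dual_bound_rough_kernel_diff[OF Om a half r \<kappa> _ osc size]) auto
    moreover have "(\<eta> j + 2 powr (- real k)) + 2 powr (- real k) = e k" using k by (simp add: e_def j_def)
    ultimately show ?thesis by (simp only: A_def)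
  qed
  have sum: "summable (\<lambda>k. e k * 2 powr (\<gamma> * real k))"
  proof (subst summable_iff_shift[symmetric, where k = k0])
    have "summable (\<lambda>n. 2 powr (\<gamma> * real m) * (\<eta> n * 2 powr (\<gamma> * real (Suc n))) + (2 * 2 powr ((\<gamma> - 1) * real k0)) * (2 powr (\<gamma> - 1)) ^ n)"
    proof (intro summable_add summable_mult)
      show "summable (\<lambda>n. \<eta> n * 2 powr (\<gamma> * real (Suc n)))"
        unfolding \<eta>_def by (rule dini_summable(2)[OF dini \<beta> \<gamma>(1)])
      have "(2::real) powr (\<gamma> - 1) < 2 powr 0" using \<gamma> by (intro powr_less_mono) auto
      then show "summable (\<lambda>n. (2 powr (\<gamma> - 1)) ^ n :: real)" by (intro summable_geometric) simp
    qed
    also have "(\<lambda>n. 2 powr (\<gamma> * real m) * (\<eta> n * 2 powr (\<gamma> * real (Suc n))) + (2 * 2 powr ((\<gamma> - 1) * real k0)) * (2 powr (\<gamma> - 1)) ^ n)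
      = (\<lambda>n. e (n + k0) * 2 powr (\<gamma> * real (n + k0)))"
    proof
      fix n
      have 1: "2 powr (\<gamma> * real m) * 2 powr (\<gamma> * real (Suc n)) = (2::real) powr (\<gamma> * real (n + k0))"
        unfolding powr_add[symmetric] k0_def by (rule arg_cong[where f = "\<lambda>x. 2 powr x"]) (simp add: algebra_simps)
      have 2: "2 powr ((\<gamma> - 1) * real k0) * (2 powr (\<gamma> - 1)) ^ n = (2::real) powr (- real (n + k0)) * 2 powr (\<gamma> * real (n + k0))"
        unfolding powr_realpow[symmetric, OF powr_gt_zero[THEN iffD2, OF zero_neq_numeral[symmetric]]] powr_powr powr_add[symmetric]
        by (rule arg_cong[where f = "\<lambda>x. 2 powr x"]) (simp add: algebra_simps)
      show "2 powr (\<gamma> * real m) * (\<eta> n * 2 powr (\<gamma> * real (Suc n))) + (2 * 2 powr ((\<gamma> - 1) * real k0)) * (2 powr (\<gamma> - 1)) ^ n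
        = e (n + k0) * 2 powr (\<gamma> * real (n + k0))"
      proof -
        let ?G = "2 powr (\<gamma> * real (n + k0)) :: real" and ?h = "2 powr (- real (n + k0)) :: real"
        have "2 powr (\<gamma> * real m) * (\<eta> n * 2 powr (\<gamma> * real (Suc n))) + (2 * 2 powr ((\<gamma> - 1) * real k0)) * (2 powr (\<gamma> - 1)) ^ n
          = \<eta> n * (2 powr (\<gamma> * real m) * 2 powr (\<gamma> * real (Suc n))) + 2 * (2 powr ((\<gamma> - 1) * real k0) * (2 powr (\<gamma> - 1)) ^ n)"
          by (simp only: mult.assoc mult.left_commute)
        also have "\<dots> = \<eta> n * ?G + 2 * (?h * ?G)" by (simp only: 1 2)
        also have "\<dots> = (\<eta> n + 2 * ?h) * ?G" by (simp only: distrib_right mult.assoc)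
        also have "\<eta> n + 2 * ?h = e (n + k0)" by (simp add: e_def)
        finally show ?thesis .
      qed
    qed
    finally show "summable (\<lambda>n. e (n + k0) * 2 powr (\<gamma> * real (n + k0)))" .
  qed
  have n0: "AE x in lborel. x \<noteq> (0::real^'n)" by (rule AE_lborel_singleton)
  have "AE x in lborel. O' x = \<Omega> x" using n0 C(3) by eventually_elim (use eq in auto)
  then show thesis
    using that[OF Om hom _ aux(1) A epos sum, of k0] bound aux(4) unfolding \<nu>_def by blast
qed

section \<open>The weight\<close>

lemma weight_measurable:
  fixes w :: "real^'n \<Rightarrow> real"
  assumes "weight w"
  shows "w \<in> borel_measurable lebesgue"
proof -
  have m: "(\<lambda>x. indicator (cball 0 (real k)) x *\<^sub>R w x) \<in> borel_measurable lebesgue" for k :: nat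
  proof -
    have "set_integrable lebesgue (cball 0 (real k)) w"
      using assms by (simp add: weight_def locally_integrable_def)
    then show ?thesis unfolding set_integrable_def by (rule borel_measurable_integrable)
  qed
  show ?thesis
  proof (rule borel_measurable_LIMSEQ_metric[OF m])
    fix x :: "real^'n"
    obtain N :: nat where N: "norm x \<le> real N" using real_arch_simple by blast
    show "(\<lambda>k. indicator (cball 0 (real k)) x *\<^sub>R w x) \<longlonglongrightarrow> w x"
    proof (rule tendsto_eventually, rule eventually_sequentiallyI[of N])
      fix k assume "N \<le> k"
      then have "x \<in> cball 0 (real k)" using N by auto
      then show "indicator (cball 0 (real k)) x *\<^sub>R w x = w x" by simp
    qed
  qed
qed

lemma esssup_on_mono_set:
  fixes w :: "real^'n \<Rightarrow> real"
  assumes [measurable]: "w \<in> borel_measurable lebesgue" and AB: "A \<subseteq> B" "A \<in> sets lebesgue" "B \<in> sets lebesgue"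
  shows "esssup_on A w \<le> esssup_on B w"
  unfolding esssup_on_def
proof (rule esssup_I)
  have "w \<in> borel_measurable (lebesgue_on A)" by (rule measurable_restrict_space1) simp
  then show "(\<lambda>x. ennreal (w x)) \<in> borel_measurable (lebesgue_on A)" by simp
  have "AE x in lebesgue_on B. ennreal (w x) \<le> esssup (lebesgue_on B) (\<lambda>x. ennreal (w x))" by (rule esssup_AE)
  then show "AE x in lebesgue_on A. ennreal (w x) \<le> esssup (lebesgue_on B) (\<lambda>x. ennreal (w x))"
    using AB by (subst (asm) AE_restrict_space_iff, simp, subst AE_restrict_space_iff) (auto elim!: eventually_mono)
qed

text \<open>The class condition on \<open>\<omega> powr t\<close>, solved for the integral of the negative power. The number
  \<open>W z R\<close> plays the role of the essential supremum of \<open>\<omega>\<close> over the ball; it is kept as a real number,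
  and it increases with the radius. Both factors in the class condition are positive because a weight
  is positive and finite almost everywhere, so neither of them can be infinite.\<close>

lemma A_infty_reverse_bound:
  fixes \<omega> :: "real^'n \<Rightarrow> real" and p t :: real
  assumes w: "weight \<omega>" and A: "(\<lambda>x. \<omega> x powr t) \<in> A_infty (p / t)" and t: "1 \<le> t" "t < p"
  defines "q \<equiv> p * t / (p - t)"
  obtains C W where "0 < (C::real)" "\<And>z R. 0 < R \<Longrightarrow> 0 < (W z R :: real)"
    "\<And>z R. 0 < R \<Longrightarrow> esssup_on (ball z R) \<omega> \<le> ennreal (W z R)"
    "\<And>z R. 0 < R \<Longrightarrow> (\<integral>\<^sup>+x\<in>ball z R. ennreal (\<omega> x powr (- q)) \<partial>lebesgue)
       \<le> ennreal (unit_ball_vol (real CARD('n)) * R ^ CARD('n) * (C / W z R) powr q)"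
    "\<And>z R R'. 0 < R \<Longrightarrow> R \<le> R' \<Longrightarrow> W z R \<le> W z R'"
proof -
  let ?v = "\<lambda>R. unit_ball_vol (real CARD('n)) * R ^ CARD('n)"
  have wm[measurable]: "\<omega> \<in> borel_measurable lebesgue" by (rule weight_measurable[OF w])
  have w0: "0 \<le> \<omega> x" for x using w by (simp add: weight_def)
  have wpos: "AE x in lebesgue. 0 < \<omega> x" using w by (simp add: weight_def)
  define r' where "r' = p / (p - t)"
  have "1 < p / t" using t by simp
  then have "enn2real (conj_exp (ennreal (p / t))) = (p / t) / (p / t - 1)"
    by (subst conj_exp_ennreal[OF \<open>1 < p / t\<close>], intro enn2real_ennreal divide_nonneg_nonneg) (use t in auto)
  also have "\<dots> = r'" using t by (simp add: r'_def field_simps)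
  finally have r': "enn2real (conj_exp (ennreal (p / t))) = r'" .
  have r'pos: "0 < r'" "0 < q" "q = t * r'" using t by (auto simp: r'_def q_def)
  have [simp]: "(\<omega> x powr t) powr (- r') = \<omega> x powr (- q)" for x by (simp add: powr_powr r'pos(3))
  define E where "E z R = esssup_on (ball z R) (\<lambda>x. \<omega> x powr t)" for z R
  define X where "X z R = eavg (ball z R) (\<lambda>x. ennreal (\<omega> x powr (- q)))" for z R
  obtain C where C: "0 < C" "\<And>z R. 0 < R \<Longrightarrow> E z R * epowr (X z R) (1 / r') \<le> ennreal C"
    using A unfolding A_infty_def Let_def r' by (auto simp: E_def X_def)
  have ball_em: "emeasure lebesgue (ball z R) = ennreal (?v R)" if "0 < R" for z :: "real^'n" and R
    using that by (simp add: emeasure_ball)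
  have vpos: "0 < ?v R" if "0 < R" for R using that by simp
  have not_null: "\<not> (AE x in lebesgue. x \<notin> ball z R)" if R: "0 < R" for z :: "real^'n" and R
  proof
    assume "AE x in lebesgue. x \<notin> ball z R"
    then have "ball z R \<in> null_sets lebesgue" by (subst AE_iff_null_sets) auto
    then have "ennreal (?v R) = 0" using ball_em[OF R, of z] by (simp add: null_sets_def)
    then have "?v R \<le> 0" by (simp only: ennreal_eq_0_iff)
    then show False using vpos[OF R] by linarith
  qed
  have Em: "(\<lambda>x. ennreal (\<omega> x powr t)) \<in> borel_measurable (lebesgue_on (ball z R))" for z R
    by (rule measurable_restrict_space1) measurable
  have EAE: "AE x in lebesgue. x \<in> ball z R \<longrightarrow> ennreal (\<omega> x powr t) \<le> E z R" for z R
    using esssup_AE[of "\<lambda>x. ennreal (\<omega> x powr t)" "lebesgue_on (ball z R)"]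
    unfolding E_def esssup_on_def by (subst (asm) AE_restrict_space_iff) auto
  have Epos: "E z R \<noteq> 0" if R: "0 < R" for z R
  proof
    assume E0: "E z R = 0"
    have "AE x in lebesgue. x \<notin> ball z R"
      using EAE[of z R] wpos by eventually_elim (use E0 in auto)
    then show False using not_null[OF R] by blast
  qed
  have bm[measurable]: "ball z R \<in> sets lebesgue" for z :: "real^'n" and R by simp
  have Xpos: "X z R \<noteq> 0" if R: "0 < R" for z R
  proof
    assume "X z R = 0"
    then have "(\<integral>\<^sup>+x\<in>ball z R. ennreal (\<omega> x powr (- q)) \<partial>lebesgue) = 0"
      using ball_em[OF R, of z] by (simp add: X_def eavg_def ennreal_divide_eq_0_iff)
    then have X0: "AE x in lebesgue. ennreal (\<omega> x powr (- q)) * indicator (ball z R) x = 0"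
      by (subst (asm) nn_integral_0_iff_AE) auto
    have "AE x in lebesgue. x \<notin> ball z R"
      using X0 wpos by eventually_elim (auto split: split_indicator_asm)
    then show False using not_null[OF R] by blast
  qed
  have Xtop: "X z R \<noteq> top" if R: "0 < R" for z R
  proof
    assume "X z R = top"
    then have "E z R * top \<le> ennreal C" using C(2)[OF R, of z] by (simp add: epowr_def)
    then show False using Epos[OF R, of z] by (simp add: ennreal_mult_top top_unique)
  qed
  have Xr: "\<exists>x>0. X z R = ennreal x" if R: "0 < R" for z R
    using Xpos[OF R, of z] Xtop[OF R, of z] by (cases "X z R") (auto simp: less_le)
  have Etop: "E z R \<noteq> top" if R: "0 < R" for z R
  proof
    assume "E z R = top"
    moreover obtain x where "0 < x" "X z R = ennreal x" using Xr[OF R] by blast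
    ultimately show False using C(2)[OF R, of z] by (simp add: epowr_def ennreal_top_mult top_unique)
  qed
  define e where "e z R = enn2real (E z R)" for z R
  have e: "E z R = ennreal (e z R)" "0 < e z R" if "0 < R" for z R
    using Etop[OF that, of z] Epos[OF that, of z] unfolding e_def by (cases "E z R"; simp)+
  define W where "W z R = e z R powr (1 / t)" for z R
  show thesis
  proof (rule that[of "C powr (1/t)" W])
    show "0 < C powr (1/t)" using C by simp
    fix z :: "real^'n" and R :: real assume R: "0 < R"
    show "0 < W z R" using e[OF R, of z] by (simp add: W_def)
    show "esssup_on (ball z R) \<omega> \<le> ennreal (W z R)"
      unfolding esssup_on_def
    proof (rule esssup_I)
      show "(\<lambda>x. ennreal (\<omega> x)) \<in> borel_measurable (lebesgue_on (ball z R))"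
        by (rule measurable_restrict_space1) measurable
      show "AE x in lebesgue_on (ball z R). ennreal (\<omega> x) \<le> ennreal (W z R)"
      proof (subst AE_restrict_space_iff)
        show "AE x in lebesgue. x \<in> ball z R \<longrightarrow> ennreal (\<omega> x) \<le> ennreal (W z R)"
          using EAE[of z R]
        proof eventually_elim
          case (elim x)
          show ?case
          proof
            assume "x \<in> ball z R"
            then have "\<omega> x powr t \<le> e z R" using elim e[OF R, of z] by simp
            then have "(\<omega> x powr t) powr (1/t) \<le> W z R" unfolding W_def using t by (intro powr_mono2) auto
            then show "ennreal (\<omega> x) \<le> ennreal (W z R)" using t w0[of x] by (simp add: powr_powr ennreal_leI)
          qed
        qed
      qed simp
    qed
    show "(\<integral>\<^sup>+x\<in>ball z R. ennreal (\<omega> x powr (- q)) \<partial>lebesgue)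
       \<le> ennreal (?v R * (C powr (1/t) / W z R) powr q)"
    proof -
      obtain x where x: "0 < x" "X z R = ennreal x" using Xr[OF R] by blast
      have "e z R * x powr (1 / r') \<le> C"
        using C(2)[OF R, of z] x e[OF R, of z] C(1) by (simp add: epowr_def flip: ennreal_mult)
      then have "x powr (1 / r') \<le> C / e z R" using e(2)[OF R, of z] by (simp add: pos_le_divide_eq mult.commute)
      then have "(x powr (1 / r')) powr r' \<le> (C / e z R) powr r'" using r'pos by (intro powr_mono2) auto
      then have "x \<le> (C / e z R) powr r'" using r'pos x by (simp add: powr_powr)
      also have "(C / e z R) powr r' = (C powr (1/t) / W z R) powr q"
        using C(1) e(2)[OF R, of z] t r'pos by (simp add: W_def powr_divide powr_powr)
      finally have xle: "x \<le> (C powr (1/t) / W z R) powr q" .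
      have "(\<integral>\<^sup>+x\<in>ball z R. ennreal (\<omega> x powr (- q)) \<partial>lebesgue) / ennreal (?v R) = ennreal x"
        using x ball_em[OF R, of z] by (simp add: X_def eavg_def)
      then have "(\<integral>\<^sup>+x\<in>ball z R. ennreal (\<omega> x powr (- q)) \<partial>lebesgue) = ennreal x * ennreal (?v R)"
      proof -
        have "I = I / V * V" if "V \<noteq> 0" "V \<noteq> top" for I V :: ennreal
          using mult_divide_eq_ennreal[OF that, of I] by (simp only: ennreal_times_divide mult.commute)
        from this[of "ennreal (?v R)" "\<integral>\<^sup>+x\<in>ball z R. ennreal (\<omega> x powr (- q)) \<partial>lebesgue"] \<open>_ / _ = ennreal x\<close> vpos[OF R]
        show ?thesis by (metis ennreal_eq_0_iff ennreal_neq_top linorder_not_le)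
      qed
      also have "\<dots> = ennreal (?v R * x)" using x vpos[OF R] by (simp add: ennreal_mult mult.commute)
      also have "\<dots> \<le> ennreal (?v R * (C powr (1/t) / W z R) powr q)"
        using xle vpos[OF R] by (intro ennreal_leI mult_left_mono) auto
      finally show ?thesis .
    qed
    show "W z R \<le> W z R'" if RR: "R \<le> R'" for R'
    proof -
      have R'0: "0 < R'" using R RR by simp
      have "E z R \<le> E z R'" unfolding E_def
      proof (rule esssup_on_mono_set)
        show "(\<lambda>x. \<omega> x powr t) \<in> borel_measurable lebesgue" by measurable
        show "ball z R \<subseteq> ball z R'" using RR by auto
      qed auto
      then have "e z R \<le> e z R'" using e[OF R, of z] e[OF R'0, of z] by simp
      then show ?thesis unfolding W_def using e(2)[OF R, of z] t by (intro powr_mono2) auto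
    qed
  qed
qed

text \<open>The tangent inequality at height \<open>\<Lambda>\<close>.\<close>

lemma nn_integral_L1_le_Lp:
  fixes h :: "'a \<Rightarrow> real"
  assumes [measurable]: "h \<in> borel_measurable M" "S \<in> sets M" and h: "\<And>x. 0 \<le> h x" and "1 \<le> l" "0 < \<Lambda>" "0 \<le> V"
    and V: "emeasure M S \<le> ennreal V"
    and le: "(\<integral>\<^sup>+x\<in>S. ennreal (h x powr l) \<partial>M) \<le> ennreal (V * \<Lambda> powr l)"
  shows "(\<integral>\<^sup>+x\<in>S. ennreal (h x) \<partial>M) \<le> ennreal (2 * V * \<Lambda>)"
proof -
  have "(\<integral>\<^sup>+x\<in>S. ennreal (h x) \<partial>M) \<le> (\<integral>\<^sup>+x. ennreal \<Lambda> * indicator S x + ennreal (\<Lambda> powr (1 - l)) * (ennreal (h x powr l) * indicator S x) \<partial>M)"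
  proof (intro nn_integral_mono)
    fix x
    have "ennreal (h x) \<le> ennreal (\<Lambda> + \<Lambda> powr (1 - l) * h x powr l)"
      by (intro ennreal_leI le_tangent_powr assms)
    also have "\<dots> = ennreal \<Lambda> + ennreal (\<Lambda> powr (1 - l)) * ennreal (h x powr l)"
      using assms by (simp add: ennreal_mult)
    finally show "ennreal (h x) * indicator S x \<le> ennreal \<Lambda> * indicator S x + ennreal (\<Lambda> powr (1 - l)) * (ennreal (h x powr l) * indicator S x)"
      by (auto split: split_indicator)
  qed
  also have "\<dots> = ennreal \<Lambda> * emeasure M S + ennreal (\<Lambda> powr (1 - l)) * (\<integral>\<^sup>+x\<in>S. ennreal (h x powr l) \<partial>M)"
    by (simp add: nn_integral_add nn_integral_cmult nn_integral_cmult_indicator)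
  also have "\<dots> \<le> ennreal \<Lambda> * ennreal V + ennreal (\<Lambda> powr (1 - l)) * ennreal (V * \<Lambda> powr l)"
    by (intro add_mono mult_left_mono V le) auto
  also have "\<dots> = ennreal (\<Lambda> * V + \<Lambda> powr (1 - l) * (V * \<Lambda> powr l))"
    using assms by (simp flip: ennreal_mult ennreal_plus)
  also have "\<Lambda> * V + \<Lambda> powr (1 - l) * (V * \<Lambda> powr l) = 2 * V * \<Lambda>"
  proof -
    have "\<Lambda> powr (1 - l) * \<Lambda> powr l = \<Lambda>" using assms by (simp flip: powr_add)
    then have "\<Lambda> powr (1 - l) * (V * \<Lambda> powr l) = V * \<Lambda>" by (metis mult.left_commute)
    then show ?thesis by simp
  qed
  finally show ?thesis .
qed

text \<open>Write \<open>|f|^t = (|f| \<omega>)^t \<omega>^(- t)\<close> and apply Hoelder's inequality with \<open>p / t\<close>; the second factor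
  is controlled by the class condition. The bounds on a ball of radius \<open>\<rho>\<close> are stated with the weight
  \<open>W z R\<close> of a smaller concentric ball, which is weaker by monotonicity of \<open>W\<close>, but allows one
  constant for all dyadic enlargements of a fixed ball.\<close>

lemma weighted_Lp_local_bounds:
  fixes \<omega> :: "real^'n \<Rightarrow> real" and p t :: real
  assumes w: "weight \<omega>" and A: "(\<lambda>x. \<omega> x powr t) \<in> A_infty (p / t)" and t: "1 \<le> t" "t < p"
  obtains C W where "0 < (C::real)" "\<And>z R. 0 < R \<Longrightarrow> 0 < (W z R :: real)"
    "\<And>z R. 0 < R \<Longrightarrow> esssup_on (ball z R) \<omega> \<le> ennreal (W z R)"
    "\<And>(f :: real^'n \<Rightarrow> complex) M z R \<rho>. f \<in> borel_measurable lebesgue \<Longrightarrow> 0 < M \<Longrightarrow>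
       (\<integral>\<^sup>+x. ennreal (norm (f x) powr p * \<omega> x powr p) \<partial>lebesgue) \<le> ennreal (M powr p) \<Longrightarrow> 0 < R \<Longrightarrow> R \<le> \<rho> \<Longrightarrow>
       (\<integral>\<^sup>+x\<in>ball z \<rho>. ennreal (norm (f x) powr t) \<partial>lebesgue)
         \<le> ennreal ((C * M / W z R * \<rho> powr (real CARD('n) * (1 / t - 1 / p))) powr t)"
    "\<And>(f :: real^'n \<Rightarrow> complex) M z R \<rho>. f \<in> borel_measurable lebesgue \<Longrightarrow> 0 < M \<Longrightarrow>
       (\<integral>\<^sup>+x. ennreal (norm (f x) powr p * \<omega> x powr p) \<partial>lebesgue) \<le> ennreal (M powr p) \<Longrightarrow> 0 < R \<Longrightarrow> R \<le> \<rho> \<Longrightarrow>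
       (\<integral>\<^sup>+x\<in>ball z \<rho>. ennreal (norm (f x)) \<partial>lebesgue)
         \<le> ennreal (C * M / W z R * \<rho> powr (real CARD('n) * (1 - 1 / p)))"
proof -
  let ?N = "real CARD('n)"
  define V where "V = unit_ball_vol ?N"
  have V: "0 < V" by (simp add: V_def)
  define q where "q = p * t / (p - t)"
  define r' where "r' = p / (p - t)"
  obtain C W where C: "0 < (C::real)" and W: "\<And>z R. 0 < R \<Longrightarrow> 0 < (W z R :: real)"
    "\<And>z R. 0 < R \<Longrightarrow> esssup_on (ball z R) \<omega> \<le> ennreal (W z R)"
    and q: "\<And>z R. 0 < R \<Longrightarrow> (\<integral>\<^sup>+x\<in>ball z R. ennreal (\<omega> x powr (- q)) \<partial>lebesgue)
       \<le> ennreal (V * R ^ CARD('n) * (C / W z R) powr q)"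
    and mono: "\<And>z R R'. 0 < R \<Longrightarrow> R \<le> R' \<Longrightarrow> W z R \<le> W z R'"
  proof (rule A_infty_reverse_bound[OF w A t])
    fix C W
    assume a: "0 < (C::real)" "\<And>z R. 0 < R \<Longrightarrow> 0 < (W z R :: real)" "\<And>z R. 0 < R \<Longrightarrow> esssup_on (ball z R) \<omega> \<le> ennreal (W z R)"
      and b: "\<And>z R. 0 < R \<Longrightarrow> (\<integral>\<^sup>+x\<in>ball z R. ennreal (\<omega> x powr (- (p * t / (p - t)))) \<partial>lebesgue)
        \<le> ennreal (unit_ball_vol ?N * R ^ CARD('n) * (C / W z R) powr (p * t / (p - t)))"
      and c: "\<And>z R R'. 0 < R \<Longrightarrow> R \<le> R' \<Longrightarrow> W z R \<le> W z R'"
    show thesis by (rule that[OF a b[folded q_def V_def] c])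
  qed
  have wm[measurable]: "\<omega> \<in> borel_measurable lebesgue" by (rule weight_measurable[OF w])
  have w0: "0 \<le> \<omega> x" for x using w by (simp add: weight_def)
  have wpos: "AE x in lebesgue. 0 < \<omega> x" using w by (simp add: weight_def)
  have bm[measurable]: "ball z R \<in> sets lebesgue" for z :: "real^'n" and R by simp
  have r': "0 < r'" "q = t * r'" "1 / (p / t) + 1 / r' = 1" "1 < p / t" using t
    by (auto simp: q_def r'_def field_simps)
  define L where "L M z R \<rho> = 2 * M * (C / W z R) * (V * \<rho> ^ CARD('n)) powr (- (1 / p))" for M z R \<rho>
  have main: "(\<integral>\<^sup>+x\<in>ball z \<rho>. ennreal (norm (f x) powr t) \<partial>lebesgue) \<le> ennreal (V * \<rho> ^ CARD('n) * L M z R \<rho> powr t)"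
    if fm: "f \<in> borel_measurable lebesgue" and M: "0 < M"
      and f: "(\<integral>\<^sup>+x. ennreal (norm (f x) powr p * \<omega> x powr p) \<partial>lebesgue) \<le> ennreal (M powr p)"
      and R: "0 < R" "R \<le> \<rho>"
    for f :: "real^'n \<Rightarrow> complex" and M z R \<rho>
  proof -
    note [measurable] = fm
    have \<rho>: "0 < \<rho>" using R by simp
    define v where "v = V * \<rho> ^ CARD('n)"
    have v: "0 < v" using V \<rho> by (simp add: v_def)
    \<comment> \<open>The factor that belongs to the ball of radius \<open>\<rho>\<close> itself; it is at most the one for radius \<open>R\<close>.\<close>
    define D where "D = C / W z \<rho>"
    have D: "0 < D" "D \<le> C / W z R" using C W(1)[OF \<rho>] W(1)[OF R(1)] mono[OF R]
      by (auto simp: D_def intro!: divide_left_mono)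
    have "(\<integral>\<^sup>+x. ennreal ((norm (f x) * \<omega> x) powr t * (\<omega> x powr (- t) * indicator (ball z \<rho>) x)) \<partial>lebesgue)
      \<le> ennreal (2 * M powr t * (v powr (1 / r') * D powr t))"
    proof (rule Holder_nn_integral[OF _ _ _ _ r'(4) r'(3)])
      have "(\<integral>\<^sup>+x. ennreal (((norm (f x) * \<omega> x) powr t) powr (p / t)) \<partial>lebesgue) = (\<integral>\<^sup>+x. ennreal (norm (f x) powr p * \<omega> x powr p) \<partial>lebesgue)"
        using t w0 by (intro nn_integral_cong) (simp add: powr_powr powr_mult)
      also have "\<dots> \<le> ennreal (M powr p)" by (rule f)
      also have "M powr p = (M powr t) powr (p / t)" using t by (simp add: powr_powr)
      finally show "(\<integral>\<^sup>+x. ennreal (((norm (f x) * \<omega> x) powr t) powr (p / t)) \<partial>lebesgue) \<le> ennreal ((M powr t) powr (p / t))" .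
      have "(\<integral>\<^sup>+x. ennreal ((\<omega> x powr (- t) * indicator (ball z \<rho>) x) powr r') \<partial>lebesgue) = (\<integral>\<^sup>+x\<in>ball z \<rho>. ennreal (\<omega> x powr (- q)) \<partial>lebesgue)"
        using r'(1,2) by (intro nn_integral_cong) (auto simp: powr_powr split: split_indicator)
      also have "\<dots> \<le> ennreal (v * D powr q)" unfolding v_def D_def by (rule q[OF \<rho>])
      also have "v * D powr q = (v powr (1 / r') * D powr t) powr r'"
        using v D r' by (simp add: powr_mult powr_powr)
      finally show "(\<integral>\<^sup>+x. ennreal ((\<omega> x powr (- t) * indicator (ball z \<rho>) x) powr r') \<partial>lebesgue) \<le> ennreal ((v powr (1 / r') * D powr t) powr r')" .
    qed (use M v D in auto)
    also have "(\<integral>\<^sup>+x. ennreal ((norm (f x) * \<omega> x) powr t * (\<omega> x powr (- t) * indicator (ball z \<rho>) x)) \<partial>lebesgue)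
      = (\<integral>\<^sup>+x\<in>ball z \<rho>. ennreal (norm (f x) powr t) \<partial>lebesgue)"
    proof (rule nn_integral_cong_AE)
      show "AE x in lebesgue. ennreal ((norm (f x) * \<omega> x) powr t * (\<omega> x powr (- t) * indicator (ball z \<rho>) x)) = ennreal (norm (f x) powr t) * indicator (ball z \<rho>) x"
        using wpos by eventually_elim (auto simp: powr_mult powr_minus split: split_indicator)
    qed
    finally have le: "(\<integral>\<^sup>+x\<in>ball z \<rho>. ennreal (norm (f x) powr t) \<partial>lebesgue) \<le> ennreal (2 * M powr t * (v powr (1 / r') * D powr t))" .
    have "2 * M powr t * (v powr (1 / r') * D powr t) \<le> 2 powr t * M powr t * (v powr (1 / r') * (C / W z R) powr t)"
    proof (intro mult_mono powr_mono2)
      show "2 \<le> (2::real) powr t" using t powr_mono[of 1 t 2] by simp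
    qed (use D t M r' v in auto)
    note le2 = this
    have "v powr (1 / r') = v * (v powr (- (1 / p))) powr t"
    proof -
      have "1 / r' = 1 + - (1 / p) * t" using t by (simp add: r'_def field_simps)
      then have "v powr (1 / r') = v powr 1 * v powr (- (1 / p) * t)" by (simp only: powr_add)
      then show ?thesis using v by (simp add: powr_powr)
    qed
    moreover have "2 powr t * M powr t * (v * x powr t * y powr t) = v * (2 * M * y * x) powr t" if "0 \<le> x" "0 \<le> y" for x y
      using M that by (simp add: powr_mult)
    from this[of "v powr (- (1 / p))" "C / W z R"]
    have "2 powr t * M powr t * (v * (v powr (- (1 / p))) powr t * (C / W z R) powr t) = v * (2 * M * (C / W z R) * v powr (- (1 / p))) powr t"
      using D by simp
    ultimately have "2 * M powr t * (v powr (1 / r') * D powr t) \<le> v * (2 * M * (C / W z R) * v powr (- (1 / p))) powr t"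
      using le2 by (simp only:)
    then show ?thesis using le unfolding L_def v_def by (meson ennreal_leI order_trans)
  qed
  have Lpos: "0 < L M z R \<rho>" if "0 < M" "0 < R" "R \<le> \<rho>" for M z R \<rho>
    using that C V W(1)[of R z] by (simp add: L_def)
  define C' where "C' = 4 * C * (V powr (1 - 1 / p) + V powr (1 / t - 1 / p))"
  have C': "0 < C'" using C V by (simp add: C'_def add_pos_pos)
  have pw: "(V * \<rho> ^ CARD('n)) powr x = V powr x * \<rho> powr (?N * x)" if "0 < \<rho>" for \<rho> x
    using that V by (simp add: powr_mult powr_powr flip: powr_realpow)
  show thesis
  proof (rule that[of C' W])
    fix f :: "real^'n \<Rightarrow> complex" and M R \<rho> :: real and z
    assume fm: "f \<in> borel_measurable lebesgue" and M: "0 < M"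
      and f: "(\<integral>\<^sup>+x. ennreal (norm (f x) powr p * \<omega> x powr p) \<partial>lebesgue) \<le> ennreal (M powr p)"
      and R: "0 < R" "R \<le> \<rho>"
    note [measurable] = fm
    have \<rho>: "0 < \<rho>" using R by simp
    let ?v = "V * \<rho> ^ CARD('n)"
    have v: "0 < ?v" using V \<rho> by simp
    note le = main[OF fm M f R, of z]
    have MW: "0 < M / W z R" using M W(1)[OF R(1)] by simp
    have Leq: "L M z R \<rho> = 2 * C * (M / W z R) * ?v powr (- (1 / p))" by (simp add: L_def)
    have "?v * L M z R \<rho> powr t = (?v powr (1 / t) * L M z R \<rho>) powr t"
    proof -
      have "v * L powr t = (v powr (1 / t) * L) powr t" if "0 < v" "0 < L" for v L
        using that t by (simp add: powr_mult powr_powr)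
      from this[OF v Lpos[OF M R, of z]] show ?thesis .
    qed
    also have "?v powr (1 / t) * L M z R \<rho> = 2 * C * V powr (1 / t - 1 / p) * (M / W z R) * \<rho> powr (?N * (1 / t - 1 / p))"
    proof -
      have "?v powr (1 / t) * ?v powr (- (1 / p)) = V powr (1 / t - 1 / p) * \<rho> powr (?N * (1 / t - 1 / p))"
        unfolding powr_add[symmetric] pw[OF \<rho>, symmetric] by simp
      then show ?thesis unfolding Leq by (simp only: mult.assoc mult.left_commute)
    qed
    also have "\<dots> powr t \<le> (C' * M / W z R * \<rho> powr (?N * (1 / t - 1 / p))) powr t"
    proof (rule powr_mono2)
      have "2 * C * V powr (1 / t - 1 / p) \<le> C'"
        using C by (simp add: C'_def distrib_left add_increasing)
      then have "2 * C * V powr (1 / t - 1 / p) * (M / W z R) * \<rho> powr (?N * (1 / t - 1 / p)) \<le> C' * (M / W z R) * \<rho> powr (?N * (1 / t - 1 / p))"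
        using MW by (intro mult_right_mono) auto
      then show "2 * C * V powr (1 / t - 1 / p) * (M / W z R) * \<rho> powr (?N * (1 / t - 1 / p)) \<le> C' * M / W z R * \<rho> powr (?N * (1 / t - 1 / p))" by simp
      show "0 \<le> 2 * C * V powr (1 / t - 1 / p) * (M / W z R) * \<rho> powr (?N * (1 / t - 1 / p))"
        using C MW by (intro mult_nonneg_nonneg) auto
    qed (use t in simp)
    finally show "(\<integral>\<^sup>+x\<in>ball z \<rho>. ennreal (norm (f x) powr t) \<partial>lebesgue)
         \<le> ennreal ((C' * M / W z R * \<rho> powr (?N * (1 / t - 1 / p))) powr t)"
      using le by (meson ennreal_leI order_trans)
    have "emeasure lebesgue (ball z \<rho>) \<le> ennreal ?v"
      using \<rho> by (simp add: emeasure_ball V_def)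
    then have "(\<integral>\<^sup>+x\<in>ball z \<rho>. ennreal (norm (f x)) \<partial>lebesgue) \<le> ennreal (2 * ?v * L M z R \<rho>)"
      by (intro nn_integral_L1_le_Lp[where l = t] le Lpos[OF M R] t) (use v in auto)
    also have "2 * ?v * L M z R \<rho> = 4 * C * V powr (1 - 1 / p) * (M / W z R) * \<rho> powr (?N * (1 - 1 / p))"
    proof -
      have "?v * ?v powr (- (1 / p)) = ?v powr 1 * ?v powr (- (1 / p))" using v by simp
      also have "\<dots> = V powr (1 - 1 / p) * \<rho> powr (?N * (1 - 1 / p))"
        unfolding powr_add[symmetric] pw[OF \<rho>, symmetric] by simp
      finally have "?v * ?v powr (- (1 / p)) = V powr (1 - 1 / p) * \<rho> powr (?N * (1 - 1 / p))" .
      moreover have "2 * ?v * L M z R \<rho> = 4 * C * (M / W z R) * (?v * ?v powr (- (1 / p)))" unfolding Leq by simp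
      ultimately show ?thesis by (simp only: mult.assoc mult.left_commute)
    qed
    also have "ennreal \<dots> \<le> ennreal (C' * M / W z R * \<rho> powr (?N * (1 - 1 / p)))"
    proof (rule ennreal_leI)
      have "4 * C * V powr (1 - 1 / p) \<le> C'"
        using C by (simp add: C'_def distrib_left)
      then have "4 * C * V powr (1 - 1 / p) * (M / W z R) * \<rho> powr (?N * (1 - 1 / p)) \<le> C' * (M / W z R) * \<rho> powr (?N * (1 - 1 / p))"
        using MW by (intro mult_right_mono) auto
      then show "4 * C * V powr (1 - 1 / p) * (M / W z R) * \<rho> powr (?N * (1 - 1 / p)) \<le> C' * M / W z R * \<rho> powr (?N * (1 - 1 / p))" by simp
    qed
    finally show "(\<integral>\<^sup>+x\<in>ball z \<rho>. ennreal (norm (f x)) \<partial>lebesgue) \<le> ennreal (C' * M / W z R * \<rho> powr (?N * (1 - 1 / p)))" .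
  qed (use C' W in auto)
qed

section \<open>The local part\<close>

text \<open>The ball is a union of dyadic annuli around 0, on which the radial factor is comparable to a
  constant; the resulting geometric series converges exactly when \<open>\<kappa> * l\<close> is below the dimension.\<close>

lemma nn_integral_rough_kernel_powr_ball:
  fixes O' :: "real^'n \<Rightarrow> complex"
  assumes [measurable]: "O' \<in> borel_measurable borel" and hom: "homogeneous_degree_zero O'"
    and l: "0 < l" "\<kappa> * l < real CARD('n)" and \<kappa>: "0 \<le> \<kappa>"
    and fin: "(\<integral>\<^sup>+x\<in>ball 0 1. ennreal (norm (O' x) powr l) \<partial>lborel) < top"
  obtains A where "0 < A" "\<And>\<rho>. 0 < \<rho> \<Longrightarrow>
    (\<integral>\<^sup>+u\<in>ball 0 \<rho>. ennreal (norm (rough_kernel O' \<kappa> u) powr l) \<partial>lborel) \<le> ennreal (A * \<rho> powr (real CARD('n) - \<kappa> * l))"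
proof -
  let ?N = "real CARD('n)"
  let ?K = "\<lambda>u. ennreal (norm (rough_kernel O' \<kappa> u) powr l)"
  obtain X where X: "(\<integral>\<^sup>+x\<in>ball 0 1. ennreal (norm (O' x) powr l) \<partial>lborel) = ennreal X" "0 \<le> X"
    using fin by (cases "\<integral>\<^sup>+x\<in>ball 0 1. ennreal (norm (O' x) powr l) \<partial>lborel") auto
  define x where "x = 2 powr (\<kappa> * l - ?N)"
  have x: "0 \<le> x" "x < 1" using l powr_less_mono[of "\<kappa> * l - ?N" 0 2] by (auto simp: x_def)
  have [measurable]: "ball (0::real^'n) r \<in> sets borel" for r by simp
  have pt: "?K u * indicator (ball 0 1) u \<le> (\<Sum>k. ennreal (2 powr (real (Suc k) * (\<kappa> * l))) * (ennreal (norm (O' u) powr l) * indicator (ball 0 ((1/2) ^ k)) u))" for u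
  proof (cases "u = 0 \<or> u \<notin> ball 0 1")
    case True
    then show ?thesis using l by (auto simp: rough_kernel_def)
  next
    case False
    then have u: "0 < norm u" "norm u < 1" by auto
    obtain m :: nat where m: "(1/2::real) ^ m < norm u" using real_arch_pow_inv[OF u(1), of "1/2"] by auto
    define k where "k = (LEAST j. (1/2::real) ^ (Suc j) < norm u)"
    have "(1/2::real) ^ (Suc m) = (1/2) ^ m / 2" by simp
    then have "(1/2::real) ^ (Suc m) < norm u" using m u(1) by linarith
    then have ex: "\<exists>j. (1/2::real) ^ (Suc j) < norm u" by blast
    then have k1: "(1/2::real) ^ (Suc k) < norm u" unfolding k_def by (rule LeastI_ex)
    have k2: "u \<in> ball 0 ((1/2) ^ k) \<or> norm u = (1/2) ^ k"
    proof (cases k)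
      case 0 then show ?thesis using u by simp
    next
      case (Suc j)
      then have "\<not> (1/2::real) ^ (Suc j) < norm u" using not_less_Least[of j "\<lambda>j. (1/2::real) ^ (Suc j) < norm u"] k_def by auto
      then show ?thesis using Suc by auto
    qed
    \<comment> \<open>If \<open>norm u\<close> is exactly a power of 1/2, step back by one, so that \<open>u\<close> lies in an open ball.\<close>
    define k' where "k' = (if norm u = (1/2) ^ k then k - 1 else k)"
    have k'1: "(1/2::real) ^ (Suc k') \<le> norm u" and k'2: "u \<in> ball 0 ((1/2) ^ k')"
    proof -
      show "(1/2::real) ^ (Suc k') \<le> norm u"
        using k1 u by (cases k) (auto simp: k'_def)
      show "u \<in> ball 0 ((1/2) ^ k')"
      proof (cases "norm u = (1/2) ^ k")
        case True
        then have "k \<noteq> 0" using u by (intro notI) simp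
        then obtain j where "k = Suc j" by (cases k) auto
        then have "norm u * 2 = (1/2) ^ j" using True by simp
        then have "norm u < (1/2) ^ j" using u by linarith
        moreover have "k' = j" using True \<open>k = Suc j\<close> by (simp add: k'_def)
        ultimately show ?thesis by (simp only: mem_ball_0)
      qed (use k2 in \<open>simp add: k'_def\<close>)
    qed
    have "norm (rough_kernel O' \<kappa> u) powr l = norm (O' u) powr l * (norm u powr (- \<kappa>)) powr l"
    proof -
      have "norm (rough_kernel O' \<kappa> u) = norm (O' u) * norm u powr (- \<kappa>)"
        by (simp add: rough_kernel_def norm_divide powr_minus divide_inverse norm_mult norm_inverse)
      then show ?thesis by (simp add: powr_mult)
    qed
    also have "\<dots> \<le> norm (O' u) powr l * ((2 powr real (Suc k')) powr \<kappa>) powr l"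
    proof (intro mult_left_mono powr_mono2)
      have "norm u powr (- \<kappa>) \<le> ((1/2) ^ Suc k') powr (- \<kappa>)" using k'1 \<kappa> by (intro powr_mono2') auto
      also have "(1/2::real) ^ Suc k' = 2 powr (- real (Suc k'))"
        by (simp add: powr_minus powr_realpow power_one_over inverse_eq_divide del: power_Suc of_nat_Suc)
      finally show "norm u powr (- \<kappa>) \<le> (2 powr real (Suc k')) powr \<kappa>" by (simp add: powr_powr del: of_nat_Suc)
    qed (use l in auto)
    also have "((2 powr real (Suc k')) powr \<kappa>) powr l = 2 powr (real (Suc k') * (\<kappa> * l))" by (simp add: powr_powr mult.assoc)
    finally have "?K u * indicator (ball 0 1) u \<le> ennreal (2 powr (real (Suc k') * (\<kappa> * l))) * (ennreal (norm (O' u) powr l) * indicator (ball 0 ((1/2) ^ k')) u)"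
      using u k'2 by (simp add: ennreal_leI mult.commute flip: ennreal_mult)
    also have "\<dots> \<le> (\<Sum>k. ennreal (2 powr (real (Suc k) * (\<kappa> * l))) * (ennreal (norm (O' u) powr l) * indicator (ball 0 ((1/2) ^ k)) u))"
      using sum_le_suminf[OF summableI, of "{k'}" "\<lambda>k. ennreal (2 powr (real (Suc k) * (\<kappa> * l))) * (ennreal (norm (O' u) powr l) * indicator (ball 0 ((1/2) ^ k)) u)"] by simp
    finally show ?thesis .
  qed
  have shell: "(\<integral>\<^sup>+u. ennreal (2 powr (real (Suc k) * (\<kappa> * l))) * (ennreal (norm (O' u) powr l) * indicator (ball 0 ((1/2) ^ k)) u) \<partial>lborel)
    = ennreal (2 powr (\<kappa> * l) * X * x ^ k)" for k
  proof -
    have "(\<integral>\<^sup>+u. ennreal (2 powr (real (Suc k) * (\<kappa> * l))) * (ennreal (norm (O' u) powr l) * indicator (ball 0 ((1/2) ^ k)) u) \<partial>lborel)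
      = ennreal (2 powr (real (Suc k) * (\<kappa> * l))) * (\<integral>\<^sup>+u\<in>ball 0 ((1/2) ^ k). ennreal (norm (O' u) powr l) \<partial>lborel)"
      by (rule nn_integral_cmult) measurable
    also have "(\<integral>\<^sup>+u\<in>ball 0 ((1/2) ^ k). ennreal (norm (O' u) powr l) \<partial>lborel)
      = ennreal (((1/2) ^ k) ^ CARD('n)) * ennreal X"
      unfolding X(1)[symmetric] using hom by (subst nn_integral_ball_scale) (auto simp: homogeneous_degree_zero_def)
    also have "ennreal (2 powr (real (Suc k) * (\<kappa> * l))) * (ennreal (((1/2) ^ k) ^ CARD('n)) * ennreal X)
      = ennreal (2 powr (real (Suc k) * (\<kappa> * l)) * (((1/2) ^ k) ^ CARD('n) * X))"
      using X(2) by (simp add: ennreal_mult)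
    also have "2 powr (real (Suc k) * (\<kappa> * l)) * (((1/2) ^ k) ^ CARD('n) * X) = 2 powr (\<kappa> * l) * X * x ^ k"
    proof -
      have "((1/2::real) ^ k) ^ CARD('n) = 2 powr (- (real k * ?N))"
        by (simp add: powr_minus powr_realpow power_one_over inverse_eq_divide flip: power_mult of_nat_mult)
      moreover have "x ^ k = 2 powr (real k * (\<kappa> * l)) * 2 powr (- (real k * ?N))"
      proof -
        have "x ^ k = x powr real k" by (simp add: powr_realpow x_def)
        then show ?thesis by (simp add: x_def powr_powr algebra_simps flip: powr_add)
      qed
      moreover have "2 powr (real (Suc k) * (\<kappa> * l)) = 2 powr (\<kappa> * l) * (2::real) powr (real k * (\<kappa> * l))"
        by (simp add: algebra_simps flip: powr_add)
      ultimately show ?thesis by simp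
    qed
    finally show ?thesis .
  qed
  have "(\<integral>\<^sup>+u\<in>ball 0 1. ?K u \<partial>lborel) \<le> (\<integral>\<^sup>+u. (\<Sum>k. ennreal (2 powr (real (Suc k) * (\<kappa> * l))) * (ennreal (norm (O' u) powr l) * indicator (ball 0 ((1/2) ^ k)) u)) \<partial>lborel)"
    by (intro nn_integral_mono pt)
  also have "\<dots> = (\<Sum>k. ennreal (2 powr (\<kappa> * l) * X * x ^ k))"
    by (subst nn_integral_suminf) (measurable, simp only: shell)
  also have "\<dots> = ennreal (\<Sum>k. 2 powr (\<kappa> * l) * X * x ^ k)"
    using x X by (intro suminf_ennreal2 summable_mult summable_geometric) auto
  finally have 1: "(\<integral>\<^sup>+u\<in>ball 0 1. ?K u \<partial>lborel) \<le> ennreal (\<Sum>k. 2 powr (\<kappa> * l) * X * x ^ k)" .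
  define A where "A = (\<Sum>k. 2 powr (\<kappa> * l) * X * x ^ k) + 1"
  have A0: "0 \<le> (\<Sum>k. 2 powr (\<kappa> * l) * X * x ^ k)"
    using x X by (intro suminf_nonneg summable_mult summable_geometric) auto
  show thesis
  proof (rule that[of A])
    show "0 < A" using A0 by (simp add: A_def)
    fix \<rho> :: real assume \<rho>: "0 < \<rho>"
    have K: "norm (rough_kernel O' \<kappa> (\<rho> *\<^sub>R u)) powr l = \<rho> powr (- \<kappa> * l) * norm (rough_kernel O' \<kappa> u) powr l" for u
    proof -
      have "norm (rough_kernel O' \<kappa> (\<rho> *\<^sub>R u)) = \<rho> powr (- \<kappa>) * norm (rough_kernel O' \<kappa> u)"
        using \<rho> hom by (simp add: rough_kernel_def homogeneous_degree_zero_def norm_divide powr_mult powr_minus divide_inverse norm_mult norm_inverse)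
      then show ?thesis by (simp add: powr_mult powr_powr)
    qed
    have "(\<integral>\<^sup>+u\<in>ball 0 \<rho>. ?K u \<partial>lborel) = ennreal (\<rho> ^ CARD('n)) * (\<integral>\<^sup>+u\<in>ball 0 1. ?K (\<rho> *\<^sub>R u) \<partial>lborel)"
      using \<rho> by (subst nn_integral_ball_scale) auto
    also have "(\<integral>\<^sup>+u\<in>ball 0 1. ?K (\<rho> *\<^sub>R u) \<partial>lborel) = ennreal (\<rho> powr (- \<kappa> * l)) * (\<integral>\<^sup>+u\<in>ball 0 1. ?K u \<partial>lborel)"
      unfolding K by (subst nn_integral_cmult[symmetric]) (auto simp: ennreal_mult mult.assoc)
    also have "ennreal (\<rho> ^ CARD('n)) * (ennreal (\<rho> powr (- \<kappa> * l)) * (\<integral>\<^sup>+u\<in>ball 0 1. ?K u \<partial>lborel))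
      \<le> ennreal (\<rho> ^ CARD('n)) * (ennreal (\<rho> powr (- \<kappa> * l)) * ennreal A)"
      using order_trans[OF 1, of "ennreal A"] by (intro mult_left_mono) (auto simp: A_def ennreal_leI)
    also have "\<dots> = ennreal (\<rho> ^ CARD('n) * (\<rho> powr (- \<kappa> * l) * A))"
      using \<rho> \<open>0 < A\<close> by (simp add: ennreal_mult)
    also have "\<rho> ^ CARD('n) * (\<rho> powr (- \<kappa> * l) * A) = A * \<rho> powr (?N - \<kappa> * l)"
    proof -
      have "\<rho> ^ CARD('n) * \<rho> powr (- \<kappa> * l) = \<rho> powr ?N * \<rho> powr (- \<kappa> * l)" using \<rho> by (simp add: powr_realpow)
      also have "\<dots> = \<rho> powr (?N - \<kappa> * l)" by (simp flip: powr_add)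
      finally show ?thesis by (metis mult.assoc mult.commute)
    qed
    finally show "(\<integral>\<^sup>+u\<in>ball 0 \<rho>. ?K u \<partial>lborel) \<le> ennreal (A * \<rho> powr (?N - \<kappa> * l))" .
  qed
qed

text \<open>Young's inequality for the convolution of \<open>K\<close> in \<open>L\<^sup>l\<close> with \<open>g\<close> in \<open>L\<^sup>1\<close>. Pointwise, the tangent inequality
  with the optimal height bounds the \<open>l\<close>-th power of the convolution by a multiple of
  \<open>H x\<close>, the convolution of \<open>K powr l\<close> with \<open>g\<close>, and \<open>H\<close> is integrated by exchanging integrals.\<close>

lemma local_convolution_bound:
  fixes K :: "'a::euclidean_space \<Rightarrow> real" and g :: "'a \<Rightarrow> real"
  assumes [measurable]: "K \<in> borel_measurable borel" "g \<in> borel_measurable borel"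
    and nn: "\<And>x. 0 \<le> K x" "\<And>x. 0 \<le> g x" and l: "1 \<le> l"
    and G: "(\<integral>\<^sup>+y\<in>ball z R'. ennreal (g y) \<partial>lborel) \<le> ennreal G" "0 < G"
    and A: "(\<integral>\<^sup>+u\<in>ball 0 (R + R'). ennreal (K u powr l) \<partial>lborel) \<le> ennreal A" "0 \<le> A"
  defines "L \<equiv> \<lambda>x. \<integral>\<^sup>+y\<in>ball z R'. ennreal (K (x - y) * g y) \<partial>lborel"
  shows "AE x in lborel. x \<in> ball z R \<longrightarrow> L x < top"
    and "(\<integral>\<^sup>+x\<in>ball z R. ennreal (enn2real (L x) powr l) \<partial>lborel) \<le> ennreal (2 powr l * G powr l * A)"
proof -
  have [measurable]: "ball (c::'a) r \<in> sets borel" for c r by simp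
  define H where "H x = (\<integral>\<^sup>+y\<in>ball z R'. ennreal (K (x - y) powr l * g y) \<partial>lborel)" for x
  have Lm[measurable]: "L \<in> borel_measurable borel" unfolding L_def by measurable
  have Hm[measurable]: "H \<in> borel_measurable borel" unfolding H_def by measurable
  have inner: "(\<integral>\<^sup>+x. ennreal (K (x - y) powr l * g y) * indicator (ball z R') y * indicator (ball z R) x \<partial>lborel) \<le> ennreal (g y) * indicator (ball z R') y * ennreal A" for y
  proof (cases "y \<in> ball z R'")
    case True
    have "(\<integral>\<^sup>+x. ennreal (K (x - y) powr l * g y) * indicator (ball z R') y * indicator (ball z R) x \<partial>lborel)
      \<le> (\<integral>\<^sup>+x. ennreal (g y) * (ennreal (K (x - y) powr l) * indicator (ball 0 (R + R')) (x - y)) \<partial>lborel)"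
    proof (intro nn_integral_mono)
      fix x
      have "x - y \<in> ball 0 (R + R')" if "x \<in> ball z R"
        using that True norm_triangle_ineq4[of "x - z" "y - z"] by (simp add: dist_norm norm_minus_commute)
      then show "ennreal (K (x - y) powr l * g y) * indicator (ball z R') y * indicator (ball z R) x
        \<le> ennreal (g y) * (ennreal (K (x - y) powr l) * indicator (ball 0 (R + R')) (x - y))"
        using True nn(2)[of y] by (auto split: split_indicator simp: ennreal_mult mult.commute)
    qed
    also have "\<dots> = ennreal (g y) * (\<integral>\<^sup>+x. ennreal (K (x - y) powr l) * indicator (ball 0 (R + R')) (x - y) \<partial>lborel)"
      by (rule nn_integral_cmult) measurable
    also have "(\<integral>\<^sup>+x. ennreal (K (x - y) powr l) * indicator (ball 0 (R + R')) (x - y) \<partial>lborel) = (\<integral>\<^sup>+u\<in>ball 0 (R + R'). ennreal (K u powr l) \<partial>lborel)"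
      by (rule nn_integral_lborel_translate[where F = "\<lambda>u. ennreal (K u powr l) * indicator (ball 0 (R + R')) u"]) measurable
    also have "ennreal (g y) * \<dots> \<le> ennreal (g y) * ennreal A" by (intro mult_left_mono A) simp
    finally show ?thesis using True by simp
  qed simp
  have HG: "(\<integral>\<^sup>+x\<in>ball z R. H x \<partial>lborel) \<le> ennreal (G * A)"
  proof -
    have "(\<integral>\<^sup>+x\<in>ball z R. H x \<partial>lborel) = (\<integral>\<^sup>+x. (\<integral>\<^sup>+y. ennreal (K (x - y) powr l * g y) * indicator (ball z R') y * indicator (ball z R) x \<partial>lborel) \<partial>lborel)"
      unfolding H_def by (intro nn_integral_cong nn_integral_multc[symmetric]) measurable
    also have "\<dots> = (\<integral>\<^sup>+y. (\<integral>\<^sup>+x. ennreal (K (x - y) powr l * g y) * indicator (ball z R') y * indicator (ball z R) x \<partial>lborel) \<partial>lborel)"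
      by (rule lborel_pair.Fubini') measurable
    also have "\<dots> \<le> (\<integral>\<^sup>+y. ennreal (g y) * indicator (ball z R') y * ennreal A \<partial>lborel)"
      by (intro nn_integral_mono inner)
    also have "\<dots> = (\<integral>\<^sup>+y\<in>ball z R'. ennreal (g y) \<partial>lborel) * ennreal A"
      by (rule nn_integral_multc) measurable
    also have "\<dots> \<le> ennreal G * ennreal A" by (intro mult_right_mono G) simp
    finally show ?thesis using G A by (simp add: ennreal_mult)
  qed
  have "AE x in lborel. H x * indicator (ball z R) x \<noteq> \<infinity>"
    using HG by (intro nn_integral_PInf_AE) (auto simp: top_unique)
  then have Hfin: "AE x in lborel. x \<in> ball z R \<longrightarrow> H x < top"
    by eventually_elim (auto simp: less_top split: split_indicator_asm)
  have Ltan: "L x \<le> ennreal (c * G + c powr (1 - l) * h)" if c: "0 < c" and h: "H x = ennreal h" "0 \<le> h" for x c h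
  proof -
    have "L x \<le> (\<integral>\<^sup>+y. ennreal c * (ennreal (g y) * indicator (ball z R') y) + ennreal (c powr (1 - l)) * (ennreal (K (x - y) powr l * g y) * indicator (ball z R') y) \<partial>lborel)"
      unfolding L_def
    proof (intro nn_integral_mono)
      fix y
      have "K (x - y) * g y \<le> (c + c powr (1 - l) * K (x - y) powr l) * g y"
        by (intro mult_right_mono le_tangent_powr nn c l)
      then have "ennreal (K (x - y) * g y) \<le> ennreal (c * g y + c powr (1 - l) * (K (x - y) powr l * g y))"
        by (intro ennreal_leI) (simp add: algebra_simps)
      also have "\<dots> = ennreal c * ennreal (g y) + ennreal (c powr (1 - l)) * ennreal (K (x - y) powr l * g y)"
        using c nn(2)[of y] by (simp flip: ennreal_mult ennreal_plus)
      finally show "ennreal (K (x - y) * g y) * indicator (ball z R') y \<le> ennreal c * (ennreal (g y) * indicator (ball z R') y) + ennreal (c powr (1 - l)) * (ennreal (K (x - y) powr l * g y) * indicator (ball z R') y)"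
        by (auto split: split_indicator)
    qed
    also have "\<dots> = ennreal c * (\<integral>\<^sup>+y\<in>ball z R'. ennreal (g y) \<partial>lborel) + ennreal (c powr (1 - l)) * H x"
      unfolding H_def by (simp add: nn_integral_add nn_integral_cmult)
    also have "\<dots> \<le> ennreal c * ennreal G + ennreal (c powr (1 - l)) * ennreal h"
      by (intro add_mono mult_left_mono G) (simp_all add: h)
    also have "\<dots> = ennreal (c * G + c powr (1 - l) * h)" using c G h by (simp flip: ennreal_mult ennreal_plus)
    finally show ?thesis .
  qed
  have LH: "L x < top \<and> ennreal (enn2real (L x) powr l) \<le> ennreal (2 powr l * G powr (l - 1)) * H x" if Hx: "H x < top" for x
  proof -
    obtain h where h: "H x = ennreal h" "0 \<le> h" using Hx by (cases "H x") auto
    show ?thesis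
    proof (cases "h = 0")
      case True
      have "L x \<le> 0"
      proof (rule ennreal_le_epsilon)
        fix \<epsilon> :: real assume "0 < \<epsilon>"
        then show "L x \<le> 0 + ennreal \<epsilon>" using Ltan[of "\<epsilon> / G" x h] h True G by simp
      qed
      then have "L x = 0" by simp
      then show ?thesis using l by simp
    next
      case False
      then have hpos: "0 < h" using h by simp
      \<comment> \<open>The height at which both terms of the tangent inequality are equal.\<close>
      define c where "c = (h / G) powr (1 / l)"
      have c: "0 < c" using hpos G by (simp add: c_def)
      have "c powr (1 - l) * h = c * (c powr (- l) * h)"
        using c by (simp add: powr_diff powr_minus divide_inverse)
      also have "c powr (- l) = G / h" using hpos G l by (simp add: c_def powr_powr powr_minus)
      finally have "c * G + c powr (1 - l) * h = 2 * c * G" using hpos by simp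
      with Ltan[OF c h] have Lle: "L x \<le> ennreal (2 * c * G)" by simp
      then have Lt: "L x < top" by (rule le_less_trans) simp
      have "enn2real (L x) \<le> 2 * c * G" using enn2real_mono[OF Lle] c G by simp
      then have "enn2real (L x) powr l \<le> (2 * c * G) powr l" using l by (intro powr_mono2) auto
      also have "\<dots> = 2 powr l * (h / G) * G powr l" using c G l hpos by (simp add: powr_mult c_def powr_powr)
      also have "\<dots> = 2 powr l * G powr (l - 1) * h" using G by (simp add: powr_diff)
      finally have "ennreal (enn2real (L x) powr l) \<le> ennreal (2 powr l * G powr (l - 1) * h)" by (rule ennreal_leI)
      then show ?thesis using Lt h by (simp add: ennreal_mult)
    qed
  qed
  show "AE x in lborel. x \<in> ball z R \<longrightarrow> L x < top"
    using Hfin by eventually_elim (use LH in blast)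
  have "(\<integral>\<^sup>+x\<in>ball z R. ennreal (enn2real (L x) powr l) \<partial>lborel) \<le> (\<integral>\<^sup>+x. ennreal (2 powr l * G powr (l - 1)) * (H x * indicator (ball z R) x) \<partial>lborel)"
  proof (rule nn_integral_mono_AE)
    show "AE x in lborel. ennreal (enn2real (L x) powr l) * indicator (ball z R) x \<le> ennreal (2 powr l * G powr (l - 1)) * (H x * indicator (ball z R) x)"
      using Hfin
    proof eventually_elim
      case (elim x)
      then show ?case using LH[of x] by (auto split: split_indicator)
    qed
  qed
  also have "\<dots> = ennreal (2 powr l * G powr (l - 1)) * (\<integral>\<^sup>+x\<in>ball z R. H x \<partial>lborel)"
    by (rule nn_integral_cmult) measurable
  also have "\<dots> \<le> ennreal (2 powr l * G powr (l - 1)) * ennreal (G * A)" by (intro mult_left_mono HG) simp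
  also have "\<dots> = ennreal (2 powr l * G powr l * A)"
    using G A by (simp add: powr_diff flip: ennreal_mult)
  finally show "(\<integral>\<^sup>+x\<in>ball z R. ennreal (enn2real (L x) powr l) \<partial>lborel) \<le> ennreal (2 powr l * G powr l * A)" .
qed

section \<open>The far part\<close>

lemma ex_dyadic_interval:
  fixes x :: real
  assumes "1 \<le> x"
  obtains k :: nat where "2 ^ k \<le> x" "x < 2 ^ Suc k"
proof -
  define k where "k = (LEAST j. x < 2 ^ Suc j)"
  obtain m :: nat where "x < 2 ^ m" using real_arch_pow[of 2 x] by auto
  also have "(2::real) ^ m \<le> 2 ^ Suc m" by (intro power_increasing) auto
  finally have "\<exists>j. x < 2 ^ Suc j" by blast
  then have 1: "x < 2 ^ Suc k" unfolding k_def by (rule LeastI_ex)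
  have 2: "2 ^ k \<le> x"
  proof (cases k)
    case 0 then show ?thesis using assms by simp
  next
    case (Suc j)
    then have "\<not> x < 2 ^ Suc j" using not_less_Least[of j "\<lambda>j. x < 2 ^ Suc j"] k_def by auto
    then show ?thesis using Suc by (simp only: not_less)
  qed
  show thesis by (rule that[OF 2 1])
qed

lemma ennreal_le_suminf: "f k \<le> suminf f" for f :: "nat \<Rightarrow> ennreal"
  using sum_le_suminf[OF summableI, of "{k}" f] by simp

text \<open>Decompose the complement of the ball into dyadic annuli around \<open>z\<close>. On the annulus of radius
  \<open>r = 2 ^ (k + k0) * R\<close> the shift from \<open>z\<close> to \<open>x\<close> has relative size at most \<open>2 powr (- real (k + k0))\<close>, so the
  kernel condition applies; its powers of \<open>r\<close> and those of the bound on \<open>g\<close> combine to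
  \<open>r powr \<gamma>\<close>, which turns the sum over \<open>k\<close> into the convergent series of the kernel condition.\<close>

lemma far_difference_bound:
  fixes K :: "'a::euclidean_space \<Rightarrow> complex" and g :: "'a \<Rightarrow> real"
  assumes [measurable]: "K \<in> borel_measurable borel" "g \<in> borel_measurable borel" and g: "\<And>x. 0 \<le> g x"
    and bound: "\<And>k r a. k0 \<le> k \<Longrightarrow> 0 < r \<Longrightarrow> norm a \<le> r * 2 powr (- real k) \<Longrightarrow>
       dual_bound t (annulus r) (\<lambda>u. norm (K (u - a) - K u)) (A * r powr \<mu> * e k)"
    and A: "0 < A" "\<And>k. 0 < e k" and summ: "summable (\<lambda>k. e k * 2 powr (\<gamma> * real k))" and \<gamma>: "\<gamma> = \<mu> + \<tau>"
    and B: "0 < B" "0 < R" and gB: "\<And>\<rho>. R \<le> \<rho> \<Longrightarrow> (\<integral>\<^sup>+y\<in>ball z \<rho>. ennreal (g y powr t) \<partial>lborel) \<le> ennreal ((B * \<rho> powr \<tau>) powr t)"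
    and x: "norm (x - z) \<le> R"
  shows "(\<integral>\<^sup>+y\<in>- ball z (2 ^ k0 * R). ennreal (norm (K (x - y) - K (z - y)) * g y) \<partial>lborel)
    \<le> ennreal (A * 2 powr \<tau> * (\<Sum>k. e (k + k0) * 2 powr (\<gamma> * real (k + k0))) * R powr \<gamma> * B)"
proof -
  define a where "a = z - x"
  have a: "norm a \<le> R" using x by (simp add: a_def norm_minus_commute)
  let ?F = "\<lambda>y. ennreal (norm (K (x - y) - K (z - y)) * g y)"
  let ?r = "\<lambda>k. 2 ^ (k + k0) * R"
  have r: "0 < ?r k" "R \<le> ?r k" for k using B by auto
  have [measurable]: "ball (c::'a) r \<in> sets borel" for c r by simp
  have pt: "?F y * indicator (- ball z (2 ^ k0 * R)) y \<le> (\<Sum>k. ?F y * indicator (annulus (?r k)) (z - y))" for y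
  proof (cases "y \<in> ball z (2 ^ k0 * R)")
    case True then show ?thesis by simp
  next
    case False
    then have "1 \<le> norm (z - y) / (2 ^ k0 * R)" using B by (simp add: dist_norm)
    then obtain k where k: "2 ^ k \<le> norm (z - y) / (2 ^ k0 * R)" "norm (z - y) / (2 ^ k0 * R) < 2 ^ Suc k"
      by (rule ex_dyadic_interval)
    have "z - y \<in> annulus (?r k)"
      using k B by (simp add: annulus_def pos_le_divide_eq pos_divide_less_eq power_add mult_ac)
    then have "?F y * indicator (- ball z (2 ^ k0 * R)) y = ?F y * indicator (annulus (?r k)) (z - y)" using False by simp
    also have "\<dots> \<le> (\<Sum>k. ?F y * indicator (annulus (?r k)) (z - y))"
      by (rule ennreal_le_suminf[where f = "\<lambda>k. ?F y * indicator (annulus (?r k)) (z - y)"])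
    finally show ?thesis .
  qed
  have piece: "(\<integral>\<^sup>+y. ?F y * indicator (annulus (?r k)) (z - y) \<partial>lborel)
    \<le> ennreal (A * 2 powr \<tau> * R powr \<gamma> * B * (e (k + k0) * 2 powr (\<gamma> * real (k + k0))))" for k
  proof -
    let ?\<rho> = "?r k"
    define h where "h u = g (z - u)" for u
    have h: "h \<in> borel_measurable borel" "\<And>u. 0 \<le> h u" using g by (simp_all add: h_def[abs_def])
    have "(\<integral>\<^sup>+y. ?F y * indicator (annulus ?\<rho>) (z - y) \<partial>lborel)
      = ennreal (\<bar>-1\<bar> ^ DIM('a)) * (\<integral>\<^sup>+u. ?F (z + (-1) *\<^sub>R u) * indicator (annulus ?\<rho>) (z - (z + (-1) *\<^sub>R u)) \<partial>lborel)"
      by (rule nn_integral_lborel_affine[where F = "\<lambda>y. ?F y * indicator (annulus ?\<rho>) (z - y)"]) auto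
    also have "\<dots> = (\<integral>\<^sup>+u\<in>annulus ?\<rho>. ennreal (norm (K (u - a) - K u) * h u) \<partial>lborel)"
      by (simp add: h_def a_def algebra_simps)
    also have "\<dots> \<le> ennreal (A * ?\<rho> powr \<mu> * e (k + k0) * (B * (2 * ?\<rho>) powr \<tau>))"
    proof (rule dual_boundD[OF bound h])
      have e: "?\<rho> * 2 powr (- real (k + k0)) = R" by (simp add: powr_minus powr_realpow del: of_nat_add)
      show "norm a \<le> ?\<rho> * 2 powr (- real (k + k0))" unfolding e by (rule a)
      have "(\<integral>\<^sup>+u\<in>annulus ?\<rho>. ennreal (h u powr t) \<partial>lborel) \<le> (\<integral>\<^sup>+u. ennreal (g (z - u) powr t) * indicator (ball z (2 * ?\<rho>)) (z - u) \<partial>lborel)"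
        by (intro nn_integral_mono) (auto simp: h_def annulus_def dist_norm split: split_indicator)
      also have "\<dots> = (\<integral>\<^sup>+y\<in>ball z (2 * ?\<rho>). ennreal (g y powr t) \<partial>lborel)"
        using nn_integral_lborel_affine[of "\<lambda>y. ennreal (g y powr t) * indicator (ball z (2 * ?\<rho>)) y" "-1" z] by simp
      also have "\<dots> \<le> ennreal ((B * (2 * ?\<rho>) powr \<tau>) powr t)"
        using r[of k] by (intro gB) linarith
      finally show "(\<integral>\<^sup>+u\<in>annulus ?\<rho>. ennreal (h u powr t) \<partial>lborel) \<le> ennreal ((B * (2 * ?\<rho>) powr \<tau>) powr t)" .
    qed (use B r[of k] in auto)
    also have "A * ?\<rho> powr \<mu> * e (k + k0) * (B * (2 * ?\<rho>) powr \<tau>) = A * 2 powr \<tau> * R powr \<gamma> * B * (e (k + k0) * 2 powr (\<gamma> * real (k + k0)))"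
    proof -
      have 1: "(2 * ?\<rho>) powr \<tau> = 2 powr \<tau> * ?\<rho> powr \<tau>" by (rule powr_mult)
      have "?\<rho> powr \<mu> * ?\<rho> powr \<tau> = ?\<rho> powr \<gamma>" by (simp only: \<gamma> powr_add)
      also have "\<dots> = (2 ^ (k + k0)) powr \<gamma> * R powr \<gamma>" by (rule powr_mult)
      also have "(2 ^ (k + k0)) powr \<gamma> = (2::real) powr (\<gamma> * real (k + k0))"
        by (simp only: powr_realpow[symmetric] powr_powr zero_less_numeral mult.commute)
      finally have 2: "?\<rho> powr \<mu> * ?\<rho> powr \<tau> = 2 powr (\<gamma> * real (k + k0)) * R powr \<gamma>" .
      have "A * ?\<rho> powr \<mu> * e (k + k0) * (B * (2 * ?\<rho>) powr \<tau>) = A * 2 powr \<tau> * B * e (k + k0) * (?\<rho> powr \<mu> * ?\<rho> powr \<tau>)"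
        unfolding 1 by (simp only: mult_ac)
      then show ?thesis unfolding 2 by (simp only: mult_ac)
    qed
    finally show ?thesis .
  qed
  have summ': "summable (\<lambda>k. e (k + k0) * 2 powr (\<gamma> * real (k + k0)))"
    using summable_iff_shift[of "\<lambda>k. e k * 2 powr (\<gamma> * real k)" k0] summ by simp
  have "(\<integral>\<^sup>+y\<in>- ball z (2 ^ k0 * R). ?F y \<partial>lborel) \<le> (\<integral>\<^sup>+y. (\<Sum>k. ?F y * indicator (annulus (?r k)) (z - y)) \<partial>lborel)"
    by (intro nn_integral_mono pt)
  also have "\<dots> = (\<Sum>k. \<integral>\<^sup>+y. ?F y * indicator (annulus (?r k)) (z - y) \<partial>lborel)"
    by (rule nn_integral_suminf) measurable
  also have "\<dots> \<le> (\<Sum>k. ennreal (A * 2 powr \<tau> * R powr \<gamma> * B * (e (k + k0) * 2 powr (\<gamma> * real (k + k0)))))"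
    by (intro suminf_le piece) auto
  also have "\<dots> = ennreal (\<Sum>k. A * 2 powr \<tau> * R powr \<gamma> * B * (e (k + k0) * 2 powr (\<gamma> * real (k + k0))))"
    using A B by (intro suminf_ennreal2 summable_mult summ') (auto intro!: mult_nonneg_nonneg less_imp_le)
  also have "(\<Sum>k. A * 2 powr \<tau> * R powr \<gamma> * B * (e (k + k0) * 2 powr (\<gamma> * real (k + k0))))
    = A * 2 powr \<tau> * (\<Sum>k. e (k + k0) * 2 powr (\<gamma> * real (k + k0))) * R powr \<gamma> * B"
    by (subst suminf_mult[OF summ']) simp
  finally show ?thesis .
qed

section \<open>The operator on one ball\<close>

lemma set_integrable_lborel_iff_nn_integral:
  fixes f :: "'a::euclidean_space \<Rightarrow> complex"
  assumes [measurable]: "f \<in> borel_measurable borel" "S \<in> sets borel"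
  shows "set_integrable lborel S f \<longleftrightarrow> (\<integral>\<^sup>+y\<in>S. ennreal (norm (f y)) \<partial>lborel) < top"
proof -
  have "(\<integral>\<^sup>+y. ennreal (norm (indicator S y *\<^sub>R f y)) \<partial>lborel) = (\<integral>\<^sup>+y\<in>S. ennreal (norm (f y)) \<partial>lborel)"
    by (intro nn_integral_cong) (auto split: split_indicator)
  then show ?thesis unfolding set_integrable_def integrable_iff_bounded by (simp add: less_top)
qed

lemma norm_set_lebesgue_integral_le_enn2real:
  fixes f :: "'a::euclidean_space \<Rightarrow> complex"
  assumes "set_integrable lborel S f"
  shows "norm (LINT y:S|lborel. f y) \<le> enn2real (\<integral>\<^sup>+y\<in>S. ennreal (norm (f y)) \<partial>lborel)"
proof -
  have m: "(\<lambda>y. indicator S y *\<^sub>R f y) \<in> borel_measurable lborel"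
    using assms unfolding set_integrable_def by (rule borel_measurable_integrable)
  have "norm (LINT y:S|lborel. f y) \<le> (LINT y|lborel. norm (indicator S y *\<^sub>R f y))"
    unfolding set_lebesgue_integral_def by (rule integral_norm_bound)
  also have "\<dots> = enn2real (\<integral>\<^sup>+y. ennreal (norm (indicator S y *\<^sub>R f y)) \<partial>lborel)"
    by (rule integral_eq_nn_integral[OF measurable_compose[OF m borel_measurable_norm]]) simp
  also have "(\<integral>\<^sup>+y. ennreal (norm (indicator S y *\<^sub>R f y)) \<partial>lborel) = (\<integral>\<^sup>+y\<in>S. ennreal (norm (f y)) \<partial>lborel)"
    by (intro nn_integral_cong) (auto split: split_indicator)
  finally show ?thesis .
qed

text \<open>The constant is the far part of the integral at the centre. If the far part does not converge
  absolutely at \<open>z\<close>, then it does so at no point of the ball, because the differences always converge;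
  then the whole integral is 0 by convention on the ball, and the constant 0 serves.\<close>

lemma convolution_near_constant:
  fixes K f :: "'a::euclidean_space \<Rightarrow> complex"
  assumes [measurable]: "K \<in> borel_measurable borel" "f \<in> borel_measurable borel" and D: "0 \<le> D"
    and far: "\<And>x. x \<in> ball z R \<Longrightarrow> (\<integral>\<^sup>+y\<in>- ball z R'. ennreal (norm (K (x - y) - K (z - y)) * norm (f y)) \<partial>lborel) \<le> ennreal D"
  defines "L \<equiv> \<lambda>x. \<integral>\<^sup>+y\<in>ball z R'. ennreal (norm (K (x - y)) * norm (f y)) \<partial>lborel"
  obtains c where "\<And>x. x \<in> ball z R \<Longrightarrow> L x < top \<Longrightarrow> norm ((LINT y|lborel. K (x - y) * f y) - c) \<le> enn2real (L x) + D"
proof -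
  let ?far = "- ball z R'"
  have [measurable]: "ball z R' \<in> sets borel" "?far \<in> sets borel" by simp_all
  have diff: "set_integrable lborel ?far (\<lambda>y. (K (x - y) - K (z - y)) * f y)" if "x \<in> ball z R" for x
    using le_less_trans[OF far[OF that]] by (subst set_integrable_lborel_iff_nn_integral) (auto simp: norm_mult)
  have split: "(\<lambda>y. K (x - y) * f y) = (\<lambda>y. (K (x - y) - K (z - y)) * f y + K (z - y) * f y)"
    "(\<lambda>y. K (z - y) * f y) = (\<lambda>y. K (x - y) * f y - (K (x - y) - K (z - y)) * f y)" for x
    by (auto simp: algebra_simps)
  show thesis
  proof (cases "set_integrable lborel ?far (\<lambda>y. K (z - y) * f y)")
    case True
    show thesis
    proof (rule that[of "LINT y:?far|lborel. K (z - y) * f y"])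
      fix x assume x: "x \<in> ball z R" and Lx: "L x < top"
      have near: "set_integrable lborel (ball z R') (\<lambda>y. K (x - y) * f y)"
        using Lx by (subst set_integrable_lborel_iff_nn_integral) (auto simp: L_def norm_mult)
      have farx: "set_integrable lborel ?far (\<lambda>y. K (x - y) * f y)"
        by (subst split(1)) (intro set_integral_add(1) diff x True)
      have "(LINT y|lborel. K (x - y) * f y) = (LINT y:ball z R' \<union> ?far|lborel. K (x - y) * f y)"
        by (simp add: set_lebesgue_integral_def)
      also have "\<dots> = (LINT y:ball z R'|lborel. K (x - y) * f y) + (LINT y:?far|lborel. K (x - y) * f y)"
        by (intro set_integral_Un near farx) simp
      also have "(LINT y:?far|lborel. K (x - y) * f y) = (LINT y:?far|lborel. (K (x - y) - K (z - y)) * f y) + (LINT y:?far|lborel. K (z - y) * f y)"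
        by (subst split(1)) (intro set_integral_add(2) diff x True)
      finally have "(LINT y|lborel. K (x - y) * f y) - (LINT y:?far|lborel. K (z - y) * f y)
        = (LINT y:ball z R'|lborel. K (x - y) * f y) + (LINT y:?far|lborel. (K (x - y) - K (z - y)) * f y)" by simp
      also have "norm \<dots> \<le> norm (LINT y:ball z R'|lborel. K (x - y) * f y) + norm (LINT y:?far|lborel. (K (x - y) - K (z - y)) * f y)"
        by (rule norm_triangle_ineq)
      also have "\<dots> \<le> enn2real (L x) + D"
      proof (intro add_mono)
        show "norm (LINT y:ball z R'|lborel. K (x - y) * f y) \<le> enn2real (L x)"
          using norm_set_lebesgue_integral_le_enn2real[OF near] by (simp add: L_def norm_mult)
        have "norm (LINT y:?far|lborel. (K (x - y) - K (z - y)) * f y) \<le> enn2real (\<integral>\<^sup>+y\<in>?far. ennreal (norm (K (x - y) - K (z - y)) * norm (f y)) \<partial>lborel)"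
          using norm_set_lebesgue_integral_le_enn2real[OF diff[OF x]] by (simp add: norm_mult)
        also have "\<dots> \<le> enn2real (ennreal D)" by (intro enn2real_mono far x) simp
        finally show "norm (LINT y:?far|lborel. (K (x - y) - K (z - y)) * f y) \<le> D" using D by simp
      qed
      finally show "norm ((LINT y|lborel. K (x - y) * f y) - (LINT y:?far|lborel. K (z - y) * f y)) \<le> enn2real (L x) + D" .
    qed
  next
    case False
    show thesis
    proof (rule that[of 0])
      fix x assume x: "x \<in> ball z R"
      have "\<not> integrable lborel (\<lambda>y. K (x - y) * f y)"
      proof
        assume "integrable lborel (\<lambda>y. K (x - y) * f y)"
        then have "set_integrable lborel ?far (\<lambda>y. K (x - y) * f y)"
          unfolding set_integrable_def by (intro integrable_mult_indicator) simp_all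
        then have "set_integrable lborel ?far (\<lambda>y. K (z - y) * f y)"
          by (subst split(2)[of x]) (intro set_integral_diff(1) diff x)
        with False show False by simp
      qed
      then show "norm ((LINT y|lborel. K (x - y) * f y) - 0) \<le> enn2real (L x) + D"
        using D by (simp add: not_integrable_integral_eq)
    qed
  qed
qed

lemma convolution_oscillation_bound:
  fixes K f :: "'a::euclidean_space \<Rightarrow> complex"
  assumes [measurable]: "K \<in> borel_measurable borel" "f \<in> borel_measurable borel" and D: "0 \<le> D" and R: "0 < R" and l: "1 \<le> l"
    and far: "\<And>x. x \<in> ball z R \<Longrightarrow> (\<integral>\<^sup>+y\<in>- ball z R'. ennreal (norm (K (x - y) - K (z - y)) * norm (f y)) \<partial>lborel) \<le> ennreal D"
    and G: "(\<integral>\<^sup>+y\<in>ball z R'. ennreal (norm (f y)) \<partial>lborel) \<le> ennreal G" "0 < G"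
    and A: "(\<integral>\<^sup>+u\<in>ball 0 (R + R'). ennreal (norm (K u) powr l) \<partial>lborel) \<le> ennreal A" "0 \<le> A"
  obtains c where "(\<integral>\<^sup>+x\<in>ball z R. ennreal (norm ((LINT y|lborel. K (x - y) * f y) - c) powr l) \<partial>lborel)
    \<le> ennreal (2 powr l * (2 powr l * G powr l * A + D powr l * (unit_ball_vol (real DIM('a)) * R ^ DIM('a))))"
proof -
  define L where "L x = (\<integral>\<^sup>+y\<in>ball z R'. ennreal (norm (K (x - y)) * norm (f y)) \<partial>lborel)" for x
  have [measurable]: "ball (c::'a) r \<in> sets borel" for c r by simp
  have [measurable]: "L \<in> borel_measurable borel" unfolding L_def by measurable
  obtain c where c: "\<And>x. x \<in> ball z R \<Longrightarrow> L x < top \<Longrightarrow> norm ((LINT y|lborel. K (x - y) * f y) - c) \<le> enn2real (L x) + D"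
    using convolution_near_constant[OF assms(1,2) D far] unfolding L_def by blast
  note loc = local_convolution_bound[of "\<lambda>x. norm (K x)" "\<lambda>x. norm (f x)" l z R' G R A, folded L_def]
  have fin: "AE x in lborel. x \<in> ball z R \<longrightarrow> L x < top"
    by (rule loc(1)) (use l G A in auto)
  have Lint: "(\<integral>\<^sup>+x\<in>ball z R. ennreal (enn2real (L x) powr l) \<partial>lborel) \<le> ennreal (2 powr l * G powr l * A)"
    by (rule loc(2)) (use l G A in auto)
  have "(\<integral>\<^sup>+x\<in>ball z R. ennreal (norm ((LINT y|lborel. K (x - y) * f y) - c) powr l) \<partial>lborel)
    \<le> (\<integral>\<^sup>+x. ennreal (2 powr l) * (ennreal (enn2real (L x) powr l) * indicator (ball z R) x + ennreal (D powr l) * indicator (ball z R) x) \<partial>lborel)"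
  proof (rule nn_integral_mono_AE)
    show "AE x in lborel. ennreal (norm ((LINT y|lborel. K (x - y) * f y) - c) powr l) * indicator (ball z R) x
      \<le> ennreal (2 powr l) * (ennreal (enn2real (L x) powr l) * indicator (ball z R) x + ennreal (D powr l) * indicator (ball z R) x)"
      using fin
    proof eventually_elim
      case (elim x)
      show ?case
      proof (cases "x \<in> ball z R")
        case True
        have "norm ((LINT y|lborel. K (x - y) * f y) - c) powr l \<le> (enn2real (L x) + D) powr l"
          using c[OF True] elim True l by (intro powr_mono2) auto
        also have "\<dots> \<le> 2 powr l * (enn2real (L x) powr l + D powr l)" using D l by (intro powr_add_le) auto
        finally have "ennreal (norm ((LINT y|lborel. K (x - y) * f y) - c) powr l) \<le> ennreal (2 powr l) * (ennreal (enn2real (L x) powr l) + ennreal (D powr l))"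
          by (simp flip: ennreal_mult ennreal_plus)
        then show ?thesis using True by simp
      qed simp
    qed
  qed
  also have "\<dots> = ennreal (2 powr l) * ((\<integral>\<^sup>+x\<in>ball z R. ennreal (enn2real (L x) powr l) \<partial>lborel) + ennreal (D powr l) * emeasure lborel (ball z R))"
    by (simp add: nn_integral_cmult nn_integral_add nn_integral_cmult_indicator)
  also have "\<dots> \<le> ennreal (2 powr l) * (ennreal (2 powr l * G powr l * A) + ennreal (D powr l) * ennreal (unit_ball_vol (real DIM('a)) * R ^ DIM('a)))"
    using R by (intro mult_left_mono add_mono Lint) (auto simp: emeasure_ball)
  also have "\<dots> = ennreal (2 powr l * (2 powr l * G powr l * A + D powr l * (unit_ball_vol (real DIM('a)) * R ^ DIM('a))))"
    using A R by (simp flip: ennreal_mult ennreal_plus)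
  finally show thesis by (rule that)
qed

section \<open>Campanato seminorms\<close>

text \<open>Replacing an arbitrary constant \<open>c\<close> by the average costs a bounded factor, since the average differs
  from \<open>c\<close> by at most the mean of \<open>|h - c|\<close>.\<close>

lemma mean_oscillation_le:
  fixes h :: "real^'n \<Rightarrow> complex"
  assumes hm[measurable]: "h \<in> borel_measurable lebesgue" and R: "0 < R" and \<Lambda>: "0 < \<Lambda>" and l: "1 \<le> l"
    and le: "(\<integral>\<^sup>+x\<in>ball z R. ennreal (norm (h x - c) powr l) \<partial>lebesgue)
      \<le> ennreal (unit_ball_vol (real CARD('n)) * R ^ CARD('n) * \<Lambda> powr l)"
  shows "set_integrable lebesgue (ball z R) h"
    and "epowr (eavg (ball z R) (\<lambda>x. ennreal (norm (h x - avg (ball z R) h) powr l))) (1 / l) \<le> ennreal (8 * \<Lambda>)"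
proof -
  define v where "v = unit_ball_vol (real CARD('n)) * R ^ CARD('n)"
  have v: "0 < v" using R by (simp add: v_def)
  have Bm[measurable]: "ball z R \<in> sets lebesgue" by simp
  have Bem: "emeasure lebesgue (ball z R) = ennreal v" using R by (simp add: v_def emeasure_ball)
  then have Bme: "measure lebesgue (ball z R) = v" using v by (simp add: measure_def)
  have Bfin: "emeasure lebesgue (ball z R) < \<infinity>" using Bem by simp
  have L1: "(\<integral>\<^sup>+x\<in>ball z R. ennreal (norm (h x - c)) \<partial>lebesgue) \<le> ennreal (2 * v * \<Lambda>)"
    by (rule nn_integral_L1_le_Lp[where l = l]) (use l \<Lambda> v le Bem in \<open>auto simp: v_def\<close>)
  have norm_eq: "(\<integral>\<^sup>+x. ennreal (norm (indicator (ball z R) x *\<^sub>R (h x - c))) \<partial>lebesgue) = (\<integral>\<^sup>+x\<in>ball z R. ennreal (norm (h x - c)) \<partial>lebesgue)"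
    by (intro nn_integral_cong) (auto split: split_indicator)
  have ic: "set_integrable lebesgue (ball z R) (\<lambda>x. h x - c)"
    unfolding set_integrable_def integrable_iff_bounded norm_eq
    using le_less_trans[OF L1] by simp
  have cc: "set_integrable lebesgue (ball z R) (\<lambda>x. c)"
    using Bfin unfolding set_integrable_def by simp
  have "set_integrable lebesgue (ball z R) (\<lambda>x. (h x - c) + c)"
    by (intro set_integral_add(1) ic cc)
  then show ih: "set_integrable lebesgue (ball z R) h" by simp
  have "(LINT x:ball z R|lebesgue. h x) - v *\<^sub>R c = (LINT x:ball z R|lebesgue. h x - c)"
    using set_integral_diff(2)[OF ih cc] Bme Bfin by (simp add: set_lebesgue_integral_def)
  then have "avg (ball z R) h - c = (1 / v) *\<^sub>R (LINT x:ball z R|lebesgue. h x - c)"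
  proof -
    assume e: "(LINT x:ball z R|lebesgue. h x) - v *\<^sub>R c = (LINT x:ball z R|lebesgue. h x - c)"
    have "avg (ball z R) h - c = (1 / v) *\<^sub>R (LINT x:ball z R|lebesgue. h x) - (1 / v) *\<^sub>R (v *\<^sub>R c)"
      using v by (simp add: avg_def Bme)
    also have "\<dots> = (1 / v) *\<^sub>R ((LINT x:ball z R|lebesgue. h x) - v *\<^sub>R c)"
      by (rule scaleR_diff_right[symmetric])
    finally show ?thesis unfolding e .
  qed
  then have "norm (avg (ball z R) h - c) = (1 / v) * norm (LINT x:ball z R|lebesgue. h x - c)"
    using v by simp
  also have "norm (LINT x:ball z R|lebesgue. h x - c) \<le> enn2real (\<integral>\<^sup>+x. ennreal (norm (indicator (ball z R) x *\<^sub>R (h x - c))) \<partial>lebesgue)"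
  proof -
    have "norm (LINT x:ball z R|lebesgue. h x - c) \<le> (LINT x|lebesgue. norm (indicator (ball z R) x *\<^sub>R (h x - c)))"
      unfolding set_lebesgue_integral_def by (rule integral_norm_bound)
    also have "\<dots> = enn2real (\<integral>\<^sup>+x. ennreal (norm (indicator (ball z R) x *\<^sub>R (h x - c))) \<partial>lebesgue)"
      by (intro integral_eq_nn_integral) auto
    finally show ?thesis .
  qed
  also have "\<dots> \<le> enn2real (ennreal (2 * v * \<Lambda>))" unfolding norm_eq by (intro enn2real_mono L1) simp
  finally have av: "norm (avg (ball z R) h - c) \<le> 2 * \<Lambda>" using v \<Lambda> by (simp add: divide_simps)
  let ?a = "avg (ball z R) h"
  have "(\<integral>\<^sup>+x\<in>ball z R. ennreal (norm (h x - ?a) powr l) \<partial>lebesgue)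
    \<le> (\<integral>\<^sup>+x. ennreal (2 powr l) * (ennreal (norm (h x - c) powr l) * indicator (ball z R) x + ennreal ((2 * \<Lambda>) powr l) * indicator (ball z R) x) \<partial>lebesgue)"
  proof (intro nn_integral_mono)
    fix x
    have "norm (h x - ?a) \<le> norm (h x - c) + norm (?a - c)"
      using norm_triangle_ineq4[of "h x - c" "?a - c"] by simp
    then have "norm (h x - ?a) powr l \<le> (norm (h x - c) + 2 * \<Lambda>) powr l"
      using av l by (intro powr_mono2) auto
    also have "\<dots> \<le> 2 powr l * (norm (h x - c) powr l + (2 * \<Lambda>) powr l)"
      using \<Lambda> l by (intro powr_add_le) auto
    finally have "ennreal (norm (h x - ?a) powr l) \<le> ennreal (2 powr l) * (ennreal (norm (h x - c) powr l) + ennreal ((2 * \<Lambda>) powr l))"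
      by (simp flip: ennreal_mult ennreal_plus)
    then show "ennreal (norm (h x - ?a) powr l) * indicator (ball z R) x
      \<le> ennreal (2 powr l) * (ennreal (norm (h x - c) powr l) * indicator (ball z R) x + ennreal ((2 * \<Lambda>) powr l) * indicator (ball z R) x)"
      by (auto split: split_indicator)
  qed
  also have "\<dots> = ennreal (2 powr l) * ((\<integral>\<^sup>+x\<in>ball z R. ennreal (norm (h x - c) powr l) \<partial>lebesgue) + ennreal ((2 * \<Lambda>) powr l) * emeasure lebesgue (ball z R))"
    by (simp add: nn_integral_cmult nn_integral_add nn_integral_cmult_indicator)
  also have "\<dots> \<le> ennreal (2 powr l) * (ennreal (v * \<Lambda> powr l) + ennreal ((2 * \<Lambda>) powr l) * ennreal v)"
    unfolding Bem by (intro mult_left_mono add_right_mono) (use le in \<open>simp_all add: v_def\<close>)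
  also have "\<dots> = ennreal (2 powr l * (v * \<Lambda> powr l + (2 * \<Lambda>) powr l * v))"
    using v by (simp flip: ennreal_mult ennreal_plus)
  also have "\<dots> \<le> ennreal (v * (8 * \<Lambda>) powr l)"
  proof (rule ennreal_leI)
    have "\<Lambda> powr l \<le> (2 * \<Lambda>) powr l" using \<Lambda> l by (intro powr_mono2) auto
    then have "v * \<Lambda> powr l + (2 * \<Lambda>) powr l * v \<le> v * (2 * (2 * \<Lambda>) powr l)"
      using v by (simp add: algebra_simps)
    also have "\<dots> \<le> v * (2 powr l * (2 * \<Lambda>) powr l)"
      using v powr_mono[of 1 l "2::real"] l by (intro mult_left_mono mult_right_mono) auto
    finally have "2 powr l * (v * \<Lambda> powr l + (2 * \<Lambda>) powr l * v) \<le> 2 powr l * (v * (2 powr l * (2 * \<Lambda>) powr l))"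
      by (intro mult_left_mono) auto
    also have "\<dots> = v * (2 powr l * (2 powr l * (2 * \<Lambda>) powr l))" by simp
    also have "2 powr l * (2 powr l * (2 * \<Lambda>) powr l) = (8 * \<Lambda>) powr l"
      unfolding powr_mult[symmetric] by simp
    finally show "2 powr l * (v * \<Lambda> powr l + (2 * \<Lambda>) powr l * v) \<le> v * (8 * \<Lambda>) powr l" .
  qed
  finally have le2: "(\<integral>\<^sup>+x\<in>ball z R. ennreal (norm (h x - ?a) powr l) \<partial>lebesgue) \<le> ennreal (v * (8 * \<Lambda>) powr l)" .
  have "eavg (ball z R) (\<lambda>x. ennreal (norm (h x - ?a) powr l)) \<le> ennreal (v * (8 * \<Lambda>) powr l) / ennreal v"
    unfolding eavg_def Bem by (intro divide_right_mono_ennreal le2)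
  also have "\<dots> = ennreal ((8 * \<Lambda>) powr l)"
    using v by (simp add: divide_ennreal)
  finally show "epowr (eavg (ball z R) (\<lambda>x. ennreal (norm (h x - ?a) powr l))) (1 / l) \<le> ennreal (8 * \<Lambda>)"
    using l \<Lambda> by (intro epowr_le) auto
qed

lemma locally_integrable_if_balls:
  fixes h :: "real^'n \<Rightarrow> complex"
  assumes "\<And>R. 0 < R \<Longrightarrow> set_integrable lebesgue (ball 0 R) h"
  shows "locally_integrable h"
  unfolding locally_integrable_def
proof (intro allI impI)
  fix K :: "(real^'n) set" assume K: "compact K"
  then obtain R where R: "0 < R" "K \<subseteq> ball 0 R"
    using compact_imp_bounded bounded_subset_ballD by blast
  show "set_integrable lebesgue K h"
    by (rule set_integrable_subset[OF assms[OF R(1)]]) (use lmeasurable_compact[OF K, THEN fmeasurableD] R in auto)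
qed

section \<open>Borel representatives\<close>

lemma AE_lborel_minus:
  fixes P :: "'a::euclidean_space \<Rightarrow> bool"
  assumes "AE u in lborel. P u"
  shows "AE y in lborel. P (x - y)"
proof -
  obtain N where N: "{u \<in> space lborel. \<not> P u} \<subseteq> N" "emeasure lborel N = 0" "N \<in> sets lborel"
    using assms by (rule AE_E)
  then have Nb[measurable]: "N \<in> sets borel" by simp
  have m: "(\<lambda>y. x - y) -` N \<in> sets borel" using measurable_sets[of "\<lambda>y. x - y" borel borel N] Nb by simp
  have "emeasure lborel ((\<lambda>y. x - y) -` N) = (\<integral>\<^sup>+y. indicator N (x - y) \<partial>lborel)"
  proof -
    have "indicator N (x - y) = (indicator ((\<lambda>y. x - y) -` N) y :: ennreal)" for y
      by (auto split: split_indicator)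
    then show ?thesis using m by simp
  qed
  also have "\<dots> = (\<integral>\<^sup>+u. indicator N u \<partial>lborel)"
    using nn_integral_lborel_affine[of "indicator N" "-1" x] by simp
  also have "\<dots> = 0" using N by simp
  finally have "(\<lambda>y. x - y) -` N \<in> null_sets lborel" using m by (simp add: null_sets_def)
  then have "AE y in lborel. y \<notin> (\<lambda>y. x - y) -` N" by (rule AE_not_in)
  then show ?thesis by eventually_elim (use N(1) in auto)
qed

lemma lebesgue_borel_representative:
  fixes f :: "'a::euclidean_space \<Rightarrow> complex"
  assumes "f \<in> borel_measurable lebesgue"
  obtains g where "g \<in> borel_measurable borel" "AE x in lborel. f x = g x"
proof -
  have "(\<lambda>x. Re (f x)) \<in> borel_measurable (completion lborel)" "(\<lambda>x. Im (f x)) \<in> borel_measurable (completion lborel)"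
    using assms by auto
  note this[THEN completion_ex_borel_measurable_real]
  then obtain a b where a: "a \<in> borel_measurable lborel" "AE x in lborel. Re (f x) = a x"
    and b: "b \<in> borel_measurable lborel" "AE x in lborel. Im (f x) = b x"
    by blast
  show thesis
  proof (rule that[of "\<lambda>x. complex_of_real (a x) + \<i> * complex_of_real (b x)"])
    show "(\<lambda>x. complex_of_real (a x) + \<i> * complex_of_real (b x)) \<in> borel_measurable borel"
      using a(1) b(1) by simp
    show "AE x in lborel. f x = complex_of_real (a x) + \<i> * complex_of_real (b x)"
      using a(2) b(2) by eventually_elim (simp add: complex_eq_iff)
  qed
qed

text \<open>The function \<open>F\<close> is Lebesgue measurable because it agrees almost everywhere with a Borel function and
  Lebesgue measure is complete.\<close>

lemma lebesgue_integral_eq_lborel: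
  fixes F G :: "'a::euclidean_space \<Rightarrow> complex"
  assumes G: "G \<in> borel_measurable borel" and FG: "AE y in lborel. F y = G y"
  shows "(LINT y|lebesgue. F y) = (LINT y|lborel. G y)"
proof -
  have AEc: "AE y in lebesgue. G y = F y" using FG by (intro AE_completion) (auto elim: eventually_mono)
  have Gm: "G \<in> borel_measurable lebesgue" using G by (intro measurable_completion) simp
  have "F \<in> borel_measurable lebesgue"
  proof -
    have "AE y in lebesgue. y \<in> UNIV \<longrightarrow> G y = F y" using AEc by simp
    then obtain N where "N \<in> null_sets lebesgue" "{y. G y \<noteq> F y} \<subseteq> N"
      using AEc by (auto simp: eventually_ae_filter)
    then have neg: "negligible {y. G y \<noteq> F y}"
      by (meson negligible_iff_null_sets negligible_subset)
    show ?thesis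
      using borel_measurable_AE[OF Gm AEc] by simp
  qed
  then have "(LINT y|lebesgue. F y) = (LINT y|lebesgue. G y)"
    using Gm AEc by (intro integral_cong_AE) (auto elim: eventually_mono)
  also have "\<dots> = (LINT y|lborel. G y)" using G by (intro integral_completion) simp
  finally show ?thesis .
qed

text \<open>The values of the operator do not change under the passage to Borel representatives, at every
  single point \<open>x\<close>.\<close>

lemma T_op_eq_borel:
  fixes \<Omega> O' f g :: "real^'n \<Rightarrow> complex"
  assumes [measurable]: "O' \<in> borel_measurable borel" "g \<in> borel_measurable borel"
    and \<Omega>: "AE x in lborel. O' x = \<Omega> x" and f: "AE x in lborel. f x = g x"
  shows "T_op \<Omega> \<alpha> f x = (LINT y|lborel. rough_kernel O' (real CARD('n) - \<alpha>) (x - y) * g y)"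
  unfolding T_op_def
proof (rule lebesgue_integral_eq_lborel)
  show "(\<lambda>y. rough_kernel O' (real CARD('n) - \<alpha>) (x - y) * g y) \<in> borel_measurable borel" by measurable
  show "AE y in lborel. \<Omega> (x - y) / complex_of_real (norm (x - y) powr (real CARD('n) - \<alpha>)) * f y
     = rough_kernel O' (real CARD('n) - \<alpha>) (x - y) * g y"
    using AE_lborel_minus[OF \<Omega>, of x] f by eventually_elim (simp add: rough_kernel_def)
qed

section \<open>The main estimate\<close>

text \<open>The lower bound on \<open>s\<close> says that the conjugate exponent is at most \<open>N / \<alpha>\<close>, which is less than \<open>p\<close>.\<close>

lemma conj_exp_less:
  assumes N: "0 < \<alpha>" "\<alpha> < N" and s: "ennreal (N / (N - \<alpha>)) \<le> s" and p: "N / \<alpha> < p"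
  shows "1 < s" "enn2real (conj_exp s) < p"
proof -
  have "1 < N / (N - \<alpha>)" using N by (simp add: less_divide_eq)
  then have "1 < ennreal (N / (N - \<alpha>))" by (subst ennreal_1[symmetric], subst ennreal_less_iff) auto
  then show "1 < s" using s by (rule less_le_trans)
  have p1: "1 < p"
  proof -
    have "1 < N / \<alpha>" using N by simp
    then show ?thesis using p by simp
  qed
  show "enn2real (conj_exp s) < p"
  proof (cases "s = top")
    case True then show ?thesis using p1 by (simp add: conj_exp_top)
  next
    case False
    then obtain \<sigma> where \<sigma>: "s = ennreal \<sigma>" "0 \<le> \<sigma>" by (cases s) auto
    have \<sigma>N: "N / (N - \<alpha>) \<le> \<sigma>" using s \<sigma> N by (simp add: ennreal_le_iff)
    then have \<sigma>1: "1 < \<sigma>" using \<open>1 < N / (N - \<alpha>)\<close> by simp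
    have "N \<le> \<sigma> * (N - \<alpha>)" using \<sigma>N N by (simp add: divide_le_eq)
    then have "\<sigma> / (\<sigma> - 1) \<le> N / \<alpha>" using \<sigma>1 N by (simp add: divide_le_eq le_divide_eq algebra_simps)
    then show ?thesis using \<sigma> \<sigma>1 p by (simp add: conj_exp_ennreal)
  qed
qed

text \<open>The theorem for functions of finite weighted norm at most \<open>M\<close>. On the ball of radius \<open>R\<close> around \<open>z\<close> the near
  and the far part are both of size \<open>R powr \<gamma> * M / W z R\<close>, and the factor \<open>W z R\<close> is cancelled by the
  essential supremum in the Campanato seminorm.\<close>

lemma T_op_ball_bound:
  fixes \<Omega> :: "real^'n \<Rightarrow> complex" and \<omega> :: "real^'n \<Rightarrow> real"
    and \<alpha> \<beta> \<gamma> p l s' :: real and s :: ennreal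
  assumes \<alpha>: "0 < \<alpha>" "\<alpha> < real CARD('n)"
    and s: "ennreal (real CARD('n) / (real CARD('n) - \<alpha>)) \<le> s"
    and \<beta>: "0 < \<beta>" "\<beta> \<le> 1" and dini: "dini s \<beta> \<Omega>"
    and p: "real CARD('n) / \<alpha> < p" and s': "s' = enn2real (conj_exp s)"
    and w: "weight \<omega>" "(\<lambda>x. \<omega> x powr s') \<in> A_infty (p / s')"
    and l: "1 \<le> l" "l < real CARD('n) / (real CARD('n) - \<alpha>)"
    and \<gamma>: "\<gamma> = \<alpha> - real CARD('n) / p" "\<gamma> < \<beta>"
  obtains C where "0 < C" "\<And>f M. f \<in> borel_measurable lebesgue \<Longrightarrow> 0 < M \<Longrightarrow>
      (\<integral>\<^sup>+x. ennreal (norm (f x) powr p * \<omega> x powr p) \<partial>lebesgue) \<le> ennreal (M powr p) \<Longrightarrow>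
      locally_integrable (T_op \<Omega> \<alpha> f) \<and> campanato_norm \<gamma> l \<omega> (T_op \<Omega> \<alpha> f) \<le> ennreal (C * M)"
proof -
  let ?N = "real CARD('n)"
  define \<kappa> where "\<kappa> = ?N - \<alpha>"
  have \<kappa>: "0 < \<kappa>" using \<alpha> by (simp add: \<kappa>_def)
  have s1: "1 < s" and s'p: "s' < p" using conj_exp_less[OF \<alpha> s p] by (simp_all add: s')
  obtain O' A e k0 where Om[measurable]: "O' \<in> borel_measurable borel" and hom: "homogeneous_degree_zero O'"
    and O\<Omega>: "AE x in lborel. O' x = \<Omega> x" and s'1: "1 \<le> s'" and A: "0 < (A::real)" and e: "\<And>k::nat. 0 < (e k :: real)"
    and summ: "summable (\<lambda>k. e k * 2 powr (\<gamma> * real k))"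
    and bound: "\<And>k r a. k0 \<le> k \<Longrightarrow> 0 < r \<Longrightarrow> norm a \<le> r * 2 powr (- real k) \<Longrightarrow>
       dual_bound s' (annulus r) (\<lambda>u. norm (rough_kernel O' \<kappa> (u - a) - rough_kernel O' \<kappa> u))
         (A * r powr (?N * (1 - 1 / s') - \<kappa>) * e k)"
    and Ol: "\<And>l. 0 \<le> l \<Longrightarrow> ennreal l \<le> s \<Longrightarrow> (\<integral>\<^sup>+x\<in>ball 0 1. ennreal (norm (O' x) powr l) \<partial>lborel) < top"
    by (rule dini_kernel_regularity[OF dini s1 s', of \<gamma> \<kappa>]) (use \<beta> \<gamma> \<kappa> in auto)
  define K where "K = rough_kernel O' \<kappa>"
  have Km[measurable]: "K \<in> borel_measurable borel" by (simp add: K_def)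
  obtain C W where C: "0 < (C::real)" and W: "\<And>z R. 0 < R \<Longrightarrow> 0 < (W z R :: real)"
    "\<And>z R. 0 < R \<Longrightarrow> esssup_on (ball z R) \<omega> \<le> ennreal (W z R)"
    and Fs: "\<And>(f :: real^'n \<Rightarrow> complex) M z R \<rho>. f \<in> borel_measurable lebesgue \<Longrightarrow> 0 < M \<Longrightarrow>
       (\<integral>\<^sup>+x. ennreal (norm (f x) powr p * \<omega> x powr p) \<partial>lebesgue) \<le> ennreal (M powr p) \<Longrightarrow> 0 < R \<Longrightarrow> R \<le> \<rho> \<Longrightarrow>
       (\<integral>\<^sup>+x\<in>ball z \<rho>. ennreal (norm (f x) powr s') \<partial>lebesgue)
         \<le> ennreal ((C * M / W z R * \<rho> powr (?N * (1 / s' - 1 / p))) powr s')"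
    and F1: "\<And>(f :: real^'n \<Rightarrow> complex) M z R \<rho>. f \<in> borel_measurable lebesgue \<Longrightarrow> 0 < M \<Longrightarrow>
       (\<integral>\<^sup>+x. ennreal (norm (f x) powr p * \<omega> x powr p) \<partial>lebesgue) \<le> ennreal (M powr p) \<Longrightarrow> 0 < R \<Longrightarrow> R \<le> \<rho> \<Longrightarrow>
       (\<integral>\<^sup>+x\<in>ball z \<rho>. ennreal (norm (f x)) \<partial>lebesgue)
         \<le> ennreal (C * M / W z R * \<rho> powr (?N * (1 - 1 / p)))"
    using weighted_Lp_local_bounds[OF w s'1 s'p] by blast
  have \<kappa>l: "\<kappa> * l < ?N" using l \<kappa> by (simp add: \<kappa>_def less_divide_eq mult.commute)
  have ls: "ennreal l \<le> s" using l by (intro order_trans[OF _ s] ennreal_leI) simp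
  obtain Al where Al: "0 < Al" "\<And>\<rho>. 0 < \<rho> \<Longrightarrow>
    (\<integral>\<^sup>+u\<in>ball 0 \<rho>. ennreal (norm (K u) powr l) \<partial>lborel) \<le> ennreal (Al * \<rho> powr (?N - \<kappa> * l))"
    unfolding K_def by (rule nn_integral_rough_kernel_powr_ball[OF Om hom _ \<kappa>l]) (use l \<kappa> Ol ls in auto)
  define V where "V = unit_ball_vol ?N"
  have V: "0 < V" by (simp add: V_def)
  define \<mu> where "\<mu> = ?N * (1 - 1 / s') - \<kappa>"
  define \<tau> where "\<tau> = ?N * (1 / s' - 1 / p)"
  have \<gamma>\<mu>: "\<gamma> = \<mu> + \<tau>" by (simp add: \<gamma> \<mu>_def \<tau>_def \<kappa>_def algebra_simps)
  define S where "S = (\<Sum>k. e (k + k0) * 2 powr (\<gamma> * real (k + k0)))"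
  have "summable (\<lambda>k. e (k + k0) * 2 powr (\<gamma> * real (k + k0)))"
    using summable_iff_shift[of "\<lambda>k. e k * 2 powr (\<gamma> * real k)" k0] summ by simp
  then have S: "0 \<le> S" unfolding S_def using e by (intro suminf_nonneg) (auto intro: less_imp_le)
  define D1 where "D1 = A * 2 powr \<tau> * S"
  have D1: "0 \<le> D1" using A S by (simp add: D1_def)
  define G1 where "G1 = (2 ^ k0) powr (?N * (1 - 1 / p))"
  have G1: "0 < G1" by (simp add: G1_def)
  define a0 where "a0 = (1 + 2 ^ k0) powr (?N - \<kappa> * l)"
  have "(0::real) < 1 + 2 ^ k0" by (intro add_pos_pos) auto
  then have a0: "0 < a0" by (simp add: a0_def)
  define Q where "Q = 2 powr l * (2 powr l * G1 powr l * a0 * Al + D1 powr l * V)"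
  have Q: "0 < Q" unfolding Q_def using G1 a0 Al(1) V by (intro mult_pos_pos add_pos_nonneg) auto
  define \<Lambda>1 where "\<Lambda>1 = (Q / V) powr (1 / l)"
  have \<Lambda>1: "0 < \<Lambda>1" "V * \<Lambda>1 powr l = Q" using Q V l by (auto simp: \<Lambda>1_def powr_powr)
  define C' where "C' = V powr (- (\<gamma> / ?N)) * (8 * \<Lambda>1) * C"
  have C': "0 < C'" using V \<Lambda>1 C by (simp add: C'_def)
  show thesis
  proof (rule that[OF C'])
    fix f :: "real^'n \<Rightarrow> complex" and M :: real
    assume fm: "f \<in> borel_measurable lebesgue" and M: "0 < M"
      and fM: "(\<integral>\<^sup>+x. ennreal (norm (f x) powr p * \<omega> x powr p) \<partial>lebesgue) \<le> ennreal (M powr p)"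
    obtain g where gm[measurable]: "g \<in> borel_measurable borel" and fg: "AE x in lborel. f x = g x"
      by (rule lebesgue_borel_representative[OF fm])
    define T where "T x = (LINT y|lborel. K (x - y) * g y)" for x
    have Teq: "T_op \<Omega> \<alpha> f = T"
      by (rule ext) (simp add: T_op_eq_borel[OF Om gm O\<Omega> fg] T_def K_def \<kappa>_def)
    have Tb: "T \<in> borel_measurable borel"
      unfolding T_def by (rule lborel.borel_measurable_lebesgue_integral[where N = borel, simplified]) measurable
    have Tm: "T \<in> borel_measurable lebesgue" using Tb by (intro measurable_completion) simp
    have conv: "(\<integral>\<^sup>+x\<in>ball z \<rho>. ennreal (norm (g x) powr t) \<partial>lborel) = (\<integral>\<^sup>+x\<in>ball z \<rho>. ennreal (norm (f x) powr t) \<partial>lebesgue)" for z \<rho> t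
      unfolding nn_integral_completion
      by (rule nn_integral_cong_AE) (use fg in eventually_elim, simp)
    have conv1: "(\<integral>\<^sup>+x\<in>ball z \<rho>. ennreal (norm (g x)) \<partial>lborel) = (\<integral>\<^sup>+x\<in>ball z \<rho>. ennreal (norm (f x)) \<partial>lebesgue)" for z \<rho>
      unfolding nn_integral_completion
      by (rule nn_integral_cong_AE) (use fg in eventually_elim, simp)
    have main: "set_integrable lebesgue (ball z R) T"
      "epowr (eavg (ball z R) (\<lambda>x. ennreal (norm (T x - avg (ball z R) T) powr l))) (1 / l) \<le> ennreal (8 * (\<Lambda>1 * R powr \<gamma> * (C * M / W z R)))"
      if R: "0 < R" for z R
    proof -
      define B where "B = C * M / W z R"
      have B: "0 < B" using C M W(1)[OF R, of z] by (simp add: B_def)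
      define R' where "R' = 2 ^ k0 * R"
      have R': "R \<le> R'" "0 < R'" using R by (auto simp: R'_def)
      define D where "D = D1 * R powr \<gamma> * B"
      define G where "G = B * R' powr (?N * (1 - 1 / p))"
      have D: "0 \<le> D" using D1 B by (simp add: D_def)
      have G: "0 < G" using B R' by (simp add: G_def)
      have far: "(\<integral>\<^sup>+y\<in>- ball z R'. ennreal (norm (K (x - y) - K (z - y)) * norm (g y)) \<partial>lborel) \<le> ennreal D"
        if x: "x \<in> ball z R" for x
        unfolding D_def D1_def S_def R'_def
      proof (rule far_difference_bound[where t = s' and \<mu> = \<mu> and \<tau> = \<tau>])
        show "\<And>k r a. k0 \<le> k \<Longrightarrow> 0 < r \<Longrightarrow> norm a \<le> r * 2 powr (- real k) \<Longrightarrow>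
          dual_bound s' (annulus r) (\<lambda>u. norm (K (u - a) - K u)) (A * r powr \<mu> * e k)"
          unfolding K_def \<mu>_def by (rule bound)
        show "(\<integral>\<^sup>+y\<in>ball z \<rho>. ennreal (norm (g y) powr s') \<partial>lborel) \<le> ennreal ((B * \<rho> powr \<tau>) powr s')" if "R \<le> \<rho>" for \<rho>
          unfolding conv B_def \<tau>_def by (rule Fs[OF fm M fM R that])
        show "norm (x - z) \<le> R" using x by (simp add: dist_norm norm_minus_commute)
      qed (use A e summ \<gamma>\<mu> B R in auto)
      have near: "(\<integral>\<^sup>+y\<in>ball z R'. ennreal (norm (g y)) \<partial>lborel) \<le> ennreal G"
        unfolding conv1 G_def B_def by (rule F1[OF fm M fM R R'(1)])
      have RR: "0 < R + R'" using R R' by simp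
      obtain c where c: "(\<integral>\<^sup>+x\<in>ball z R. ennreal (norm (T x - c) powr l) \<partial>lborel)
        \<le> ennreal (2 powr l * (2 powr l * G powr l * (Al * (R + R') powr (?N - \<kappa> * l)) + D powr l * (unit_ball_vol (real DIM(real^'n)) * R ^ DIM(real^'n))))"
        unfolding T_def by (rule convolution_oscillation_bound[OF Km gm D R l(1) far near G Al(2)[OF RR]]) (use Al in auto)
      have total: "2 powr l * (2 powr l * G powr l * (Al * (R + R') powr (?N - \<kappa> * l)) + D powr l * (unit_ball_vol (real DIM(real^'n)) * R ^ DIM(real^'n)))
        = V * R ^ CARD('n) * (\<Lambda>1 * R powr \<gamma> * B) powr l"
      proof -
        have e1: "(R + R') powr (?N - \<kappa> * l) = a0 * R powr (?N - \<kappa> * l)"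
        proof -
          have "R + R' = (1 + 2 ^ k0) * R" by (simp add: R'_def distrib_right)
          then show ?thesis by (simp only: powr_mult a0_def)
        qed
        have e2: "G powr l = G1 powr l * (R powr (?N * (1 - 1 / p))) powr l * B powr l"
          by (simp add: G_def R'_def G1_def powr_mult)
        have e3: "(R powr (?N * (1 - 1 / p))) powr l * R powr (?N - \<kappa> * l) = R ^ CARD('n) * (R powr \<gamma>) powr l"
        proof -
          have "?N * (1 - 1 / p) * l + (?N - \<kappa> * l) = ?N + \<gamma> * l"
            by (simp add: \<gamma> \<kappa>_def algebra_simps)
          then have "R powr (?N * (1 - 1 / p) * l) * R powr (?N - \<kappa> * l) = R powr ?N * R powr (\<gamma> * l)"
            by (simp only: powr_add[symmetric])
          then show ?thesis using R by (simp add: powr_powr powr_realpow)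
        qed
        have e4: "D powr l = D1 powr l * (R powr \<gamma>) powr l * B powr l" by (simp add: D_def powr_mult)
        have "2 powr l * G powr l * (Al * (R + R') powr (?N - \<kappa> * l))
          = 2 powr l * G1 powr l * a0 * Al * B powr l * ((R powr (?N * (1 - 1 / p))) powr l * R powr (?N - \<kappa> * l))"
          unfolding e1 e2 by (simp only: mult_ac)
        also have "\<dots> = 2 powr l * G1 powr l * a0 * Al * (R ^ CARD('n) * (R powr \<gamma>) powr l * B powr l)"
          unfolding e3 by (simp only: mult_ac)
        finally have t1: "2 powr l * G powr l * (Al * (R + R') powr (?N - \<kappa> * l))
          = 2 powr l * G1 powr l * a0 * Al * (R ^ CARD('n) * (R powr \<gamma>) powr l * B powr l)" .
        have t2: "D powr l * (unit_ball_vol (real DIM(real^'n)) * R ^ DIM(real^'n)) = D1 powr l * V * (R ^ CARD('n) * (R powr \<gamma>) powr l * B powr l)"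
          unfolding e4 by (simp add: V_def)
        have "2 powr l * (2 powr l * G powr l * (Al * (R + R') powr (?N - \<kappa> * l)) + D powr l * (unit_ball_vol (real DIM(real^'n)) * R ^ DIM(real^'n)))
          = Q * (R ^ CARD('n) * (R powr \<gamma>) powr l * B powr l)"
          unfolding t1 t2 Q_def by (simp only: distrib_right distrib_left mult.assoc)
        also have "\<dots> = V * R ^ CARD('n) * (\<Lambda>1 * R powr \<gamma> * B) powr l"
          unfolding \<Lambda>1(2)[symmetric] by (simp add: powr_mult)
        finally show ?thesis .
      qed
      have c': "(\<integral>\<^sup>+x\<in>ball z R. ennreal (norm (T x - c) powr l) \<partial>lebesgue) \<le> ennreal (unit_ball_vol ?N * R ^ CARD('n) * (\<Lambda>1 * R powr \<gamma> * B) powr l)"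
        unfolding nn_integral_completion using c unfolding total V_def .
      have \<Lambda>: "0 < \<Lambda>1 * R powr \<gamma> * B" using \<Lambda>1 R B by simp
      show "set_integrable lebesgue (ball z R) T"
        by (rule mean_oscillation_le(1)[OF Tm R \<Lambda> l(1) c'])
      show "epowr (eavg (ball z R) (\<lambda>x. ennreal (norm (T x - avg (ball z R) T) powr l))) (1 / l) \<le> ennreal (8 * (\<Lambda>1 * R powr \<gamma> * (C * M / W z R)))"
        using mean_oscillation_le(2)[OF Tm R \<Lambda> l(1) c'] unfolding B_def .
    qed
    have "locally_integrable T" by (rule locally_integrable_if_balls) (rule main(1))
    moreover have "campanato_norm \<gamma> l \<omega> T \<le> ennreal (C' * M)"
      unfolding campanato_norm_def
    proof (rule SUP_least)
      fix Ba :: "(real^'n) set" assume "Ba \<in> {ball z R | z R. R > 0}"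
      then obtain z R where Ba: "Ba = ball z R" and R: "0 < R" by auto
      have meas: "measure lebesgue Ba = V * R ^ CARD('n)"
        using R by (simp add: Ba measure_def emeasure_ball V_def)
      have r1: "1 / measure lebesgue Ba powr (\<gamma> / ?N) = V powr (- (\<gamma> / ?N)) * R powr (- \<gamma>)"
      proof -
        have "(R ^ CARD('n)) powr (\<gamma> / ?N) = R powr \<gamma>" using R by (simp add: powr_powr flip: powr_realpow)
        then show ?thesis unfolding meas by (simp add: powr_mult powr_minus divide_inverse)
      qed
      have "esssup_on Ba \<omega> * ennreal (1 / measure lebesgue Ba powr (\<gamma> / ?N)) * epowr (eavg Ba (\<lambda>x. ennreal (norm (T x - avg Ba T) powr l))) (1 / l)
        \<le> ennreal (W z R) * ennreal (V powr (- (\<gamma> / ?N)) * R powr (- \<gamma>)) * ennreal (8 * (\<Lambda>1 * R powr \<gamma> * (C * M / W z R)))"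
        unfolding r1 unfolding Ba by (intro mult_mono W(2)[OF R] main(2)[OF R]) auto
      also have "\<dots> = ennreal (W z R * (V powr (- (\<gamma> / ?N)) * R powr (- \<gamma>)) * (8 * (\<Lambda>1 * R powr \<gamma> * (C * M / W z R))))"
      proof -
        have "ennreal a * ennreal b * ennreal c = ennreal (a * b * c)" if "0 \<le> a" "0 \<le> b" "0 \<le> c" for a b c
          using that by (simp add: ennreal_mult)
        then show ?thesis using W(1)[OF R, of z] \<Lambda>1(1) C M by simp
      qed
      also have "W z R * (V powr (- (\<gamma> / ?N)) * R powr (- \<gamma>)) * (8 * (\<Lambda>1 * R powr \<gamma> * (C * M / W z R))) = C' * M"
      proof -
        have "R powr (- \<gamma>) * R powr \<gamma> = 1" using R by (simp flip: powr_add)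
        moreover have "W z R * (V powr (- (\<gamma> / ?N)) * R powr (- \<gamma>)) * (8 * (\<Lambda>1 * R powr \<gamma> * (C * M / W z R)))
          = (W z R / W z R) * (R powr (- \<gamma>) * R powr \<gamma>) * (C' * M)" by (simp add: C'_def)
        ultimately show ?thesis using W(1)[OF R, of z] by simp
      qed
      finally show "esssup_on Ba \<omega> * ennreal (1 / measure lebesgue Ba powr (\<gamma> / ?N)) * epowr (eavg Ba (\<lambda>x. ennreal (norm (T x - avg Ba T) powr l))) (1 / l) \<le> ennreal (C' * M)" .
    qed
    ultimately show "locally_integrable (T_op \<Omega> \<alpha> f) \<and> campanato_norm \<gamma> l \<omega> (T_op \<Omega> \<alpha> f) \<le> ennreal (C' * M)"
      unfolding Teq by simp
  qed
qed

theorem theorem2p3: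
  fixes \<Omega> :: "real^'n \<Rightarrow> complex" and \<omega> :: "real^'n \<Rightarrow> real"
    and \<alpha> \<beta> \<gamma> p l s' :: real and s :: ennreal
  assumes "CARD('n) \<ge> 2"
    and "0 < \<alpha>" and "\<alpha> < real CARD('n)"
    and "ennreal (real CARD('n) / (real CARD('n) - \<alpha>)) \<le> s"
    and "0 < \<beta>" and "\<beta> \<le> 1"
    and "dini s \<beta> \<Omega>"
    and "\<alpha> < 1 + real CARD('n) / p"
    and "real CARD('n) / \<alpha> < p"
    and "s' = enn2real (conj_exp s)"
    and "weight \<omega>"
    and "(\<lambda>x. \<omega> x powr s') \<in> A_infty (p / s')"
    and "1 \<le> l" and "l < real CARD('n) / (real CARD('n) - \<alpha>)"
    and "\<gamma> = real CARD('n) * (\<alpha> / real CARD('n) - 1 / p)"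
    and "\<gamma> < \<beta>"
  shows "\<exists>C>0. \<forall>f\<in>Lpw p \<omega>.
           T_op \<Omega> \<alpha> f \<in> campanato \<gamma> l \<omega> \<and>
           campanato_norm \<gamma> l \<omega> (T_op \<Omega> \<alpha> f) \<le> ennreal C * Lpw_norm p \<omega> f"
proof -
  have \<gamma>: "\<gamma> = \<alpha> - real CARD('n) / p" using assms(15) by (simp add: algebra_simps)
  have p: "0 < p" using assms(2,3,9) by (smt (verit) divide_pos_pos)
  obtain C where C: "0 < C" and bound: "\<And>f M. f \<in> borel_measurable lebesgue \<Longrightarrow> 0 < M \<Longrightarrow>
      (\<integral>\<^sup>+x. ennreal (norm (f x) powr p * \<omega> x powr p) \<partial>lebesgue) \<le> ennreal (M powr p) \<Longrightarrow>
      locally_integrable (T_op \<Omega> \<alpha> f) \<and> campanato_norm \<gamma> l \<omega> (T_op \<Omega> \<alpha> f) \<le> ennreal (C * M)"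
    using T_op_ball_bound[OF assms(2-7,9-14) \<gamma> assms(16)] by blast
  show ?thesis
  proof (intro exI[of _ C] conjI ballI C)
    fix f assume f: "f \<in> Lpw p \<omega>"
    then have fm: "f \<in> borel_measurable lebesgue" and fin: "Lpw_norm p \<omega> f < top" by (auto simp: Lpw_def)
    define X where "X = (\<integral>\<^sup>+x. ennreal (norm (f x) powr p * \<omega> x powr p) \<partial>lebesgue)"
    have "X \<noteq> top" using fin by (auto simp: Lpw_norm_def X_def epowr_def)
    then obtain x where x: "X = ennreal x" "0 \<le> x" by (cases X) auto
    have N: "Lpw_norm p \<omega> f = ennreal (x powr (1 / p))"
      using x by (simp add: Lpw_norm_def epowr_def flip: X_def)
    have b: "locally_integrable (T_op \<Omega> \<alpha> f) \<and> campanato_norm \<gamma> l \<omega> (T_op \<Omega> \<alpha> f) \<le> ennreal (C * M)"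
      if M: "0 < M" "x powr (1 / p) \<le> M" for M
    proof (rule bound[OF fm M(1)])
      have "x = (x powr (1 / p)) powr p" using x p by (simp add: powr_powr)
      also have "\<dots> \<le> M powr p" using M p by (intro powr_mono2) auto
      finally show "(\<integral>\<^sup>+x. ennreal (norm (f x) powr p * \<omega> x powr p) \<partial>lebesgue) \<le> ennreal (M powr p)"
        unfolding X_def[symmetric] x(1) by (rule ennreal_leI)
    qed
    show le: "campanato_norm \<gamma> l \<omega> (T_op \<Omega> \<alpha> f) \<le> ennreal C * Lpw_norm p \<omega> f"
    proof (rule ennreal_le_epsilon)
      fix \<epsilon> :: real assume \<epsilon>: "0 < \<epsilon>"
      \<comment> \<open>The enlargement by \<open>\<epsilon> / C\<close> covers functions of norm 0, for which the bound needs a positive \<open>M\<close>.\<close>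
      define M where "M = x powr (1 / p) + \<epsilon> / C"
      have "campanato_norm \<gamma> l \<omega> (T_op \<Omega> \<alpha> f) \<le> ennreal (C * M)"
      proof (rule b[THEN conjunct2])
        show "0 < M" unfolding M_def using \<epsilon> C by (intro add_nonneg_pos) auto
        show "x powr (1 / p) \<le> M" using \<epsilon> C by (simp add: M_def)
      qed
      also have "C * M = C * x powr (1 / p) + \<epsilon>" using C by (simp add: M_def distrib_left)
      also have "ennreal \<dots> = ennreal C * Lpw_norm p \<omega> f + ennreal \<epsilon>"
        using C \<epsilon> by (simp add: N ennreal_mult)
      finally show "campanato_norm \<gamma> l \<omega> (T_op \<Omega> \<alpha> f) \<le> ennreal C * Lpw_norm p \<omega> f + ennreal \<epsilon>" .
    qed
    have "campanato_norm \<gamma> l \<omega> (T_op \<Omega> \<alpha> f) < top"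
      by (rule le_less_trans[OF le]) (simp add: N ennreal_mult_less_top)
    moreover have "locally_integrable (T_op \<Omega> \<alpha> f)"
      using b[of "x powr (1 / p) + 1"] by (simp add: add_nonneg_pos)
    ultimately show "T_op \<Omega> \<alpha> f \<in> campanato \<gamma> l \<omega>" by (simp add: campanato_def)
  qed
qed

end
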